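(* For a prime $p$, let $h(p)$ be the number of isomorphism classes of $2$-generated groups of order $p^5$, and let $g(p)$ be the number of isomorphism classes of Beauville groups of order $p^5$. Then $g(p)/h(p)\to 1$ as $p\to\infty$ through the primes; that is, the proportion of $2$-generated groups of order $p^5$ which are Beauville tends to $1$ as $p$ tends to infinity.
   Context: Let $G$ be a finite group with identity $e$. For $x,y\in G$ put $$\Sigma(x,y):=\bigcup_{i=1}^{|G|}\bigcup_{g\in G}\{(x^i)^g,(y^i)^g,((xy)^i)^g\},$$ where $a^g$ denotes the conjugate $g^{-1}ag$. A Beauville structure for $G$ is a pair of generating sets $\{x_1,y_1\},\{x_2,y_2\}$ of $G$ (i.e. $\langle x_1,y_1\rangle=\langle x_2,y_2\rangle=G$) such that $\Sigma(x_1,y_1)\cap\Sigma(x_2,y_2)=\{e\}$. $G$ is a Beauville group if there exists a Beauville structure for $G$. In particular every Beauville group is $2$-generated. A group is $2$-generated if it can be generated by two elements. *)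

theory Defs
  imports "HOL-Algebra.Generated_Groups" "HOL-Computational_Algebra.Primes" Complex_Main
begin

definition conj_by :: "('a, 'b) monoid_scheme \<Rightarrow> 'a \<Rightarrow> 'a \<Rightarrow> 'a" where
  "conj_by G a g = inv\<^bsub>G\<^esub> g \<otimes>\<^bsub>G\<^esub> a \<otimes>\<^bsub>G\<^esub> g"

definition Sigma_set :: "('a, 'b) monoid_scheme \<Rightarrow> 'a \<Rightarrow> 'a \<Rightarrow> 'a set" where
  "Sigma_set G x y = (\<Union>i\<in>{1..order G}. \<Union>g\<in>carrier G.
     {conj_by G (x [^]\<^bsub>G\<^esub> i) g, conj_by G (y [^]\<^bsub>G\<^esub> i) g,
      conj_by G ((x \<otimes>\<^bsub>G\<^esub> y) [^]\<^bsub>G\<^esub> i) g})"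

definition generating_pair :: "('a, 'b) monoid_scheme \<Rightarrow> 'a \<Rightarrow> 'a \<Rightarrow> bool" where
  "generating_pair G x y \<longleftrightarrow>
     x \<in> carrier G \<and> y \<in> carrier G \<and> generate G {x, y} = carrier G"

definition two_generated :: "('a, 'b) monoid_scheme \<Rightarrow> bool" where
  "two_generated G \<longleftrightarrow> (\<exists>x y. generating_pair G x y)"

definition beauville_structure ::
    "('a, 'b) monoid_scheme \<Rightarrow> 'a \<times> 'a \<Rightarrow> 'a \<times> 'a \<Rightarrow> bool" where
  "beauville_structure G = (\<lambda>(x1, y1) (x2, y2).
     generating_pair G x1 y1 \<and> generating_pair G x2 y2 \<and>
     Sigma_set G x1 y1 \<inter> Sigma_set G x2 y2 = {\<one>\<^bsub>G\<^esub>})"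

definition beauville_group :: "('a, 'b) monoid_scheme \<Rightarrow> bool" where
  "beauville_group G \<longleftrightarrow>
     group G \<and> finite (carrier G) \<and> (\<exists>s t. beauville_structure G s t)"

text \<open>Isomorphism classes of finite groups are taken among groups whose carrier is a
  set of natural numbers; every finite group is isomorphic to one of these. There are
  infinitely many such groups of order \<open>n > 0\<close>, but only finitely many classes.\<close>

definition iso_rel :: "(nat monoid \<times> nat monoid) set" where
  "iso_rel = {(G, H). group G \<and> group H \<and> G \<cong> H}"

definition groups_of_order :: "nat \<Rightarrow> nat monoid set" where
  "groups_of_order n = {G. group G \<and> finite (carrier G) \<and> order G = n}"

definition num_two_generated :: "nat \<Rightarrow> nat" where
  "num_two_generated n = card ({G \<in> groups_of_order n. two_generated G} // iso_rel)"

definition num_beauville :: "nat \<Rightarrow> nat" where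
  "num_beauville n = card ({G \<in> groups_of_order n. beauville_group G} // iso_rel)"

end

theory Submission
  imports Defs "HOL-Algebra.Group_Action" "HOL-Number_Theory.Residue_Primitive_Roots"
begin

text \<open>For \<open>p > 5\<close> all but boundedly many two-generated groups of order \<open>p\<^sup>5\<close> are Beauville, whereas
  there are at least \<open>p - 1\<close> two-generated groups. The derived subgroup of such a group has order at
  most \<open>p\<^sup>3\<close>, and in each case suitable generators give a power-commutator presentation all of whose
  exponents are \<open>0\<close> or one of the first four powers of a fixed primitive root modulo \<open>p\<close>. There is
  one exception: derived subgroup of order \<open>p\<^sup>3\<close>, class three, and \<open>p\<close>-th power map injective modulo
  the Frattini subgroup. Then six elements on pairwise different lines modulo the Frattini subgroup have
  \<open>p\<close>-th powers generating six different central subgroups, which gives a Beauville structure. The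
  exceptional case contains a family of \<open>p - 1\<close> groups told apart by the trace and determinant of the
  linear map comparing commutators with \<open>p\<close>-th powers.\<close>

text \<open>Why boundedly many code lists mean boundedly many groups: if two groups of order
  \<open>p^5\<close> satisfy the same coded relations, the pairs of corresponding generators satisfy
  them in the direct product. They generate a subgroup of order at most \<open>p^5\<close> that
  projects onto both factors, so it is the graph of an isomorphism. Why four powers of a primitive
  root suffice: replacing \<open>x\<close>, \<open>y\<close> by \<open>x^a\<close>,
  \<open>y^f\<close> multiplies the structure constants by monomials in \<open>a\<close> and
  \<open>f\<close>. After the free choices are spent, what is left is a class modulo squares, cubes
  or fourth powers. The exceptional case resists this, since a linear map between planes has
  invariants that scaling cannot remove. It is also the case where the \<open>p\<close>-th powers of
  independent generators stay independent, which is what a Beauville structure wants. Six suitable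
  lines have determinants of absolute value at most \<open>5\<close>, hence \<open>p > 5\<close>.
  Whether a group with a bounded presentation is Beauville is left open; only the number of such
  groups enters the limit.\<close>

section \<open>Groups as a type class, with products and permutations as instances\<close>

class grp = monoid_mult +
  fixes ginv :: "'a \<Rightarrow> 'a"
  assumes ginv_left [simp]: "ginv a * a = 1"
begin

lemma ginv_left_assoc [simp]: "ginv a * (a * b) = b"
  by (simp flip: mult.assoc)

lemma ginv_right [simp]: "a * ginv a = 1"
proof -
  have "a * ginv a = ginv (ginv a) * (ginv a * (a * ginv a))"
    by (rule ginv_left_assoc[symmetric])
  also have "\<dots> = 1"
    by simp
  finally show ?thesis .
qed

lemma ginv_right_assoc [simp]: "a * (ginv a * b) = b"
  by (simp flip: mult.assoc)

lemma grp_left_cancel [simp]: "a * b = a * c \<longleftrightarrow> b = c"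
  by (metis ginv_left_assoc)

lemma grp_right_cancel [simp]: "b * a = c * a \<longleftrightarrow> b = c"
  by (metis ginv_right mult.assoc mult_1_right)

lemma grp_left_cancel_one [simp]: "a * b = a \<longleftrightarrow> b = 1" "a = a * b \<longleftrightarrow> b = 1"
  by (metis grp_left_cancel mult_1_right)+

lemma ginv_unique: "a * b = 1 \<Longrightarrow> ginv a = b"
  by (metis ginv_left_assoc mult_1_right)

lemma ginv_ginv [simp]: "ginv (ginv a) = a"
  by (rule ginv_unique) simp

lemma ginv_one [simp]: "ginv 1 = 1"
  by (rule ginv_unique) simp

lemma ginv_mult: "ginv (a * b) = ginv b * ginv a"
  by (rule ginv_unique) (simp add: mult.assoc)

lemma eq_mult_ginv_iff: "a = b * ginv c \<longleftrightarrow> a * c = b"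
  by (auto simp: mult.assoc)

end

text \<open>Products house the pairs of generators by which two groups with the same presentation
  are compared.\<close>

instantiation prod :: (grp, grp) grp
begin

definition times_prod_def: "u * v = (fst u * fst v, snd u * snd v)"
definition one_prod_def: "1 = (1, 1)"
definition ginv_prod_def: "ginv u = (ginv (fst u), ginv (snd u))"

instance
  by standard (simp_all add: times_prod_def one_prod_def ginv_prod_def mult.assoc)

end

lemma fst_times [simp]: "fst (u * v) = fst u * fst (v :: 'a::grp \<times> 'b::grp)"
  and snd_times [simp]: "snd (u * v) = snd u * snd v"
  and fst_one [simp]: "fst (1 :: 'a \<times> 'b) = 1"
  and snd_one [simp]: "snd (1 :: 'a \<times> 'b) = 1"
  and fst_ginv [simp]: "fst (ginv u) = ginv (fst u)"
  and snd_ginv [simp]: "snd (ginv u) = ginv (snd u)"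
  by (simp_all add: times_prod_def one_prod_def ginv_prod_def)

lemma fst_pow [simp]: "fst (u ^ n) = fst (u :: 'a::grp \<times> 'b::grp) ^ n"
  and snd_pow [simp]: "snd (u ^ n) = snd u ^ n"
  by (induction n) simp_all

text \<open>A common host: a group on a carrier set enters through its left translations, a quotient
  through the translations of cosets.\<close>

typedef 'a sym = "{f :: 'a \<Rightarrow> 'a. bij f}"
  morphisms app Sym by (rule exI[of _ id]) simp

setup_lifting type_definition_sym

instantiation sym :: (type) grp
begin

lift_definition times_sym :: "'a sym \<Rightarrow> 'a sym \<Rightarrow> 'a sym" is "\<lambda>f g. f \<circ> g"
  by (rule bij_comp)
lift_definition one_sym :: "'a sym" is id by simp
lift_definition ginv_sym :: "'a sym \<Rightarrow> 'a sym" is "inv_into UNIV"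
  by (rule bij_imp_bij_inv)

instance
  by standard (transfer; simp add: fun_eq_iff bij_is_inj)+

end

section \<open>Subgroups of a type-class group\<close>

definition subgrp :: "'a::grp set \<Rightarrow> bool" where
  "subgrp H \<longleftrightarrow> 1 \<in> H \<and> (\<forall>a\<in>H. \<forall>b\<in>H. a * b \<in> H) \<and> (\<forall>a\<in>H. ginv a \<in> H)"

lemma sg_one: "subgrp H \<Longrightarrow> 1 \<in> H"
  and sg_mult: "subgrp H \<Longrightarrow> a \<in> H \<Longrightarrow> b \<in> H \<Longrightarrow> a * b \<in> H"
  and sg_ginv: "subgrp H \<Longrightarrow> a \<in> H \<Longrightarrow> ginv a \<in> H"
  by (auto simp: subgrp_def)

lemma sg_pow: "subgrp H \<Longrightarrow> a \<in> H \<Longrightarrow> a ^ n \<in> H"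
  by (induction n) (auto simp: sg_one sg_mult)

lemmas sg_closed = sg_one sg_mult sg_ginv sg_pow

lemma sg_mult_cancel_left: "subgrp H \<Longrightarrow> a \<in> H \<Longrightarrow> a * b \<in> H \<longleftrightarrow> b \<in> H"
  by (metis ginv_left_assoc sg_ginv sg_mult)

lemma sg_mult_cancel_right: "subgrp H \<Longrightarrow> b \<in> H \<Longrightarrow> a * b \<in> H \<longleftrightarrow> a \<in> H"
  using sg_mult[of H "a * b" "ginv b"] by (auto simp: mult.assoc sg_ginv sg_mult)

lemma sg_one_set [simp]: "subgrp {1}"
  by (simp add: subgrp_def)

text \<open>Bridge to the record-based groups, from which Lagrange's theorem and the
  orbit-stabilizer theorem are taken.\<close>

definition as_monoid :: "'a::grp set \<Rightarrow> 'a monoid" where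
  "as_monoid H = \<lparr>carrier = H, monoid.mult = (*), one = 1\<rparr>"

lemma mon_simps [simp]: "carrier (as_monoid H) = H" "x \<otimes>\<^bsub>as_monoid H\<^esub> y = x * y" "\<one>\<^bsub>as_monoid H\<^esub> = 1"
  by (simp_all add: as_monoid_def)

lemma mon_group: "subgrp H \<Longrightarrow> group (as_monoid H)"
proof (rule groupI)
  fix x assume "subgrp H" "x \<in> carrier (as_monoid H)"
  thus "\<exists>y\<in>carrier (as_monoid H). y \<otimes>\<^bsub>as_monoid H\<^esub> x = \<one>\<^bsub>as_monoid H\<^esub>"
    by (intro bexI[of _ "ginv x"]) (auto simp: sg_ginv)
qed (auto simp: subgrp_def mult.assoc)

lemma mon_inv: "subgrp H \<Longrightarrow> a \<in> H \<Longrightarrow> inv\<^bsub>as_monoid H\<^esub> a = ginv a"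
  by (rule group.inv_equality[OF mon_group]) (auto simp: subgrp_def)

lemma mon_pow [simp]: "x [^]\<^bsub>as_monoid H\<^esub> (n::nat) = x ^ n"
  by (induction n) (simp_all add: nat_pow_def power_commutes)

lemma mon_subgroup: "subgrp H \<Longrightarrow> subgrp K \<Longrightarrow> K \<subseteq> H \<Longrightarrow> subgroup K (as_monoid H)"
  by (rule subgroup.intro) (auto simp: subgrp_def mon_inv)

lemma card_sg_dvd: "subgrp H \<Longrightarrow> subgrp K \<Longrightarrow> K \<subseteq> H \<Longrightarrow> card K dvd card H"
  using group.lagrange[OF mon_group mon_subgroup, of H K]
  by (metis Coset.order_def dvd_triv_right mon_simps(1))

lemma pow_card_sg: "subgrp H \<Longrightarrow> finite H \<Longrightarrow> a \<in> H \<Longrightarrow> a ^ card H = 1"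
  using group.pow_order_eq_1[OF mon_group, of H a] by (simp add: Coset.order_def)

section \<open>Generated subgroups, normal subgroups, homomorphisms and quotients\<close>

definition gen :: "'a::grp set \<Rightarrow> 'a set" where
  "gen A = \<Inter>{H. subgrp H \<and> A \<subseteq> H}"

lemma sg_gen [simp]: "subgrp (gen A)"
  by (auto simp: gen_def subgrp_def)

lemma gen_incl: "A \<subseteq> gen A"
  by (auto simp: gen_def)

lemma gen_least: "subgrp H \<Longrightarrow> A \<subseteq> H \<Longrightarrow> gen A \<subseteq> H"
  by (auto simp: gen_def)

lemma gen_mem: "a \<in> A \<Longrightarrow> a \<in> gen A"
  using gen_incl by blast

lemma gen_eqI: "subgrp S \<Longrightarrow> gen A = S \<Longrightarrow> A \<subseteq> gen B \<Longrightarrow> B \<subseteq> S \<Longrightarrow> gen B = S"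
  by (metis gen_least sg_gen subset_antisym)

text \<open>Inverses come from closure under products: \<open>a ^ card F = 1\<close>, so the inverse
  of \<open>a\<close> is a power of \<open>a\<close>.\<close>

lemma finite_sgI:
  assumes "finite F" "H \<subseteq> F" "subgrp F" "1 \<in> H" "\<And>a b. a \<in> H \<Longrightarrow> b \<in> H \<Longrightarrow> a * b \<in> H"
  shows "subgrp H"
proof -
  have "ginv a \<in> H" if a: "a \<in> H" for a
  proof -
    have pw: "a ^ n \<in> H" for n
      by (induction n) (use assms a in auto)
    have F: "a ^ card F = 1" "card F > 0"
      using pow_card_sg[of F a] assms a by (auto simp: card_gt_0_iff)
    hence "a * a ^ (card F - 1) = 1"
      by (metis Suc_pred' power_Suc)
    hence "ginv a = a ^ (card F - 1)"
      by (rule ginv_unique)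
    thus ?thesis using pw by simp
  qed
  thus ?thesis using assms by (auto simp: subgrp_def)
qed

definition normal_sub :: "'a::grp set \<Rightarrow> 'a set \<Rightarrow> bool" where
  "normal_sub N S \<longleftrightarrow> subgrp N \<and> N \<subseteq> S \<and> (\<forall>n\<in>N. \<forall>s\<in>S. ginv s * n * s \<in> N)"

lemma nrm_sg: "normal_sub N S \<Longrightarrow> subgrp N"
  and nrm_subset: "normal_sub N S \<Longrightarrow> N \<subseteq> S"
  and nrm_conj: "normal_sub N S \<Longrightarrow> n \<in> N \<Longrightarrow> s \<in> S \<Longrightarrow> ginv s * n * s \<in> N"
  by (auto simp: normal_sub_def)

lemma nrm_conj': "subgrp S \<Longrightarrow> normal_sub N S \<Longrightarrow> n \<in> N \<Longrightarrow> s \<in> S \<Longrightarrow> s * n * ginv s \<in> N"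
  using nrm_conj[of N S n "ginv s"] by (simp add: sg_ginv)

definition ghom :: "'a::grp set \<Rightarrow> ('a \<Rightarrow> 'b::grp) \<Rightarrow> bool" where
  "ghom S f \<longleftrightarrow> (\<forall>a\<in>S. \<forall>b\<in>S. f (a * b) = f a * f b)"

lemma ghom_mult: "ghom S f \<Longrightarrow> a \<in> S \<Longrightarrow> b \<in> S \<Longrightarrow> f (a * b) = f a * f b"
  by (simp add: ghom_def)

lemma ghom_one: "ghom S f \<Longrightarrow> subgrp S \<Longrightarrow> f 1 = 1"
  using ghom_mult[of S f 1 1] by (simp add: sg_one)

lemma ghom_ginv: "ghom S f \<Longrightarrow> subgrp S \<Longrightarrow> a \<in> S \<Longrightarrow> f (ginv a) = ginv (f a)"
  using ghom_mult[of S f a "ginv a"] ghom_one[of S f]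
  by (simp add: sg_ginv ginv_unique)

lemma ghom_pow: "ghom S f \<Longrightarrow> subgrp S \<Longrightarrow> a \<in> S \<Longrightarrow> f (a ^ n) = f a ^ n"
  by (induction n) (auto simp: ghom_one ghom_mult sg_pow)

lemma ghom_image_sg:
  assumes f: "ghom S f" and S: "subgrp S" and K: "subgrp K" "K \<subseteq> S"
  shows "subgrp (f ` K)"
proof -
  have "1 \<in> f ` K"
    using ghom_one[OF f S] sg_one[OF K(1)] by (metis imageI)
  moreover have "f u * f v \<in> f ` K" if "u \<in> K" "v \<in> K" for u v
    using that K ghom_mult[OF f, of u v] sg_mult[OF K(1), of u v] by (metis imageI subsetD)
  moreover have "ginv (f u) \<in> f ` K" if "u \<in> K" for u
    using that K ghom_ginv[OF f S, of u] sg_ginv[OF K(1), of u] by (metis imageI subsetD)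
  ultimately show ?thesis by (auto simp: subgrp_def)
qed

lemma ghom_vimage_sg: "ghom S f \<Longrightarrow> subgrp S \<Longrightarrow> subgrp L \<Longrightarrow> subgrp {s \<in> S. f s \<in> L}"
  by (auto simp: subgrp_def[of "{s \<in> S. f s \<in> L}"] ghom_one ghom_mult ghom_ginv sg_closed)

lemma ghom_gen:
  assumes "ghom S f" "subgrp S" "A \<subseteq> S"
  shows "f ` gen A = gen (f ` A)"
proof
  have "gen A \<subseteq> {s \<in> S. f s \<in> gen (f ` A)}"
    by (rule gen_least[OF ghom_vimage_sg]) (use assms gen_mem[of _ "f ` A"] in auto)
  thus "f ` gen A \<subseteq> gen (f ` A)" by auto
  show "gen (f ` A) \<subseteq> f ` gen A"
    by (rule gen_least) (use assms gen_incl gen_least[of S A] in \<open>auto intro!: ghom_image_sg[of S]\<close>)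
qed

text \<open>The quotient by a normal subgroup \<open>N\<close> is realised by the left translations of the
  cosets of \<open>N\<close>, so that it lives in the type of permutations of sets.\<close>

lemma quotient_hom:
  assumes S: "subgrp S" and N: "normal_sub N S"
  obtains f :: "'a::grp \<Rightarrow> 'a set sym" where "ghom S f" "\<And>s. s \<in> S \<Longrightarrow> f s = 1 \<longleftrightarrow> s \<in> N"
proof
  define \<Omega> where "\<Omega> = (\<lambda>t. (*) t ` N) ` S"
  \<comment> \<open>Fixing every set outside \<Omega> makes the action a permutation of the whole
    type.\<close>
  define \<phi> where "\<phi> s X = (if X \<in> \<Omega> then (*) s ` X else X)" for s X
  have \<Omega>: "(*) s ` X \<in> \<Omega>" if "s \<in> S" "X \<in> \<Omega>" for s X
  proof -
    from that(2) obtain t where t: "t \<in> S" "X = (*) t ` N" by (auto simp: \<Omega>_def)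
    have "(*) s ` X = (*) (s * t) ` N" by (simp add: t image_image mult.assoc)
    thus ?thesis using sg_mult[OF S that(1) t(1)] by (auto simp: \<Omega>_def)
  qed
  have comp: "\<phi> (s * t) = \<phi> s \<circ> \<phi> t" if "s \<in> S" "t \<in> S" for s t
    using that \<Omega> by (auto simp: \<phi>_def fun_eq_iff image_image mult.assoc)
  have one: "\<phi> 1 = id"
    by (auto simp: \<phi>_def fun_eq_iff)
  have bij: "bij (\<phi> s)" if "s \<in> S" for s
    by (rule o_bij[of "\<phi> (ginv s)"])
      (use comp[of s "ginv s"] comp[of "ginv s" s] that S one in \<open>simp_all add: sg_ginv\<close>)
  show "ghom S (\<lambda>s. Sym (\<phi> s))"
    unfolding ghom_def using bij comp S
    by (simp add: times_sym_def Sym_inverse)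
  fix s assume s: "s \<in> S"
  have "Sym (\<phi> s) = 1 \<longleftrightarrow> \<phi> s = id"
    unfolding one_sym_def using bij[OF s] by (auto simp: Sym_inject)
  also have "\<dots> \<longleftrightarrow> (\<forall>X\<in>\<Omega>. (*) s ` X = X)"
    unfolding \<phi>_def fun_eq_iff id_apply by meson
  also have "\<dots> \<longleftrightarrow> (\<forall>t\<in>S. (*) s ` (*) t ` N = (*) t ` N)"
    by (simp add: \<Omega>_def)
  also have "\<dots> \<longleftrightarrow> s \<in> N"
  proof
    assume "\<forall>t\<in>S. (*) s ` (*) t ` N = (*) t ` N"
    \<comment> \<open>The coset \<open>N\<close> itself decides: it contains \<open>1\<close>, so if
      translation by \<open>s\<close> fixes it, then \<open>s\<close> lies in it.\<close>
    from bspec[OF this sg_one[OF S]] have "(*) s ` N = N" by (simp add: image_image)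
    thus "s \<in> N" using sg_one[OF nrm_sg[OF N]] by force
  next
    assume sN: "s \<in> N"
    show "\<forall>t\<in>S. (*) s ` (*) t ` N = (*) t ` N"
    proof
      fix t assume t: "t \<in> S"
      have *: "ginv t * s * t \<in> N" using N sN t by (rule nrm_conj)
      have "(*) (ginv t * s * t) ` N = N"
      proof
        show "(*) (ginv t * s * t) ` N \<subseteq> N"
          using * nrm_sg[OF N] by (auto simp: sg_mult)
        show "N \<subseteq> (*) (ginv t * s * t) ` N"
        proof
          fix n assume "n \<in> N"
          hence "ginv (ginv t * s * t) * n \<in> N"
            using * nrm_sg[OF N] by (auto simp: sg_mult sg_ginv)
          thus "n \<in> (*) (ginv t * s * t) ` N"
            by (rule image_eqI[rotated]) simp
        qed
      qed
      hence "(*) t ` (*) (ginv t * s * t) ` N = (*) t ` N" by simp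
      thus "(*) s ` (*) t ` N = (*) t ` N" by (simp add: image_image mult.assoc)
    qed
  qed
  finally show "Sym (\<phi> s) = 1 \<longleftrightarrow> s \<in> N" .
qed

lemma sg_centralizer: "subgrp S \<Longrightarrow> subgrp {s \<in> S. s * a = a * s}"
proof -
  assume S: "subgrp S"
  have "ginv s * a = a * ginv s" if "s * a = a * s" for s
  proof -
    have "s * (a * ginv s) = s * a * ginv s" by (simp add: mult.assoc)
    also have "\<dots> = s * (ginv s * a)" by (simp only: that) (simp add: mult.assoc)
    finally show ?thesis by (simp only: grp_left_cancel)
  qed
  moreover have "s * t * a = a * (s * t)" if "s * a = a * s" "t * a = a * t" for s t
    using that by (metis mult.assoc)
  ultimately show ?thesis
    using S by (auto simp: subgrp_def)
qed

text \<open>Centralizers are subgroups, so commuting with both generators spreads to the whole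
  image, first in one argument and then in the other.\<close>

lemma ghom_commute_gen2:
  assumes f: "ghom S f" and S: "subgrp S" "gen {x, y} = S" and xy: "f x * f y = f y * f x"
    and s: "s \<in> S" and t: "t \<in> S"
  shows "f s * f t = f t * f s"
proof -
  have xyS: "x \<in> S" "y \<in> S" using gen_mem[of _ "{x, y}"] S by auto
  have fS: "subgrp (f ` S)" using ghom_image_sg[OF f S(1) S(1)] by simp
  have *: "S \<subseteq> {s \<in> S. f s \<in> {w \<in> f ` S. w * a = a * w}}"
    if "f x * a = a * f x" "f y * a = a * f y" for a
    using gen_least[OF ghom_vimage_sg[OF f S(1) sg_centralizer[OF fS, of a]], of "{x, y}"]
      S that xyS by auto
  have "f s * f x = f x * f s" if "s \<in> S" for s using *[of "f x"] xy that by auto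
  moreover have "f s * f y = f y * f s" if "s \<in> S" for s using *[of "f y"] xy that by auto
  ultimately show ?thesis using *[of "f t"] s t by auto
qed

text \<open>All fibres over the image are translates of the kernel.\<close>

lemma card_ghom:
  assumes f: "ghom S f" and S: "subgrp S" and K: "subgrp K" "K \<subseteq> S" "finite K"
  shows "card K = card (f ` K) * card {u \<in> K. f u = 1}"
proof -
  have "card {u \<in> K. f u = w} = card {u \<in> K. f u = 1}" if w: "w \<in> f ` K" for w
  proof -
    from w obtain v where v: "v \<in> K" "w = f v" by auto
    have "bij_betw ((*) v) {u \<in> K. f u = 1} {u \<in> K. f u = w}"
    proof (rule bij_betwI[where g = "(*) (ginv v)"])
      show "(*) v \<in> {u \<in> K. f u = 1} \<rightarrow> {u \<in> K. f u = w}"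
        using v K by (auto simp: sg_mult ghom_mult[OF f] subset_iff)
      show "(*) (ginv v) \<in> {u \<in> K. f u = w} \<rightarrow> {u \<in> K. f u = 1}"
        using v K S by (auto simp: sg_mult sg_ginv ghom_mult[OF f] ghom_ginv[OF f S] subset_iff)
    qed simp_all
    from bij_betw_same_card[OF this] show ?thesis by simp
  qed
  moreover have "card K = (\<Sum>w\<in>f ` K. card {u \<in> K. f u = w})"
    using sum.group[of K "f ` K" f "\<lambda>_. 1::nat"] K by simp
  ultimately show ?thesis by simp
qed

text \<open>Any positive exponent \<open>n\<close> that kills \<open>b\<close> will do; the inverse
  of \<open>b ^ i\<close> is then \<open>b ^ (n * i - i)\<close>, again a power.\<close>

lemma gen_single:
  assumes "b ^ n = 1" "n > 0"
  shows "gen {b} = (\<lambda>i. b ^ i) ` {..<n}"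
proof
  have mod: "b ^ i = b ^ (i mod n)" for i
  proof -
    have "b ^ i = b ^ (n * (i div n) + i mod n)" by simp
    also have "\<dots> = b ^ (i mod n)"
      by (simp only: power_add power_mult assms(1) power_one mult_1_left)
    finally show ?thesis .
  qed
  have mem: "b ^ i \<in> (\<lambda>i. b ^ i) ` {..<n}" for i
    using assms(2) mod[of i] imageI[of "i mod n" "{..<n}" "\<lambda>i. b ^ i"] by simp
  have inv: "ginv (b ^ i) = b ^ (n * i - i)" for i
  proof (rule ginv_unique)
    have "i + (n * i - i) = n * i" using assms(2) by (cases n) auto
    thus "b ^ i * b ^ (n * i - i) = 1" using assms(1) by (simp add: power_mult flip: power_add)
  qed
  have "subgrp ((\<lambda>i. b ^ i) ` {..<n})"
    unfolding subgrp_def using mem[of 0] mem by (auto simp: inv simp flip: power_add)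
  moreover have "{b} \<subseteq> (\<lambda>i. b ^ i) ` {..<n}" using mem[of 1] by simp
  ultimately show "gen {b} \<subseteq> (\<lambda>i. b ^ i) ` {..<n}"
    by (rule gen_least)
  show "(\<lambda>i. b ^ i) ` {..<n} \<subseteq> gen {b}"
    using gen_mem[of b "{b}"] by (auto intro!: sg_pow)
qed

section \<open>Central elements and central series of finite \<open>p\<close>-groups\<close>

text \<open>The last nontrivial iterate of the \<open>p\<close>-th power map has order
  \<open>p\<close>.\<close>

lemma pow_prime_step:
  assumes "a ^ (p ^ n) = (1::'a::monoid_mult)" "a \<noteq> 1"
  obtains k where "a ^ (p ^ k) \<noteq> 1" "(a ^ (p ^ k)) ^ p = 1"
proof -
  define l where "l = (LEAST l. a ^ (p ^ l) = 1)"
  have l: "a ^ (p ^ l) = 1" unfolding l_def by (rule LeastI[of _ n]) (rule assms)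
  hence "l \<noteq> 0" using assms(2) by (cases l) auto
  then obtain k where k: "l = Suc k" by (cases l) auto
  have "a ^ (p ^ k) \<noteq> 1" using not_less_Least[of k "\<lambda>l. a ^ (p ^ l) = 1"] k l_def by auto
  moreover have "(a ^ (p ^ k)) ^ p = 1" using l k by (simp add: mult.commute flip: power_mult)
  ultimately show ?thesis by (rule that)
qed

lemma card_conj_class_dvd:
  fixes Q :: "'a::grp set"
  assumes "subgrp Q" "finite Q" "x \<in> Q"
  shows "card ((\<lambda>q. q * x * ginv q) ` Q) dvd card Q"
proof -
  interpret group "as_monoid Q" by (rule mon_group) fact
  interpret group_action "as_monoid Q" "carrier (as_monoid Q)"
      "\<lambda>g. \<lambda>h\<in>carrier (as_monoid Q). g \<otimes>\<^bsub>as_monoid Q\<^esub> h \<otimes>\<^bsub>as_monoid Q\<^esub> inv\<^bsub>as_monoid Q\<^esub> g"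
    by (rule action_by_conjugation)
  have "orbit (as_monoid Q) (\<lambda>g. \<lambda>h\<in>carrier (as_monoid Q). g \<otimes>\<^bsub>as_monoid Q\<^esub> h \<otimes>\<^bsub>as_monoid Q\<^esub> inv\<^bsub>as_monoid Q\<^esub> g) x
      = (\<lambda>q. q * x * ginv q) ` Q"
  proof -
    have "q * x * ginv q = q * x * inv\<^bsub>as_monoid Q\<^esub> q" if "q \<in> Q" for q
      using mon_inv[OF assms(1) that] by simp
    thus ?thesis using assms(3) by (auto simp: orbit_def)
  qed
  with orbit_stabilizer_theorem[of x] assms(3) show ?thesis
    by (simp add: Coset.order_def) (rule dvdI[OF sym], assumption)
qed

text \<open>Class equation inside \<open>M\<close>: if \<open>M\<close> met the centre only in
  \<open>1\<close>, every conjugacy class in \<open>M - {1}\<close> would have a size divisible by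
  \<open>p\<close>, and so would \<open>card M - 1\<close>, whereas \<open>p\<close> divides
  \<open>card M\<close>.\<close>

lemma central_element:
  fixes Q :: "'a::grp set"
  assumes Q: "subgrp Q" "finite Q" "card Q = p ^ n" "prime p" and M: "normal_sub M Q" "M \<noteq> {1}"
  obtains m where "m \<in> M" "m \<noteq> 1" "\<And>q. q \<in> Q \<Longrightarrow> q * m = m * q"
proof (rule ccontr)
  note main = that
  assume no: "\<not> thesis"
  have *: False if "m \<in> M" "m \<noteq> 1" "\<And>q. q \<in> Q \<Longrightarrow> q * m = m * q" for m
    using main[OF that] no by blast
  define orb where "orb x = (\<lambda>q. q * x * ginv q) ` Q" for x
  have M1: "1 \<in> M" "subgrp M" "M \<subseteq> Q" "finite M"
    using M(1) Q(2) by (auto simp: normal_sub_def subgrp_def intro: finite_subset)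
  have self: "x \<in> orb x" for x
    using sg_one[OF Q(1)] by (force simp: orb_def)
  have sub: "orb x \<subseteq> M - {1}" if "x \<in> M - {1}" for x
  proof
    fix z assume "z \<in> orb x"
    then obtain q where q: "q \<in> Q" "z = q * x * ginv q" by (auto simp: orb_def)
    have "z \<in> M" using nrm_conj'[OF Q(1) M(1)] that q by auto
    moreover have "z \<noteq> 1"
    proof
      assume "z = 1"
      hence "ginv q * (q * x * ginv q) * q = 1" using q by simp
      thus False using that by (simp add: mult.assoc)
    qed
    ultimately show "z \<in> M - {1}" by auto
  qed
  have dvd: "p dvd card (orb x)" if x: "x \<in> M - {1}" for x
  proof -
    have "x \<in> Q" using x M1 by auto
    hence "card (orb x) dvd p ^ n"
      using card_conj_class_dvd[OF Q(1,2)] Q(3) by (simp add: orb_def)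
    then obtain k where k: "card (orb x) = p ^ k"
      using Q(4) by (meson divides_primepow_nat)
    have "k \<noteq> 0"
    proof
      assume "k = 0"
      hence "orb x = {x}" using k self[of x] by (auto simp: card_1_singleton_iff)
      hence "q * x * ginv q = x" if "q \<in> Q" for q using that by (auto simp: orb_def)
      hence "q * x = x * q" if "q \<in> Q" for q
        using that by (metis eq_mult_ginv_iff)
      thus False using *[of x] x by auto
    qed
    thus ?thesis using k by (cases k) auto
  qed
  have symm: "orb x = orb y" if "z \<in> orb x" "z \<in> orb y" for x y z
  proof -
    have eq: "orb u = orb v" if uv: "u \<in> orb v" for u v
    proof -
      obtain q where q: "q \<in> Q" "u = q * v * ginv q" using uv by (auto simp: orb_def)
      have "orb u \<subseteq> orb v"
      proof
        fix w assume "w \<in> orb u"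
        then obtain r where r: "r \<in> Q" "w = r * u * ginv r" by (auto simp: orb_def)
        have "w = (r * q) * v * ginv (r * q)" by (simp add: r q ginv_mult mult.assoc)
        thus "w \<in> orb v" using sg_mult[OF Q(1) r(1) q(1)] by (auto simp: orb_def)
      qed
      moreover have "orb v \<subseteq> orb u"
      proof
        fix w assume "w \<in> orb v"
        then obtain r where r: "r \<in> Q" "w = r * v * ginv r" by (auto simp: orb_def)
        have "w = (r * ginv q) * u * ginv (r * ginv q)" by (simp add: r q ginv_mult mult.assoc)
        thus "w \<in> orb u" using sg_mult[OF Q(1) r(1) sg_ginv[OF Q(1) q(1)]] by (auto simp: orb_def)
      qed
      ultimately show ?thesis by auto
    qed
    show ?thesis using eq[of z x] eq[of z y] that by simp
  qed
  have "p dvd card (\<Union>(orb ` (M - {1})))"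
  proof (rule dvd_partition)
    show "finite (\<Union> (orb ` (M - {1})))"
      using sub M1(4) by (meson UN_least finite_Diff finite_subset)
    show "\<forall>c\<in>orb ` (M - {1}). p dvd card c" using dvd by auto
    show "\<forall>c1\<in>orb ` (M - {1}). \<forall>c2\<in>orb ` (M - {1}). c1 \<noteq> c2 \<longrightarrow> c1 \<inter> c2 = {}"
      using symm by blast
  qed
  moreover have "\<Union>(orb ` (M - {1})) = M - {1}" using sub self by blast
  ultimately have 1: "p dvd card (M - {1})" by simp
  have "card M dvd p ^ n" using card_sg_dvd[OF Q(1) M1(2,3)] Q(3) by simp
  then obtain k where k: "card M = p ^ k" using Q(4) by (meson divides_primepow_nat)
  have "k \<noteq> 0" using k M1(1) M(2) by (auto simp: card_1_singleton_iff)
  hence "p dvd card M" using k by (cases k) auto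
  moreover have "card M = Suc (card (M - {1}))"
    using M1(1,4) by (metis card_Suc_Diff1)
  ultimately have "p dvd 1" using 1 by (metis Suc_eq_plus1 dvd_add_right_iff)
  thus False using Q(4) by (auto dest: not_prime_unit)
qed

text \<open>Take \<open>M\<close> maximal among the normal subgroups of \<open>S\<close> properly
  inside \<open>N\<close>. Modulo \<open>M\<close> some central element of order \<open>p\<close>
  lies in the image of \<open>N\<close>; the subgroup it generates pulls back to a larger normal
  subgroup, which by maximality is \<open>N\<close>. So \<open>N\<close> is central of order
  \<open>p\<close> modulo \<open>M\<close>.\<close>

lemma central_series_step:
  fixes S :: "'a::grp set"
  assumes S: "subgrp S" "finite S" "card S = p ^ n" "prime p" and N: "normal_sub N S" "N \<noteq> {1}"
  obtains M where "normal_sub M S" "M \<subseteq> N" "card N = p * card M"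
    "\<And>u s. u \<in> N \<Longrightarrow> s \<in> S \<Longrightarrow> \<exists>w\<in>M. u * s = s * u * w"
proof -
  have N1: "1 \<in> N" "subgrp N" "N \<subseteq> S" "finite N"
    using N(1) S(2) by (auto simp: normal_sub_def subgrp_def intro: finite_subset)
  define \<M> where "\<M> = {M. normal_sub M S \<and> M \<subset> N}"
  have "{1} \<in> \<M>" using N N1 by (auto simp: \<M>_def normal_sub_def)
  moreover have "finite \<M>"
    by (rule finite_subset[of _ "Pow N"]) (use N1(4) in \<open>auto simp: \<M>_def\<close>)
  ultimately have "Max (card ` \<M>) \<in> card ` \<M>" "\<forall>k\<in>card ` \<M>. k \<le> Max (card ` \<M>)"
    using Max_in[of "card ` \<M>"] Max_ge[of "card ` \<M>"] by blast+
  then obtain M where M: "M \<in> \<M>" "\<And>M'. M' \<in> \<M> \<Longrightarrow> card M' \<le> card M"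
    by auto
  hence MS: "normal_sub M S" "M \<subset> N" by (auto simp: \<M>_def)
  obtain f :: "'a \<Rightarrow> 'a set sym" where f: "ghom S f" "\<And>s. s \<in> S \<Longrightarrow> f s = 1 \<longleftrightarrow> s \<in> M"
    using quotient_hom[OF S(1) MS(1)] by blast
  define Q where "Q = f ` S"
  have Q: "subgrp Q" "finite Q" unfolding Q_def using ghom_image_sg[OF f(1) S(1) S(1)] S(2) by auto
  have "card Q dvd p ^ n"
    using card_ghom[OF f(1) S(1) S(1)] S(2,3) unfolding Q_def by (metis dvd_triv_left subset_refl)
  then obtain m where m: "card Q = p ^ m" using S(4) by (meson divides_primepow_nat)
  have fN: "normal_sub (f ` N) Q"
  proof -
    have "ginv (f s) * f u * f s \<in> f ` N" if "u \<in> N" "s \<in> S" for u s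
    proof -
      have "ginv (f s) * f u * f s = f (ginv s * u * s)"
        using that N1(3) S(1) f(1) by (simp add: ghom_mult ghom_ginv sg_closed subset_iff)
      thus ?thesis using nrm_conj[OF N(1) that] by auto
    qed
    thus ?thesis
      using ghom_image_sg[OF f(1) S(1) N1(2,3)] N1(3) by (auto simp: normal_sub_def Q_def)
  qed
  \<comment> \<open>The preimage of the subgroup generated by \<open>b\<close> is normal and
    strictly larger than \<open>M\<close>, so maximality makes it all of \<open>N\<close>.\<close>
  have key: "u \<in> {v \<in> N. f v \<in> gen {b}}"
    if b: "b \<in> f ` N" "b \<noteq> 1" "\<And>q. q \<in> Q \<Longrightarrow> q * b = b * q" and u: "u \<in> N" for b u
  proof -
    let ?B = "{v \<in> N. f v \<in> gen {b}}"
    have cen: "g * q = q * g" if "g \<in> gen {b}" "q \<in> Q" for g q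
    proof -
      have "b \<in> Q" using b(1) N1(3) by (auto simp: Q_def)
      hence "gen {b} \<subseteq> {s \<in> Q. s * q = q * s}"
        by (intro gen_least sg_centralizer Q) (use b that in auto)
      thus ?thesis using that by auto
    qed
    have "ghom N f" using f(1) N1(3) by (auto simp: ghom_def)
    hence sgB: "subgrp ?B" using ghom_vimage_sg[OF _ N1(2)] sg_gen by blast
    have "normal_sub ?B S"
      unfolding normal_sub_def
    proof (intro conjI ballI)
      fix v s assume v: "v \<in> ?B" and s: "s \<in> S"
      have "f (ginv s * v * s) = ginv (f s) * f v * f s"
        using v s N1(3) S(1) f(1) by (auto simp: ghom_mult ghom_ginv sg_closed subset_iff)
      also have "\<dots> = f v" using cen[of "f v" "f s"] v s by (simp add: Q_def mult.assoc)
      finally show "ginv s * v * s \<in> ?B" using v nrm_conj[OF N(1) _ s] by auto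
    qed (use sgB N1(3) in auto)
    moreover have "M \<subset> ?B"
    proof -
      obtain v where v: "v \<in> N" "b = f v" using b by auto
      hence "v \<in> ?B" "v \<notin> M" using f(2)[of v] b N1(3) gen_mem[of b "{b}"] by auto
      moreover have "M \<subseteq> ?B"
      proof
        fix w assume "w \<in> M"
        thus "w \<in> ?B" using MS f(2)[of w] N1(3) sg_one[OF sg_gen, of "{b}"] by auto
      qed
      ultimately show ?thesis by auto
    qed
    ultimately have "?B = N"
      using M(2)[of ?B] N1(4) psubset_card_mono[of ?B M] 
      by (auto simp: \<M>_def)
    thus ?thesis using u by auto
  qed
  have fN1: "f ` N \<noteq> {1}"
  proof
    assume "f ` N = {1}"
    hence "N \<subseteq> M" using f(2) N1(3) by blast
    thus False using MS by auto
  qed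
  obtain a where a: "a \<in> f ` N" "a \<noteq> 1" "\<And>q. q \<in> Q \<Longrightarrow> q * a = a * q"
    using central_element[OF Q m S(4) fN fN1] by blast
  have "a \<in> Q" using a N1(3) by (auto simp: Q_def)
  hence "a ^ (p ^ m) = 1" using pow_card_sg[OF Q] m by metis
  then obtain k where k: "a ^ (p ^ k) \<noteq> 1" "(a ^ (p ^ k)) ^ p = 1"
    using pow_prime_step a(2) by metis
  \<comment> \<open>Passing from \<open>a\<close> to a power of order \<open>p\<close> bounds the
    image of \<open>N\<close> by \<open>p\<close>.\<close>
  define b where "b = a ^ (p ^ k)"
  have b: "b \<in> f ` N" "b \<noteq> 1" "\<And>q. q \<in> Q \<Longrightarrow> q * b = b * q"
    using k a sg_pow[OF nrm_sg[OF fN]] by (auto simp: b_def power_commuting_commutes)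
  have sub: "f ` N \<subseteq> gen {b}" using key[OF b] by auto
  have "gen {b} = (\<lambda>i. b ^ i) ` {..<p}"
    by (rule gen_single) (use k S(4) in \<open>auto simp: b_def prime_gt_0_nat\<close>)
  hence "card (f ` N) \<le> p"
    using sub by (metis card_image_le card_lessThan card_mono finite_imageI finite_lessThan le_trans)
  moreover have "card (f ` N) dvd p ^ m"
    using card_sg_dvd[OF Q(1) nrm_sg[OF fN] nrm_subset[OF fN]] m by simp
  then obtain l where l: "card (f ` N) = p ^ l" using S(4) by (meson divides_primepow_nat)
  moreover have "l \<noteq> 0"
  proof
    assume "l = 0"
    then obtain v where "f ` N = {v}" using l by (auto simp: card_1_singleton_iff)
    thus False using fN1 sg_one[OF nrm_sg[OF fN]] by auto
  qed
  ultimately have "card (f ` N) = p"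
    using S(4) by (metis One_nat_def dvd_refl dvd_imp_le dvd_power le_antisym not_gr_zero prime_gt_0_nat
        zero_less_power)
  moreover have "{u \<in> N. f u = 1} = M" using f(2) MS N1(3) by auto
  ultimately have "card N = p * card M"
    using card_ghom[OF f(1) S(1) N1(2,3,4)] by simp
  moreover have "\<exists>w\<in>M. u * s = s * u * w" if u: "u \<in> N" and s: "s \<in> S" for u s
  proof
    have uS: "u \<in> S" using u N1(3) by auto
    show "u * s = s * u * (ginv (s * u) * (u * s))" by (simp add: mult.assoc)
    have "gen {b} \<subseteq> {t \<in> Q. t * f s = f s * t}"
      using b N1(3) s by (intro gen_least sg_centralizer Q) (auto simp: Q_def)
    hence "f u * f s = f s * f u" using sub u by auto
    hence "f (ginv (s * u) * (u * s)) = 1"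
      using s uS S(1) f(1) by (simp add: ghom_mult ghom_ginv sg_closed)
    thus "ginv (s * u) * (u * s) \<in> M" using f(2) s uS S(1) by (simp add: sg_closed)
  qed
  ultimately show ?thesis using that MS by blast
qed

section \<open>Commutators and the derived subgroup\<close>

text \<open>The convention for which \<open>u * v = v * u * comm u v\<close>, so that commutators
  are collected on the right.\<close>

definition comm :: "'a::grp \<Rightarrow> 'a \<Rightarrow> 'a" where
  "comm u v = ginv (v * u) * (u * v)"

lemma mult_comm: "u * v = v * u * comm u v"
  by (simp add: comm_def)

lemma comm_unique: "u * v = v * u * w \<longleftrightarrow> w = comm u v"
  by (auto simp: comm_def)

lemma comm_eq_one_iff: "comm u v = 1 \<longleftrightarrow> u * v = v * u"
  using comm_unique[of u v 1] by auto

lemma comm_closed: "subgrp S \<Longrightarrow> u \<in> S \<Longrightarrow> v \<in> S \<Longrightarrow> comm u v \<in> S"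
  by (simp add: comm_def sg_closed)

definition derived_sub :: "'a::grp set \<Rightarrow> 'a set" where
  "derived_sub S = gen ((\<lambda>(u, v). comm u v) ` (S \<times> S))"

lemma comm_in_der: "u \<in> S \<Longrightarrow> v \<in> S \<Longrightarrow> comm u v \<in> derived_sub S"
  unfolding derived_sub_def by (rule gen_mem) auto

lemma der_least: "subgrp N \<Longrightarrow> (\<And>u v. u \<in> S \<Longrightarrow> v \<in> S \<Longrightarrow> comm u v \<in> N) \<Longrightarrow> derived_sub S \<subseteq> N"
  unfolding derived_sub_def by (rule gen_least) auto

text \<open>Conjugates of commutators are commutators, and the elements all of whose conjugates stay
  in the derived subgroup form a subgroup.\<close>

lemma nrm_der:
  assumes S: "subgrp S"
  shows "normal_sub (derived_sub S) S"
proof -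
  let ?N = "{n \<in> S. \<forall>s\<in>S. ginv s * n * s \<in> derived_sub S}"
  have D: "subgrp (derived_sub S)" by (simp add: derived_sub_def)
  have "subgrp ?N"
    unfolding subgrp_def
  proof (intro conjI ballI)
    show "1 \<in> ?N" using S D by (simp add: sg_one mult.assoc)
    fix a assume a: "a \<in> ?N"
    have "ginv s * ginv a * s = ginv (ginv s * a * s)" for s
      by (simp add: ginv_mult mult.assoc)
    thus "ginv a \<in> ?N" using a S D by (auto simp: sg_ginv)
    fix b assume b: "b \<in> ?N"
    have "ginv s * (a * b) * s = (ginv s * a * s) * (ginv s * b * s)" for s
      by (simp add: mult.assoc)
    thus "a * b \<in> ?N" using a b S D by (auto simp: sg_mult)
  qed
  moreover have "comm u v \<in> ?N" if "u \<in> S" "v \<in> S" for u v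
  proof -
    have "ginv s * comm u v * s = comm (ginv s * u * s) (ginv s * v * s)" for s
      by (simp add: comm_def ginv_mult mult.assoc)
    thus ?thesis using that S by (simp add: comm_closed comm_in_der sg_closed)
  qed
  ultimately have "derived_sub S \<subseteq> ?N" by (rule der_least)
  thus ?thesis using D by (auto simp: normal_sub_def)
qed

lemma ghom_comm_iff:
  assumes "ghom S f" "subgrp S" "u \<in> S" "v \<in> S"
  shows "f (comm u v) = 1 \<longleftrightarrow> f u * f v = f v * f u"
proof -
  have "f (comm u v) = comm (f u) (f v)"
    using assms by (simp add: comm_def ghom_mult ghom_ginv sg_closed)
  thus ?thesis by (simp add: comm_eq_one_iff)
qed

text \<open>Modulo \<open>N\<close> the two generators commute, so the quotient is abelian.\<close>

lemma der_gen2: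
  assumes S: "subgrp S" "gen {x, y} = S" and N: "normal_sub N S" "comm y x \<in> N"
  shows "derived_sub S \<subseteq> N"
proof -
  obtain f :: "'a \<Rightarrow> 'a set sym" where f: "ghom S f" "\<And>s. s \<in> S \<Longrightarrow> f s = 1 \<longleftrightarrow> s \<in> N"
    using quotient_hom[OF S(1) N(1)] by blast
  have xy: "x \<in> S" "y \<in> S" using S gen_mem[of _ "{x, y}"] by auto
  have "f y * f x = f x * f y"
    using ghom_comm_iff[OF f(1) S(1), of y x] f(2)[of "comm y x"] xy N S
    by (auto simp: comm_closed)
  hence "comm u v \<in> N" if "u \<in> S" "v \<in> S" for u v
    using ghom_commute_gen2[OF f(1) S _ that] ghom_comm_iff[OF f(1) S(1) that]
      f(2)[of "comm u v"] that S by (auto simp: comm_closed)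
  thus ?thesis by (intro der_least nrm_sg[OF N(1)])
qed

section \<open>Coded power-commutator presentations and the isomorphisms they force\<close>

fun ev :: "(nat \<Rightarrow> nat) \<Rightarrow> 'a::grp list \<Rightarrow> nat list \<Rightarrow> 'a" where
  "ev v (g # gs) (i # w) = g ^ v i * ev v gs w"
| "ev v _ _ = 1"

text \<open>Each generator comes with the word for its \<open>p\<close>-th power and one conjugation
  word for every later generator, all in the later generators. This says that relations hold, not
  that the group is the one they define.\<close>

fun pc_presentation :: "nat \<Rightarrow> (nat \<Rightarrow> nat) \<Rightarrow> 'a::grp list \<Rightarrow> (nat list \<times> nat list list) list \<Rightarrow> bool" where
  "pc_presentation p v (g # gs) ((w, ws) # cs) \<longleftrightarrow>
     length w = length gs \<and> g ^ p = ev v gs w \<and>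
     list_all2 (\<lambda>h u. length u = length gs \<and> h * g = g * ev v gs u) gs ws \<and> pc_presentation p v gs cs"
| "pc_presentation p v [] [] \<longleftrightarrow> True"
| "pc_presentation p v _ _ \<longleftrightarrow> False"

lemma ev_closed: "subgrp H \<Longrightarrow> set gs \<subseteq> H \<Longrightarrow> ev v gs w \<in> H"
  by (induction v gs w rule: ev.induct) (auto simp: sg_closed)

text \<open>The relations let every product be collected to \<open>g ^ a * n\<close> with
  \<open>a < p\<close> and \<open>n\<close> generated by the later generators; each generator thus
  contributes a factor of at most \<open>p\<close>.\<close>

lemma card_gen_pc_rel:
  fixes gs :: "'a::grp list"
  assumes "pc_presentation p v gs cs" "p > 0" "subgrp F" "finite F" "set gs \<subseteq> F"
  shows "card (gen (set gs)) \<le> p ^ length gs"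
  using assms
proof (induction p v gs cs rule: pc_presentation.induct)
  case (1 p v g gs w ws cs)
  define N where "N = gen (set gs)"
  have N: "subgrp N" "N \<subseteq> F" "finite N" "card N \<le> p ^ length gs" "set gs \<subseteq> N"
    using 1 gen_least[of F "set gs"] gen_incl[of "set gs"]
    by (auto simp: N_def intro: finite_subset)
  have gF: "g \<in> F" using 1 by auto
  have gp: "g ^ p \<in> N" using 1 N by (auto intro: ev_closed)
  have hg: "ginv g * h * g \<in> N" if "h \<in> set gs" for h
  proof -
    from 1(2) that obtain u where u: "h * g = g * ev v gs u"
      by (auto simp: list_all2_conv_all_nth in_set_conv_nth)
    have "ginv g * h * g = ev v gs u" using u by (simp add: mult.assoc)
    thus ?thesis using N ev_closed by metis
  qed
  have "subgrp {n \<in> N. ginv g * n * g \<in> N}"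
    unfolding subgrp_def
  proof (intro conjI ballI)
    show "1 \<in> {n \<in> N. ginv g * n * g \<in> N}" using N by (simp add: sg_one mult.assoc)
    fix a assume a: "a \<in> {n \<in> N. ginv g * n * g \<in> N}"
    have "ginv g * ginv a * g = ginv (ginv g * a * g)" by (simp add: ginv_mult mult.assoc)
    thus "ginv a \<in> {n \<in> N. ginv g * n * g \<in> N}" using a N by (auto simp: sg_ginv)
    fix b assume b: "b \<in> {n \<in> N. ginv g * n * g \<in> N}"
    have "ginv g * (a * b) * g = (ginv g * a * g) * (ginv g * b * g)" by (simp add: mult.assoc)
    thus "a * b \<in> {n \<in> N. ginv g * n * g \<in> N}" using a b N by (auto simp: sg_mult)
  qed
  hence "N \<subseteq> {n \<in> N. ginv g * n * g \<in> N}"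
    unfolding N_def by (rule gen_least) (use hg N(5) in \<open>auto simp: N_def\<close>)
  hence conj: "\<exists>n'\<in>N. n * g = g * n'" if "n \<in> N" for n
    using that by (intro bexI[of _ "ginv g * n * g"]) (auto simp: mult.assoc)
  have conjp: "\<exists>n'\<in>N. n * g ^ a = g ^ a * n'" if "n \<in> N" for n a
    using that
  proof (induction a arbitrary: n)
    case (Suc a)
    obtain m where m: "m \<in> N" "n * g = g * m" using conj Suc.prems by blast
    obtain k where k: "k \<in> N" "m * g ^ a = g ^ a * k" using Suc.IH m by blast
    have "n * g ^ Suc a = g * (m * g ^ a)" using m(2) by (simp flip: mult.assoc)
    also have "\<dots> = g ^ Suc a * k" by (simp add: k(2) mult.assoc)
    finally show ?case using k by blast
  qed (auto intro: bexI)
  \<comment> \<open>These collected elements form a subgroup: closure under products is enough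
    because everything lies in the finite \<open>F\<close>.\<close>
  define T where "T = (\<lambda>(a, n). g ^ a * n) ` ({..<p} \<times> N)"
  have Tmem: "g ^ a * n \<in> T" if "n \<in> N" for a n
  proof -
    have "g ^ a = g ^ (a mod p + p * (a div p))" by simp
    also have "\<dots> = g ^ (a mod p) * (g ^ p) ^ (a div p)" by (simp only: power_add power_mult)
    finally have "g ^ a * n = g ^ (a mod p) * ((g ^ p) ^ (a div p) * n)" by (simp add: mult.assoc)
    moreover have "(g ^ p) ^ (a div p) * n \<in> N" using gp that N by (auto simp: sg_closed)
    ultimately show ?thesis
      using 1(3) imageI[of "(a mod p, (g ^ p) ^ (a div p) * n)" "{..<p} \<times> N" "\<lambda>(a, n). g ^ a * n"]
      by (simp add: T_def)
  qed
  have "subgrp T"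
  proof (rule finite_sgI[of F])
    show "T \<subseteq> F" using N gF 1 by (auto simp: T_def intro!: sg_mult sg_pow)
    show "1 \<in> T" using Tmem[of 1 0] N by (simp add: sg_one)
    fix s t assume "s \<in> T" "t \<in> T"
    then obtain a n b m where s: "s = g ^ a * n" "n \<in> N" and t: "t = g ^ b * m" "m \<in> N"
      by (auto simp: T_def)
    obtain k where k: "k \<in> N" "n * g ^ b = g ^ b * k" using conjp s by blast
    have "s * t = g ^ a * (n * g ^ b) * m" by (simp add: s t mult.assoc)
    also have "\<dots> = g ^ (a + b) * (k * m)" by (simp add: k power_add mult.assoc)
    finally show "s * t \<in> T" using Tmem k t N by (simp add: sg_mult)
  qed (use 1 in auto)
  moreover have "set (g # gs) \<subseteq> T"
    using Tmem[of 1 1] Tmem[of _ 0] N by (auto simp: sg_one)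
  ultimately have "gen (set (g # gs)) \<subseteq> T" by (rule gen_least)
  moreover have "finite T" using N by (simp add: T_def)
  ultimately have "card (gen (set (g # gs))) \<le> card T" by (rule card_mono[rotated])
  also have "\<dots> \<le> card ({..<p} \<times> N)" unfolding T_def by (rule card_image_le) (use N in auto)
  also have "\<dots> \<le> p * p ^ length gs" using N by simp
  finally show ?case by simp
next
  case (2 p v)
  have "gen {} = {1::'a}" using gen_least[OF sg_one_set, of "{}"] sg_one[OF sg_gen] by blast
  thus ?case by simp
qed auto

lemma ev_zip:
  "length gs = length hs \<Longrightarrow> length w = length gs \<Longrightarrow> ev v (zip gs hs) w = (ev v gs w, ev v hs w)"
proof (induction gs hs arbitrary: w rule: list_induct2)
  case (Cons g gs h hs)
  then obtain i u where "w = i # u" by (cases w) auto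
  thus ?case using Cons by (auto simp: prod_eq_iff)
qed (simp add: one_prod_def)

lemma pc_rel_zip:
  "length gs = length hs \<Longrightarrow> pc_presentation p v gs cs \<Longrightarrow> pc_presentation p v hs cs \<Longrightarrow> pc_presentation p v (zip gs hs) cs"
proof (induction gs hs arbitrary: cs rule: list_induct2)
  case (Cons g gs h hs)
  then obtain w ws cs' where cs: "cs = (w, ws) # cs'" by (cases cs) auto
  show ?case using Cons unfolding cs
    by (auto simp: list_all2_conv_all_nth ev_zip prod_eq_iff)
next
  case Nil
  thus ?case by (cases cs) auto
qed

text \<open>The subgroup \<open>K\<close> of the product generated by the paired generators
  satisfies the same relations, hence has at most \<open>p ^ n\<close> elements; it projects onto
  two groups of order \<open>p ^ n\<close>, so it is the graph of an isomorphism.\<close>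

lemma pc_rel_isomorphic:
  fixes gs :: "'a::grp list" and hs :: "'b::grp list"
  assumes "pc_presentation p v gs cs" "pc_presentation p v hs cs" "p > 0"
    and len: "length gs = n" "length hs = n"
    and card: "card (gen (set gs)) = p ^ n" "card (gen (set hs)) = p ^ n"
  obtains \<phi> where "bij_betw \<phi> (gen (set gs)) (gen (set hs))" "ghom (gen (set gs)) \<phi>"
proof -
  define K where "K = gen (set (zip gs hs))"
  have fin: "finite (gen (set gs))" "finite (gen (set hs))"
    using card assms(3) card.infinite by fastforce+
  let ?F = "gen (set gs) \<times> gen (set hs)"
  have F: "subgrp ?F" "finite ?F"
    using fin sg_gen[of "set gs"] sg_gen[of "set hs"]
    unfolding subgrp_def by (auto simp: mem_Times_iff)
  have sub: "set (zip gs hs) \<subseteq> ?F"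
    using gen_incl[of "set gs"] gen_incl[of "set hs"] by (auto dest: set_zip_leftD set_zip_rightD)
  have K: "subgrp K" "K \<subseteq> ?F" unfolding K_def using gen_least[OF F(1) sub] by auto
  have finK: "finite K" using K(2) F(2) by (rule finite_subset)
  have cK: "card K \<le> p ^ n"
    unfolding K_def using card_gen_pc_rel[OF pc_rel_zip[OF _ assms(1,2)] assms(3) F sub] len by simp
  have h: "ghom UNIV (fst :: 'a \<times> 'b \<Rightarrow> 'a)" "ghom UNIV (snd :: 'a \<times> 'b \<Rightarrow> 'b)"
    by (auto simp: ghom_def)
  have U: "subgrp UNIV" by (simp add: subgrp_def)
  have im: "fst ` K = gen (set gs)" "snd ` K = gen (set hs)"
    unfolding K_def using ghom_gen[OF h(1) U, of "set (zip gs hs)"] ghom_gen[OF h(2) U, of "set (zip gs hs)"] len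
    by (simp_all flip: set_map)
  have bij: "bij_betw fst K (gen (set gs))" "bij_betw snd K (gen (set hs))"
    unfolding bij_betw_def using im card cK card_image_le[OF finK, of fst] card_image_le[OF finK, of snd] finK
    by (auto intro!: eq_card_imp_inj_on)
  let ?\<phi> = "\<lambda>a. snd (the_inv_into K fst a)"
  have "bij_betw (snd \<circ> the_inv_into K fst) (gen (set gs)) (gen (set hs))"
    by (rule bij_betw_trans[OF bij_betw_the_inv_into[OF bij(1)] bij(2)])
  hence "bij_betw ?\<phi> (gen (set gs)) (gen (set hs))" by (simp add: comp_def)
  moreover have "ghom (gen (set gs)) ?\<phi>"
    unfolding ghom_def
  proof (intro ballI)
    fix a b assume "a \<in> gen (set gs)" "b \<in> gen (set gs)"
    then obtain k l where kl: "k \<in> K" "l \<in> K" "a = fst k" "b = fst l" using im by blast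
    have inj: "inj_on fst K" using bij by (simp add: bij_betw_def)
    have "the_inv_into K fst (a * b) = k * l"
      by (rule the_inv_into_f_eq[OF inj]) (use kl K in \<open>auto simp: sg_mult\<close>)
    thus "?\<phi> (a * b) = ?\<phi> a * ?\<phi> b"
      using kl the_inv_into_f_f[OF inj] by simp
  qed
  ultimately show ?thesis by (rule that)
qed

text \<open>Exponents are coded by indices below \<open>5\<close>, which the function \<open>v\<close> translates, so the set of codes
  does not depend on the prime.\<close>

definition codes :: "(nat list \<times> nat list list) list set" where
  "codes = (let L = {w. set w \<subseteq> {..<5} \<and> length w \<le> 5} in
     {cs. set cs \<subseteq> L \<times> {ws. set ws \<subseteq> L \<and> length ws \<le> 5} \<and> length cs \<le> 5})"

lemma finite_codes: "finite codes"
  unfolding codes_def Let_def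
  by (intro finite_lists_length_le finite_cartesian_product finite_lessThan)

text \<open>Together with \<open>bounded_pc\<close>, a version of coded presentations in which words
  are elements rather than lists of codes, so that a case only has to exhibit its relations. The
  codes are recovered in \<open>bounded_pc_codes\<close>.\<close>

fun bwords :: "(nat \<Rightarrow> nat) \<Rightarrow> 'a::grp list \<Rightarrow> 'a set" where
  "bwords v [] = {1}"
| "bwords v (g # gs) = {g ^ v i * w | i w. i < 5 \<and> w \<in> bwords v gs}"

fun bounded_pc :: "nat \<Rightarrow> (nat \<Rightarrow> nat) \<Rightarrow> 'a::grp list \<Rightarrow> bool" where
  "bounded_pc p v [] \<longleftrightarrow> True"
| "bounded_pc p v (g # gs) \<longleftrightarrow> g ^ p \<in> bwords v gs \<and>
     (\<forall>h\<in>set gs. \<exists>w\<in>bwords v gs. h * g = g * w) \<and> bounded_pc p v gs"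

lemma bwords_ev:
  "w \<in> bwords v gs \<Longrightarrow> \<exists>u. set u \<subseteq> {..<5} \<and> length u = length gs \<and> w = ev v gs u"
proof (induction gs arbitrary: w)
  case (Cons g gs)
  then obtain i w' u where "i < 5" "w = g ^ v i * w'" "set u \<subseteq> {..<5}" "length u = length gs"
    "w' = ev v gs u" by fastforce
  thus ?case by (intro exI[of _ "i # u"]) auto
qed simp

lemma bounded_pc_codes:
  assumes "bounded_pc p v gs" "length gs \<le> 5"
  shows "\<exists>cs\<in>codes. length cs = length gs \<and> pc_presentation p v gs cs"
  using assms
proof (induction gs)
  case Nil
  have "[] \<in> codes" by (simp add: codes_def Let_def)
  thus ?case by (intro bexI[of _ "[]"]) auto
next
  case (Cons g gs)
  then obtain cs where cs: "cs \<in> codes" "length cs = length gs" "pc_presentation p v gs cs" by auto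
  obtain w where w: "set w \<subseteq> {..<5}" "length w = length gs" "g ^ p = ev v gs w"
    using Cons.prems bwords_ev by fastforce
  have "\<exists>u. set u \<subseteq> {..<5} \<and> length u = length gs \<and> h * g = g * ev v gs u" if "h \<in> set gs" for h
    using Cons.prems that bwords_ev by fastforce
  then obtain U where U: "\<And>h. h \<in> set gs \<Longrightarrow>
      set (U h) \<subseteq> {..<5} \<and> length (U h) = length gs \<and> h * g = g * ev v gs (U h)" by metis
  have "pc_presentation p v (g # gs) ((w, map U gs) # cs)"
    using w U cs by (auto simp: list_all2_map2 list_all2_same)
  moreover have "(w, map U gs) # cs \<in> codes"
    using w U cs Cons.prems by (fastforce simp: codes_def Let_def)
  ultimately show ?case using cs by (intro bexI[of _ "(w, map U gs) # cs"]) auto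
qed

section \<open>Transfer from groups on natural numbers\<close>

text \<open>Cayley's embedding, extended by the identity outside the carrier to give a permutation
  of the type.\<close>

definition cayley :: "('a, 'b) monoid_scheme \<Rightarrow> 'a \<Rightarrow> 'a sym" where
  "cayley G g = Sym (\<lambda>h. if h \<in> carrier G then g \<otimes>\<^bsub>G\<^esub> h else h)"

lemma (in group) app_cay:
  assumes "g \<in> carrier G"
  shows "app (cayley G g) = (\<lambda>h. if h \<in> carrier G then g \<otimes> h else h)"
proof -
  have "bij (\<lambda>h. if h \<in> carrier G then g \<otimes> h else h)"
    by (rule o_bij[of "\<lambda>h. if h \<in> carrier G then inv g \<otimes> h else h"])
      (use assms in \<open>auto simp: fun_eq_iff m_assoc[symmetric]\<close>)
  thus ?thesis by (simp add: cayley_def Sym_inverse)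
qed

lemma app_times: "app (f * g) = app f \<circ> app g"
  and app_one: "app 1 = id"
  by (transfer, simp)+

lemma (in group) cay_mult: "g \<in> carrier G \<Longrightarrow> h \<in> carrier G \<Longrightarrow> cayley G (g \<otimes> h) = cayley G g * cayley G h"
  by (rule app_inject[THEN iffD1]) (auto simp: app_cay app_times fun_eq_iff m_assoc)

lemma (in group) cay_inj: "inj_on (cayley G) (carrier G)"
proof (rule inj_onI)
  fix g h assume gh: "g \<in> carrier G" "h \<in> carrier G" "cayley G g = cayley G h"
  hence "app (cayley G g) \<one> = app (cayley G h) \<one>" by simp
  thus "g = h" using gh(1,2) by (simp add: app_cay)
qed

lemma (in group) cay_one: "cayley G \<one> = 1"
  by (rule app_inject[THEN iffD1]) (auto simp: app_cay app_one fun_eq_iff)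

lemma (in group) cay_inv: "g \<in> carrier G \<Longrightarrow> cayley G (inv g) = ginv (cayley G g)"
  by (rule sym, rule ginv_unique) (simp add: cay_one flip: cay_mult)

lemma (in group) cay_pow: "g \<in> carrier G \<Longrightarrow> cayley G (g [^] (n::nat)) = cayley G g ^ n"
  by (induction n) (simp_all add: cay_one cay_mult power_commutes)

lemma (in group) sg_cay: "subgroup H G \<Longrightarrow> subgrp (cayley G ` H)"
  unfolding subgrp_def
  by (auto simp: cay_one[symmetric] cay_mult[symmetric] cay_inv[symmetric] subgroup.one_closed
      subgroup.m_closed subgroup.m_inv_closed subgroup.mem_carrier intro!: imageI)

lemma (in group) gen_cay:
  assumes "A \<subseteq> carrier G"
  shows "gen (cayley G ` A) = cayley G ` generate G A"
proof
  show "gen (cayley G ` A) \<subseteq> cayley G ` generate G A"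
  proof (rule gen_least)
    show "subgrp (cayley G ` generate G A)" by (intro sg_cay generate_is_subgroup assms)
    have "A \<subseteq> generate G A" by (auto intro: generate.incl)
    thus "cayley G ` A \<subseteq> cayley G ` generate G A" by (rule image_mono)
  qed
  have "cayley G g \<in> gen (cayley G ` A)" if "g \<in> generate G A" for g
    using that
  proof (induction rule: generate.induct)
    case one
    show ?case by (simp add: cay_one sg_one)
  next
    case (incl h)
    thus ?case by (intro gen_mem) auto
  next
    case (inv h)
    moreover have "h \<in> carrier G" using inv assms by auto
    ultimately show ?case by (simp add: cay_inv sg_ginv gen_mem)
  next
    case (eng h k)
    thus ?case using assms by (auto simp: cay_mult generate_in_carrier sg_mult)
  qed
  thus "cayley G ` generate G A \<subseteq> gen (cayley G ` A)" by auto
qed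

lemma cay_iso:
  assumes G: "group G" and H: "group H"
    and \<phi>: "bij_betw \<phi> (cayley G ` carrier G) (cayley H ` carrier H)" "ghom (cayley G ` carrier G) \<phi>"
  shows "G \<cong> H"
proof -
  have bG: "bij_betw (cayley G) (carrier G) (cayley G ` carrier G)"
    using group.cay_inj[OF G] by (simp add: bij_betw_def)
  have bH: "bij_betw (cayley H) (carrier H) (cayley H ` carrier H)"
    using group.cay_inj[OF H] by (simp add: bij_betw_def)
  define \<psi> where "\<psi> = the_inv_into (carrier H) (cayley H) \<circ> (\<phi> \<circ> cayley G)"
  have b: "bij_betw \<psi> (carrier G) (carrier H)"
    unfolding \<psi>_def
    by (rule bij_betw_trans[OF bij_betw_trans[OF bG \<phi>(1)] bij_betw_the_inv_into[OF bH]])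
  have c: "cayley H (\<psi> g) = \<phi> (cayley G g)" if "g \<in> carrier G" for g
  proof -
    have "\<phi> (cayley G g) \<in> cayley H ` carrier H" using \<phi>(1) that by (auto simp: bij_betw_def)
    thus ?thesis unfolding \<psi>_def comp_def
      by (rule f_the_inv_into_f[OF group.cay_inj[OF H]])
  qed
  have cl: "\<psi> g \<in> carrier H" if "g \<in> carrier G" for g
    using b that by (auto simp: bij_betw_def)
  have "\<psi> (g \<otimes>\<^bsub>G\<^esub> h) = \<psi> g \<otimes>\<^bsub>H\<^esub> \<psi> h" if gh: "g \<in> carrier G" "h \<in> carrier G" for g h
  proof (rule inj_onD[OF group.cay_inj[OF H]])
    have m: "g \<otimes>\<^bsub>G\<^esub> h \<in> carrier G" using group.subgroup_self[OF G] gh by (rule subgroup.m_closed)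
    show "cayley H (\<psi> (g \<otimes>\<^bsub>G\<^esub> h)) = cayley H (\<psi> g \<otimes>\<^bsub>H\<^esub> \<psi> h)"
      using gh m cl ghom_mult[OF \<phi>(2)] by (simp add: c group.cay_mult[OF G] group.cay_mult[OF H])
    show "\<psi> (g \<otimes>\<^bsub>G\<^esub> h) \<in> carrier H" using m cl by simp
    show "\<psi> g \<otimes>\<^bsub>H\<^esub> \<psi> h \<in> carrier H"
      using group.subgroup_self[OF H] cl gh by (simp add: subgroup.m_closed)
  qed
  hence "\<psi> \<in> iso G H" using b cl by (auto simp: iso_def hom_def)
  thus ?thesis by (auto simp: is_iso_def)
qed

lemma iso_rel_class_eq:
  assumes "group G" "group H" "G \<cong> H"
  shows "iso_rel `` {G} = iso_rel `` {H}"
  using assms group.iso_sym[OF assms(1)] iso_trans by (auto simp: iso_rel_def)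

text \<open>Here \<open>P G c\<close> reads "\<open>c\<close> describes \<open>G\<close>". One
  description per group is chosen, and a class is determined by the description of any of its
  members.\<close>

lemma card_iso_classes_le:
  assumes A: "\<And>G. G \<in> A \<Longrightarrow> group G" and C: "finite C"
    and code: "\<And>G. G \<in> A \<Longrightarrow> \<exists>c\<in>C. P G c"
    and iso: "\<And>G H c. G \<in> A \<Longrightarrow> H \<in> A \<Longrightarrow> P G c \<Longrightarrow> P H c \<Longrightarrow> G \<cong> H"
  shows "finite (A // iso_rel) \<and> card (A // iso_rel) \<le> card C"
proof -
  obtain k where k: "\<And>G. G \<in> A \<Longrightarrow> k G \<in> C \<and> P G (k G)" using code by metis
  define q where "q c = iso_rel `` {SOME G. G \<in> A \<and> P G c}" for c
  have "iso_rel `` {G} = q (k G)" if G: "G \<in> A" for G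
  proof -
    let ?H = "SOME H. H \<in> A \<and> P H (k G)"
    have "?H \<in> A \<and> P ?H (k G)" by (rule someI[of _ G]) (use G k in auto)
    thus ?thesis using iso_rel_class_eq[of G ?H] iso[of G ?H "k G"] A G k by (auto simp: q_def)
  qed
  hence "A // iso_rel \<subseteq> q ` C" using k by (auto simp: quotient_def)
  thus ?thesis using C by (meson card_image_le card_mono finite_imageI finite_subset le_trans)
qed

section \<open>Collection\<close>

lemma commute_pow:
  fixes a b :: "'a::monoid_mult"
  assumes "a * b = b * a"
  shows "a ^ m * b ^ n = b ^ n * a ^ m"
  using assms by (metis power_commuting_commutes)

lemma commute_mult_pow:
  fixes a b :: "'a::monoid_mult"
  assumes "a * b = b * a"
  shows "(a * b) ^ n = a ^ n * b ^ n"
proof (induction n)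
  case (Suc n)
  have "(a * b) ^ Suc n = a * (b * a ^ n) * b ^ n" by (simp add: Suc mult.assoc)
  also have "b * a ^ n = a ^ n * b" using commute_pow[OF assms, of n 1] by simp
  finally show ?case by (simp add: mult.assoc)
qed simp

lemma pow_cong_mod:
  fixes a :: "'a::monoid_mult"
  assumes "a ^ p = 1" "[m = n] (mod p)"
  shows "a ^ m = a ^ n"
proof -
  have mod: "a ^ i = a ^ (i mod p)" for i
  proof -
    have "a ^ i = a ^ (p * (i div p) + i mod p)" by simp
    also have "\<dots> = a ^ (i mod p)" by (simp only: power_add power_mult assms(1) power_one mult_1_left)
    finally show ?thesis .
  qed
  show ?thesis using mod[of m] mod[of n] assms(2) by (simp add: cong_def)
qed

lemma pow_dvd_one:
  fixes a :: "'a::monoid_mult"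
  shows "a ^ p = 1 \<Longrightarrow> p dvd n \<Longrightarrow> a ^ n = 1"
  by (auto simp: power_mult)

text \<open>One set of relations serves all cases: \<open>c = [y, x]\<close>,
  \<open>d = [c, x]\<close>, \<open>e = [d, x]\<close>, \<open>z = [c, y]\<close>, with
  \<open>e\<close> and \<open>z\<close> central on the generators. Class three is
  \<open>e = 1\<close>, class two is \<open>d = e = z = 1\<close>.\<close>

locale collection =
  fixes x y c d e z :: "'a::grp"
  assumes yx: "y * x = x * y * c" and cx: "c * x = x * c * d" and dx: "d * x = x * d * e"
    and cy: "c * y = y * c * z" and dy: "d * y = y * d"
    and ex: "e * x = x * e" and ey: "e * y = y * e" and zx: "z * x = x * z" and zy: "z * y = y * z"
    and cd: "c * d = d * c" and ce: "c * e = e * c" and de: "d * e = e * d"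
    and cz: "c * z = z * c" and dz: "d * z = z * d" and ez: "e * z = z * e"
begin

definition nf :: "nat \<Rightarrow> nat \<Rightarrow> nat \<Rightarrow> nat \<Rightarrow> nat \<Rightarrow> nat \<Rightarrow> 'a" where
  "nf i j k l m n = x ^ i * (y ^ j * (c ^ k * (d ^ l * (e ^ m * z ^ n))))"

lemma dx_pow: "d ^ l * x = x * (d ^ l * e ^ l)"
proof (induction l)
  case (Suc l)
  have "d ^ Suc l * x = d * (d ^ l * x)" by (simp add: mult.assoc)
  also have "\<dots> = d * x * (d ^ l * e ^ l)" by (simp only: Suc mult.assoc)
  also have "\<dots> = x * (d * (e * d ^ l) * e ^ l)" by (simp only: dx mult.assoc)
  also have "e * d ^ l = d ^ l * e" using commute_pow[OF de, of l 1] by simp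
  finally show ?case by (simp add: mult.assoc)
qed simp

lemma cx_pow: "c ^ k * x = x * (c ^ k * d ^ k)"
proof (induction k)
  case (Suc k)
  have "c ^ Suc k * x = c * (c ^ k * x)" by (simp add: mult.assoc)
  also have "\<dots> = c * x * (c ^ k * d ^ k)" by (simp only: Suc mult.assoc)
  also have "\<dots> = x * (c * (d * c ^ k) * d ^ k)" by (simp only: cx mult.assoc)
  also have "d * c ^ k = c ^ k * d" using commute_pow[OF cd, of k 1] by simp
  finally show ?case by (simp add: mult.assoc)
qed simp

lemma cy_pow: "c ^ k * y = y * (c ^ k * z ^ k)"
proof (induction k)
  case (Suc k)
  have "c ^ Suc k * y = c * (c ^ k * y)" by (simp add: mult.assoc)
  also have "\<dots> = c * y * (c ^ k * z ^ k)" by (simp only: Suc mult.assoc)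
  also have "\<dots> = y * (c * (z * c ^ k) * z ^ k)" by (simp only: cy mult.assoc)
  also have "z * c ^ k = c ^ k * z" using commute_pow[OF cz, of k 1] by simp
  finally show ?case by (simp add: mult.assoc)
qed simp

lemma choose2: "(Suc j choose 2) = j + (j choose 2)"
  by (simp add: numeral_2_eq_2)

text \<open>In the induction step the block \<open>c ^ j\<close> passes one more \<open>y\<close>
  and sheds \<open>z ^ j\<close>; the sum of these is the binomial coefficient.\<close>

lemma yx_pow: "y ^ j * x = x * (y ^ j * (c ^ j * z ^ (j choose 2)))"
proof (induction j)
  case (Suc j)
  have "y ^ Suc j * x = y ^ j * (y * x)" by (simp only: power_Suc2 mult.assoc)
  also have "\<dots> = y ^ j * x * (y * c)" by (simp only: yx mult.assoc)
  also have "\<dots> = x * (y ^ j * (c ^ j * (z ^ (j choose 2) * y) * c))" by (simp only: Suc mult.assoc)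
  also have "z ^ (j choose 2) * y = y * z ^ (j choose 2)"
    using commute_pow[OF zy, of _ 1] by simp
  also have "c ^ j * (y * z ^ (j choose 2)) * c = c ^ j * y * (z ^ (j choose 2) * c)"
    by (simp only: mult.assoc)
  also have "z ^ (j choose 2) * c = c * z ^ (j choose 2)"
    using commute_pow[OF cz, of 1] by simp
  also have "c ^ j * y * (c * z ^ (j choose 2)) = y * (c ^ j * (z ^ j * c) * z ^ (j choose 2))"
    by (simp only: cy_pow mult.assoc)
  also have "z ^ j * c = c * z ^ j"
    using commute_pow[OF cz, of 1] by simp
  also have "c ^ j * (c * z ^ j) * z ^ (j choose 2) = c ^ Suc j * z ^ (Suc j choose 2)"
    by (simp only: mult.assoc power_Suc2 power_add choose2)
  also have "y ^ j * (y * (c ^ Suc j * z ^ (Suc j choose 2))) = y ^ Suc j * (c ^ Suc j * z ^ (Suc j choose 2))"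
    by (simp only: power_Suc2 mult.assoc)
  finally show ?case .
qed (simp add: binomial_eq_0)

lemma assoc_rule: "a * b = b * w \<Longrightarrow> a * (b * t) = b * (w * t)" for a b w t :: 'a
  by (metis mult.assoc)

lemma nf_x: "nf i j k l m n * x = nf (Suc i) j (k + j) (l + k) (m + l) (n + (j choose 2))"
proof -
  have comms: "z ^ a * x = x * z ^ a" "e ^ a * x = x * e ^ a"
    "z ^ a * c ^ b = c ^ b * z ^ a" "z ^ a * d ^ b = d ^ b * z ^ a" "z ^ a * e ^ b = e ^ b * z ^ a" for a b
    using commute_pow[OF zx, of a 1] commute_pow[OF ex, of a 1] commute_pow[OF cz, of b a]
      commute_pow[OF dz, of b a] commute_pow[OF ez, of b a] by simp_all
  note rules = comms comms[THEN assoc_rule] dx_pow[THEN assoc_rule] cx_pow[THEN assoc_rule] yx_pow[THEN assoc_rule]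
  have add: "c ^ a * (c ^ b * t) = c ^ (b + a) * t" "d ^ a * (d ^ b * t) = d ^ (b + a) * t"
     "e ^ a * (e ^ b * t) = e ^ (b + a) * t" "z ^ a * z ^ b = z ^ (b + a)" for a b t
    by (simp_all add: power_add mult.assoc[symmetric] commute_pow[of _ _ a b])
  show ?thesis unfolding nf_def
    by (simp only: mult.assoc rules add power_Suc2 add.commute)
qed

lemma nf_y: "nf i j k l m n * y = nf i (Suc j) k l m (n + k)"
proof -
  have comms: "z ^ a * y = y * z ^ a" "e ^ a * y = y * e ^ a" "d ^ a * y = y * d ^ a"
    "z ^ a * d ^ b = d ^ b * z ^ a" "z ^ a * e ^ b = e ^ b * z ^ a" for a b
    using commute_pow[OF zy, of a 1] commute_pow[OF ey, of a 1] commute_pow[OF dy, of a 1]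
      commute_pow[OF dz, of b a] commute_pow[OF ez, of b a] by simp_all
  note rules = comms comms[THEN assoc_rule] cy_pow[THEN assoc_rule]
  have add: "z ^ a * z ^ b = z ^ (b + a)" for a b
    by (simp add: power_add commute_pow[of _ _ a b])
  show ?thesis unfolding nf_def
    by (simp only: mult.assoc rules add power_Suc2 add.commute)
qed

text \<open>Repeated multiplication by \<open>x\<close> acts on the exponents like Pascal's rule, so
  binomial coefficients appear.\<close>

lemma nf_x_pow:
  "nf 0 j k l m n * x ^ i = nf i j (k + i * j) (l + k * i + j * (i choose 2))
     (m + l * i + k * (i choose 2) + j * (i choose 3)) (n + i * (j choose 2))"
proof (induction i)
  case (Suc i)
  have "nf 0 j k l m n * x ^ Suc i = nf 0 j k l m n * x ^ i * x"
    by (simp only: power_Suc2 mult.assoc)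
  also have "\<dots> = nf (Suc i) j (k + Suc i * j) (l + k * Suc i + j * (Suc i choose 2))
     (m + l * Suc i + k * (Suc i choose 2) + j * (Suc i choose 3)) (n + Suc i * (j choose 2))"
    unfolding Suc nf_x by (simp add: numeral_2_eq_2 numeral_3_eq_3 algebra_simps)
  finally show ?case .
qed (simp add: numeral_2_eq_2 numeral_3_eq_3)

lemma y_x_pow: "y ^ j * x ^ i = nf i j (i * j) (j * (i choose 2)) (j * (i choose 3)) (i * (j choose 2))"
  using nf_x_pow[of j 0 0 0 0 i] by (simp add: nf_def)

lemma c_x_pow: "c ^ k * x ^ i = nf i 0 k (k * i) (k * (i choose 2)) 0"
  using nf_x_pow[of 0 k 0 0 0 i] by (simp add: nf_def binomial_eq_0)

lemma c_y_pow: "c ^ k * y ^ j = y ^ j * c ^ k * z ^ (k * j)"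
proof -
  have "nf 0 0 k 0 0 0 * y ^ j = nf 0 j k 0 0 (k * j)"
  proof (induction j)
    case (Suc j)
    have "nf 0 0 k 0 0 0 * y ^ Suc j = nf 0 0 k 0 0 0 * y ^ j * y"
      by (simp only: power_Suc2 mult.assoc)
    thus ?case unfolding Suc nf_y by (simp add: algebra_simps)
  qed simp
  thus ?thesis by (simp add: nf_def mult.assoc)
qed

text \<open>Hall's formula up to class four. The factor number \<open>i + 1\<close> adds
  \<open>(i choose 2) + (Suc i choose 2) = i^2\<close> to the exponent of \<open>z\<close>, and the
  last entry is the sum of these squares.\<close>

lemma xy_pow: "(x * y) ^ n = nf n n (n choose 2) (n choose 3) (n choose 4) ((n choose 2) + 2 * (n choose 3))"
proof (induction n)
  case 0
  show ?case by (simp add: nf_def binomial_eq_0)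
next
  case (Suc n)
  have "(x * y) ^ Suc n = (x * y) ^ n * x * y" by (simp only: power_Suc2 mult.assoc)
  thus ?case unfolding Suc nf_x nf_y
    by (simp add: eval_nat_numeral algebra_simps)
qed

end

text \<open>From \<open>k * (n choose k) = n * ((n - 1) choose (k - 1))\<close>; this form also
  covers prime powers \<open>n\<close>.\<close>

lemma dvd_choose_coprime:
  assumes "coprime k n" "0 < k"
  shows "n dvd (n choose k)"
proof (cases n)
  case (Suc m)
  obtain l where l: "k = Suc l" using assms(2) by (cases k) auto
  have "Suc l * (Suc m choose Suc l) = Suc m * (m choose l)" by (simp only: Suc_times_binomial_eq mult.commute)
  hence "n dvd k * (n choose k)" unfolding Suc l by (metis dvd_triv_left)
  thus ?thesis using assms(1) by (simp add: coprime_commute coprime_dvd_mult_right_iff)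
qed (use assms in auto)

lemma prime_coprime_small:
  assumes "prime (p::nat)" "0 < k" "k < p"
  shows "coprime k (p ^ m)"
  using assms by (metis coprime_commute coprime_power_left_iff nat_dvd_not_less prime_imp_coprime coprime_power_right_iff)

text \<open>The commutator exponents involve \<open>p\<close> choose \<open>2\<close>,
  \<open>3\<close> and \<open>4\<close>, all divisible by \<open>p\<close> once
  \<open>p > 4\<close>.\<close>

lemma (in collection) xy_pow_prime:
  assumes "prime p" "p > 4" "c ^ p = 1" "d ^ p = 1" "e ^ p = 1" "z ^ p = 1"
  shows "(x * y) ^ p = x ^ p * y ^ p"
proof -
  have "p dvd (p choose k)" if "0 < k" "k < p" for k
    using dvd_choose_coprime[of k p] prime_coprime_small[OF assms(1) that, of 1] that by simp
  hence "p dvd (p choose 2)" "p dvd (p choose 3)" "p dvd (p choose 4)" using assms(2) by auto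
  thus ?thesis
    using assms(3-6) by (simp add: xy_pow nf_def pow_dvd_one[of _ p])
qed

section \<open>Generating pairs of a group of order \<open>p\<^sup>5\<close>\<close>

definition gpair :: "nat \<Rightarrow> 'a::grp set \<Rightarrow> 'a \<Rightarrow> 'a \<Rightarrow> bool" where
  "gpair p S x y \<longleftrightarrow> prime p \<and> 5 < p \<and> subgrp S \<and> finite S \<and> card S = p ^ 5 \<and> gen {x, y} = S"

lemma gpair_mem: "gpair p S x y \<Longrightarrow> x \<in> S" "gpair p S x y \<Longrightarrow> y \<in> S"
  using gen_mem[of x "{x, y}"] gen_mem[of y "{x, y}"] by (auto simp: gpair_def)

lemma gpair_sg:
  assumes "gpair p S x y"
  shows "subgrp S" "finite S" "prime p" "5 < p" "card S = p ^ 5"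
  using assms by (auto simp: gpair_def)

lemma gpair_swap: "gpair p S x y \<Longrightarrow> gpair p S y x"
  by (simp add: gpair_def insert_commute)

lemma gpair_change:
  assumes "gpair p S x y" "x' \<in> S" "y' \<in> S" "x \<in> gen {x', y'}" "y \<in> gen {x', y'}"
  shows "gpair p S x' y'"
  using assms gen_eqI[of S "{x, y}" "{x', y'}"] by (auto simp: gpair_def)

lemma gpair_mult_right:
  assumes "gpair p S x y"
  shows "gpair p S x (y * x ^ m)"
proof (rule gpair_change[OF assms])
  have S: "subgrp S" "x \<in> S" "y \<in> S" using gpair_sg(1)[OF assms] gpair_mem[OF assms] by auto
  show "x \<in> S" "y * x ^ m \<in> S" using S by (auto simp: sg_closed)
  show x: "x \<in> gen {x, y * x ^ m}" by (rule gen_mem) simp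
  have "y * x ^ m \<in> gen {x, y * x ^ m}" by (rule gen_mem) simp
  thus "y \<in> gen {x, y * x ^ m}" using x by (simp add: sg_mult_cancel_right sg_pow)
qed

text \<open>An exponent prime to \<open>p\<close> is invertible modulo the order, so such a power
  generates the same cyclic group.\<close>

lemma pow_inverse_exponent:
  fixes u :: "'a::grp"
  assumes "prime p" "\<not> p dvd a" "u ^ (p ^ n) = 1"
  obtains b where "(u ^ a) ^ b = u"
proof -
  have "coprime a (p ^ n)"
    using prime_imp_coprime[OF assms(1,2)] by (simp add: coprime_commute)
  then obtain b where "[a * b = 1] (mod p ^ n)"
    using cong_solve_coprime_nat[of a "p ^ n"] by auto
  hence "(u ^ a) ^ b = u" using pow_cong_mod[OF assms(3), of "a * b" 1] by (simp add: power_mult)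
  thus ?thesis by (rule that)
qed

lemma gpair_pow5: "gpair p S x y \<Longrightarrow> u \<in> S \<Longrightarrow> u ^ (p ^ 5) = 1"
  using pow_card_sg[of S u] by (auto simp: gpair_def)

lemma gpair_pow:
  assumes "gpair p S x y" "\<not> p dvd a" "\<not> p dvd b"
  shows "gpair p S (x ^ a) (y ^ b)"
proof (rule gpair_change[OF assms(1)])
  have S: "subgrp S" "x \<in> S" "y \<in> S" "prime p"
    using gpair_sg[OF assms(1)] gpair_mem[OF assms(1)] by auto
  show "x ^ a \<in> S" "y ^ b \<in> S" using S by (auto simp: sg_closed)
  have *: "u \<in> gen A" if u: "u \<in> S" "\<not> p dvd k" "u ^ k \<in> A" for u k A
  proof -
    obtain b where "(u ^ k) ^ b = u" by (rule pow_inverse_exponent[OF S(4) u(2) gpair_pow5[OF assms(1) u(1)]])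
    thus ?thesis using sg_pow[OF sg_gen gen_mem[OF u(3)], of b] by simp
  qed
  show "x \<in> gen {x ^ a, y ^ b}" "y \<in> gen {x ^ a, y ^ b}"
    using *[of x a "{x ^ a, y ^ b}"] *[of y b "{x ^ a, y ^ b}"] S assms(2,3) by auto
qed

text \<open>By Bezout \<open>H\<close> also contains \<open>u\<close> to the power
  \<open>gcd j (p ^ n)\<close>, which is a power of \<open>p\<close>, and minimality of
  \<open>b\<close> applies.\<close>

lemma dvd_exponent_mem:
  fixes u :: "'a::grp"
  assumes p: "prime p" and H: "subgrp H" and u: "u ^ (p ^ n) = 1" and least: "\<And>l. u ^ (p ^ l) \<in> H \<Longrightarrow> b \<le> l"
    and j: "u ^ j \<in> H"
  shows "p ^ b dvd j"
proof (cases "j = 0")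
  case False
  have "gcd j (p ^ n) dvd p ^ n" by simp
  then obtain l where l: "gcd j (p ^ n) = p ^ l" using p by (meson divides_primepow_nat)
  obtain s t where st: "j * t = p ^ n * s + gcd j (p ^ n)"
    using bezout_nat[OF False, of "p ^ n"] by blast
  have "(u ^ j) ^ t = u ^ (p ^ l)"
    unfolding power_mult[symmetric] st l by (simp add: power_add power_mult u)
  hence "u ^ (p ^ l) \<in> H" using sg_pow[OF H j] by metis
  from least[OF this] have "p ^ b dvd p ^ l" by (rule le_imp_power_dvd)
  thus ?thesis using l by (metis dvd_trans gcd_dvd1)
qed simp

text \<open>Divisibility of a difference, phrased without subtraction below zero.\<close>

lemma dvd_complement_eq:
  fixes i j q :: nat
  assumes "i < q" "j < q" "q dvd i + (q - j)"
  shows "i = j"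
proof (cases "j \<le> i")
  case True
  hence "i + (q - j) = q + (i - j)" using assms by simp
  hence "q dvd i - j" using assms(3) by simp
  thus ?thesis using True assms(1) by (metis diff_is_0_eq' dvd_imp_le le_antisym less_imp_diff_less
        linorder_not_less zero_less_diff)
next
  case False
  thus ?thesis using assms dvd_imp_le[of q "i + (q - j)"] by linarith
qed

text \<open>The abelianization as a product of cyclic groups of orders \<open>p ^ a\<close> and
  \<open>p ^ b\<close>, with a basis lifted to generators of \<open>S\<close>. The generator of
  larger order modulo the derived subgroup comes first, and the other one is corrected by a power of
  it.\<close>

lemma abelian_type:
  fixes S :: "'a::grp set"
  assumes xy: "gpair p S x y"
  obtains x' y' a b where "gpair p S x' y'" "b \<le> a" "card S = p ^ (a + b) * card (derived_sub S)"
    "\<And>i j. x' ^ i * y' ^ j \<in> derived_sub S \<longleftrightarrow> p ^ a dvd i \<and> p ^ b dvd j"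
proof -
  have S: "subgrp S" "finite S" "prime p" using xy by (auto simp: gpair_def)
  have xyS: "x \<in> S" "y \<in> S" using gpair_mem[OF xy] by auto
  obtain f :: "'a \<Rightarrow> 'a set sym" where f: "ghom S f" "\<And>s. s \<in> S \<Longrightarrow> f s = 1 \<longleftrightarrow> s \<in> derived_sub S"
    using quotient_hom[OF S(1) nrm_der[OF S(1)]] by blast
  have com: "f u * f v = f v * f u" if "u \<in> S" "v \<in> S" for u v
    using ghom_comm_iff[OF f(1) S(1) that] f(2)[of "comm u v"] comm_in_der[OF that] comm_closed[OF S(1) that]
    by auto
  have f5: "f u ^ (p ^ 5) = 1" if "u \<in> S" for u
    using gpair_pow5[OF xy that] ghom_pow[OF f(1) S(1) that, of "p ^ 5"] ghom_one[OF f(1) S(1)] by simp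
  define od where "od u = (LEAST l. f u ^ (p ^ l) = 1)" for u
  have od: "f u ^ (p ^ od u) = 1" "\<And>l. f u ^ (p ^ l) = 1 \<Longrightarrow> od u \<le> l" if "u \<in> S" for u
    unfolding od_def using f5[OF that] by (auto intro: LeastI Least_le)
  have "\<exists>x y. gpair p S x y \<and> od y \<le> od x"
  proof (cases "od y \<le> od x")
    case False
    thus ?thesis using gpair_swap[OF xy] by (intro exI[of _ y] exI[of _ x]) auto
  qed (use xy in auto)
  then obtain x y where xy: "gpair p S x y" and od_le: "od y \<le> od x" by blast
  have xyS: "x \<in> S" "y \<in> S" using gpair_mem[OF xy] by auto
  define a where "a = od x"
  define b where "b = (LEAST l. f y ^ (p ^ l) \<in> gen {f x})"
  have yb: "f y ^ (p ^ b) \<in> gen {f x}" "\<And>l. f y ^ (p ^ l) \<in> gen {f x} \<Longrightarrow> b \<le> l"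
    unfolding b_def using f5[OF xyS(2)] sg_one[OF sg_gen, of "{f x}"] by (auto intro: LeastI[of _ 5] Least_le)
  have "b \<le> od y" by (rule yb) (use od[OF xyS(2)] in \<open>simp add: sg_one\<close>)
  hence ba: "b \<le> a" using od_le by (simp add: a_def)
  have xa: "f x ^ (p ^ a) = 1" "\<And>i. f x ^ i = 1 \<Longrightarrow> p ^ a dvd i"
    using od[OF xyS(1)] dvd_exponent_mem[OF S(3) sg_one_set f5[OF xyS(1)], of a] by (auto simp: a_def)
  have p0: "p > 0" using S(3) by (simp add: prime_gt_0_nat)
  obtain k where k: "f y ^ (p ^ b) = f x ^ k"
    using yb(1) gen_single[OF xa(1)] p0 by auto
  \<comment> \<open>Since \<open>x\<close> has the larger order, this power is trivial, which forces
    \<open>p ^ b\<close> to divide \<open>k\<close>; only then can a power of \<open>x\<close>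
    absorb \<open>f y ^ (p ^ b)\<close>.\<close>
  have "f x ^ (k * p ^ (a - b)) = (f y ^ (p ^ b)) ^ (p ^ (a - b))" by (simp add: k power_mult)
  also have "\<dots> = f y ^ (p ^ a)" using ba by (simp flip: power_mult power_add)
  also have "\<dots> = (f y ^ (p ^ od y)) ^ (p ^ (a - od y))"
    using od_le by (simp add: a_def flip: power_mult power_add)
  also have "\<dots> = 1" using od(1)[OF xyS(2)] by simp
  finally have "p ^ (b + (a - b)) dvd k * p ^ (a - b)" using xa(2) ba by simp
  hence "p ^ b dvd k" using p0 by (simp add: power_add)
  then obtain m where m: "k = p ^ b * m" by auto
  \<comment> \<open>A natural number that plays the role of \<open>- m\<close> as an exponent of
    \<open>f x\<close>.\<close>
  define m' where "m' = p ^ a * m - m"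
  have mm: "m + m' = p ^ a * m" using p0 by (auto simp: m'_def)
  define y' where "y' = y * x ^ m'"
  have xy': "gpair p S x y'" unfolding y'_def by (rule gpair_mult_right[OF xy])
  have y'S: "y' \<in> S" using gpair_mem[OF xy'] by simp
  have fy': "f y' = f y * f x ^ m'"
    unfolding y'_def using xyS S by (simp add: ghom_mult[OF f(1)] ghom_pow[OF f(1) S(1)] sg_pow)
  have c1: "f y * f x ^ l = f x ^ l * f y" for l
    using commute_pow[OF com[OF xyS(2,1)], of 1 l] by simp
  have fy'j: "f y' ^ j = f y ^ j * f x ^ (m' * j)" for j
    unfolding fy' by (subst commute_mult_pow[OF c1], simp add: power_mult)
  have y'b: "f y' ^ (p ^ b) = 1"
  proof -
    have "f y' ^ (p ^ b) = f x ^ (p ^ b * (m + m'))"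
      unfolding fy'j k m by (simp add: algebra_simps flip: power_add)
    also have "\<dots> = (f x ^ (p ^ a)) ^ (p ^ b * m)" unfolding mm by (simp add: algebra_simps flip: power_mult)
    finally show ?thesis using xa by simp
  qed
  have ind: "p ^ a dvd i \<and> p ^ b dvd j" if "f x ^ i * f y' ^ j = 1" for i j
  proof -
    have "f x ^ i * f y' ^ j = f x ^ i * f y ^ j * f x ^ (m' * j)" by (simp add: fy'j mult.assoc)
    hence "f x ^ i * f y ^ j * f x ^ (m' * j) \<in> gen {f x}" using that sg_one[OF sg_gen] by simp
    hence "f y ^ j \<in> gen {f x}"
      using gen_mem[of "f x" "{f x}"]
      by (simp add: sg_mult_cancel_right sg_mult_cancel_left sg_pow)
    hence "p ^ b dvd j" using dvd_exponent_mem[OF S(3) sg_gen f5[OF xyS(2)] yb(2)] by blast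
    moreover from this have "f y' ^ j = 1" using pow_dvd_one[OF y'b] by blast
    ultimately show ?thesis using that xa(2) by auto
  qed
  have iff: "x ^ i * y' ^ j \<in> derived_sub S \<longleftrightarrow> p ^ a dvd i \<and> p ^ b dvd j" for i j
  proof -
    have "f (x ^ i * y' ^ j) = f x ^ i * f y' ^ j"
      using xyS y'S S by (simp add: ghom_mult[OF f(1)] ghom_pow[OF f(1) S(1)] sg_pow)
    moreover have "f x ^ i * f y' ^ j = 1" if "p ^ a dvd i \<and> p ^ b dvd j"
      using that pow_dvd_one[OF y'b] pow_dvd_one[OF xa(1)] by auto
    ultimately show ?thesis using ind f(2)[of "x ^ i * y' ^ j"] xyS y'S S by (auto simp: sg_closed)
  qed
  \<comment> \<open>Normal forms in the abelian quotient, to read off its order.\<close>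
  have "bij_betw (\<lambda>(i, j). f x ^ i * f y' ^ j) ({..<p ^ a} \<times> {..<p ^ b}) (f ` S)"
    unfolding bij_betw_def
  proof
    show "inj_on (\<lambda>(i, j). f x ^ i * f y' ^ j) ({..<p ^ a} \<times> {..<p ^ b})"
    proof (rule inj_onI, clarsimp)
      fix i j i' j'
      assume b: "i < p ^ a" "j < p ^ b" "i' < p ^ a" "j' < p ^ b"
        and eq: "f x ^ i * f y' ^ j = f x ^ i' * f y' ^ j'"
      have cxy: "f x ^ k * f y' ^ l = f y' ^ l * f x ^ k" for k l
        by (rule commute_pow) (rule com[OF xyS(1) y'S])
      have "f x ^ (i + (p ^ a - i')) * f y' ^ (j + (p ^ b - j'))
          = (f x ^ i * f y' ^ j) * (f x ^ (p ^ a - i') * f y' ^ (p ^ b - j'))"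
        unfolding power_add by (metis cxy mult.assoc)
      also have "\<dots> = f x ^ (i' + (p ^ a - i')) * f y' ^ (j' + (p ^ b - j'))"
        unfolding power_add eq by (metis cxy mult.assoc)
      also have "\<dots> = 1" using b xa y'b by simp
      finally have "p ^ a dvd i + (p ^ a - i')" "p ^ b dvd j + (p ^ b - j')" using ind by blast+
      thus "i = i' \<and> j = j'" using b by (simp add: dvd_complement_eq)
    qed
    have f1: "1 \<in> (\<lambda>(i, j). f x ^ i * f y' ^ j) ` ({..<p ^ a} \<times> {..<p ^ b})" 
      using p0 by (intro image_eqI[of _ _ "(0, 0)"]) auto
    show "(\<lambda>(i, j). f x ^ i * f y' ^ j) ` ({..<p ^ a} \<times> {..<p ^ b}) = f ` S"
    proof
      have "f x ^ i * f y' ^ j = f (x ^ i * y' ^ j)" for i j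
        using xyS y'S S by (simp add: ghom_mult[OF f(1)] ghom_pow[OF f(1) S(1)] sg_pow)
      thus "(\<lambda>(i, j). f x ^ i * f y' ^ j) ` ({..<p ^ a} \<times> {..<p ^ b}) \<subseteq> f ` S"
        using xyS y'S S by (auto simp: sg_closed)
      let ?T = "(\<lambda>(i, j). f x ^ i * f y' ^ j) ` ({..<p ^ a} \<times> {..<p ^ b})"
      have T: "f x ^ i * f y' ^ j \<in> ?T" for i j
      proof -
        have "f x ^ i = f x ^ (i mod p ^ a)" "f y' ^ j = f y' ^ (j mod p ^ b)"
          by (rule pow_cong_mod[OF xa(1)], simp add: cong_def) (rule pow_cong_mod[OF y'b], simp add: cong_def)
        thus ?thesis using p0 by (intro image_eqI[of _ _ "(i mod p ^ a, j mod p ^ b)"]) auto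
      qed
      have "subgrp ?T"
      proof (rule finite_sgI[of "f ` S"])
        fix s t assume "s \<in> ?T" "t \<in> ?T"
        then obtain i j k l where "s = f x ^ i * f y' ^ j" "t = f x ^ k * f y' ^ l" by auto
        moreover have "(f x ^ i * f y' ^ j) * (f x ^ k * f y' ^ l) = f x ^ (i + k) * f y' ^ (j + l)"
        proof -
          have "f y' ^ j * f x ^ k = f x ^ k * f y' ^ j" by (rule commute_pow) (rule com[OF y'S xyS(1)])
          thus ?thesis unfolding power_add by (metis mult.assoc)
        qed
        ultimately show "s * t \<in> ?T" using T by metis
      qed (use S f1 ghom_image_sg[OF f(1) S(1) S(1)] \<open>?T \<subseteq> f ` S\<close> in auto)
      moreover have "{f x, f y'} \<subseteq> ?T" using T[of 1 0] T[of 0 1] by simp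
      ultimately have "gen {f x, f y'} \<subseteq> ?T" by (rule gen_least)
      moreover have "f ` S = gen {f x, f y'}"
        using ghom_gen[OF f(1) S(1), of "{x, y'}"] xy' xyS y'S by (auto simp: gpair_def)
      ultimately show "f ` S \<subseteq> ?T" by simp
    qed
  qed
  hence "card (f ` S) = p ^ (a + b)" by (auto dest!: bij_betw_same_card simp: power_add)
  moreover have "{u \<in> S. f u = 1} = derived_sub S" using f(2) nrm_subset[OF nrm_der[OF S(1)]] by auto
  ultimately have "card S = p ^ (a + b) * card (derived_sub S)"
    using card_ghom[OF f(1) S(1) S(1) subset_refl S(2)] by simp
  thus ?thesis using that xy' ba iff by blast
qed

section \<open>Normal forms with boundedly many exponents\<close>

text \<open>Code \<open>0\<close> is the exponent \<open>0\<close>, code \<open>i + 1\<close> is the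
  \<open>i\<close>-th power of a primitive root; codes below \<open>5\<close> thus reach the powers
  \<open>0\<close> to \<open>3\<close>, which represent the units modulo fourth powers.\<close>

definition exponent :: "nat \<Rightarrow> nat \<Rightarrow> nat" where
  "exponent p i = (if i = 0 then 0 else (SOME r. residue_primroot p r) ^ (i - 1))"

lemma val_0 [simp]: "exponent p 0 = 0" and val_1 [simp]: "exponent p (Suc 0) = 1"
  by (simp_all add: exponent_def)

text \<open>Write \<open>t\<close> as a power \<open>r ^ k\<close> of the primitive root and divide
  \<open>k\<close> by \<open>n\<close>: the remainder gives the code, the quotient the
  \<open>n\<close>-th power.\<close>

lemma power_class_representative:
  assumes p: "prime p" and t: "\<not> p dvd t" and n: "0 < n"
  obtains i a where "i < n" "\<not> p dvd a" "[exponent p (Suc i) * a ^ n = t] (mod p)"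
proof -
  have p1: "p > 1" using p by (rule prime_gt_1_nat)
  define r where "r = (SOME r. residue_primroot p r)"
  have r: "residue_primroot p r"
    unfolding r_def by (rule someI_ex[OF prime_primitive_root_exists]) (use p p1 in auto)
  have "coprime t p" using prime_imp_coprime[OF p t] by (simp add: coprime_commute)
  moreover have "t mod p > 0" using t by (simp add: dvd_eq_mod_eq_0)
  ultimately have "t mod p \<in> totatives p"
    using p1 by (auto simp: totatives_def intro: less_imp_le)
  then obtain k where k: "t mod p = r ^ k mod p"
    using residue_primroot_is_generator[OF p1 r] by (auto simp: bij_betw_def)
  have "\<not> p dvd r"
    using r p1 by (auto simp: residue_primroot_def coprime_absorb_left)
  hence "\<not> p dvd r ^ (k div n)" using p by (meson prime_dvd_power)
  moreover have "exponent p (Suc (k mod n)) * (r ^ (k div n)) ^ n = r ^ k"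
    by (simp add: exponent_def r_def flip: power_mult power_add)
  ultimately show ?thesis
    using that[of "k mod n" "r ^ (k div n)"] n k by (simp add: cong_def)
qed

lemma linear_cong_solvable:
  assumes "prime (p::nat)" "\<not> p dvd a"
  obtains b where "[a * b = t] (mod p)"
proof -
  have "coprime a p" using prime_imp_coprime[OF assms] by (simp add: coprime_commute)
  then obtain u where "[a * u = 1] (mod p)" using cong_solve_coprime_nat[of a p] by auto
  hence "[a * u * t = 1 * t] (mod p)" by (rule cong_scalar_right)
  thus ?thesis using that[of "u * t"] by (simp add: mult.assoc)
qed

lemma additive_cong_solvable:
  assumes "prime (p::nat)" "\<not> p dvd s"
  obtains k where "p dvd k * s + t"
proof -
  \<comment> \<open>Here \<open>p - 1\<close> stands for \<open>-1\<close>.\<close>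
  obtain k where k: "[s * k = (p - 1) * t] (mod p)" using linear_cong_solvable[OF assms] by blast
  have "p - 1 + 1 = p" using prime_gt_0_nat[OF assms(1)] by simp
  hence "(p - 1) * t + t = p * t" by (metis add_mult_distrib mult_1)
  hence "[k * s + t = 0] (mod p)"
    using cong_add[OF k cong_refl[of t]] by (simp add: cong_def mult.commute)
  thus ?thesis using that by (simp add: cong_0_iff)
qed

lemma bw_one: "1 \<in> bwords (exponent p) gs"
  by (induction gs) (auto intro!: exI[of _ 0])

lemma bw_skip: "w \<in> bwords (exponent p) gs \<Longrightarrow> w \<in> bwords (exponent p) (g # gs)"
  by (auto intro!: exI[of _ 0])

lemma bw_take: "w \<in> bwords (exponent p) gs \<Longrightarrow> g * w \<in> bwords (exponent p) (g # gs)"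
  by (auto intro!: exI[of _ "Suc 0"])

lemma bw_pow: "i < 5 \<Longrightarrow> g ^ exponent p i \<in> bwords (exponent p) (g # gs)"
  using bw_one[of p gs] by (simp, intro exI[of _ i] exI[of _ 1]) simp

lemma bw_elem: "g \<in> set gs \<Longrightarrow> g \<in> bwords (exponent p) gs"
proof (induction gs)
  case (Cons h gs)
  show ?case
  proof (cases "g = h")
    case True
    thus ?thesis using bw_take[OF bw_one, of h p gs] by simp
  next
    case False
    thus ?thesis using Cons bw_skip by (metis set_ConsD)
  qed
qed simp

text \<open>The commuting alternative is split off because most pairs of generators commute and then
  no word has to be named.\<close>

lemma bounded_pc_ConsI:
  assumes "g ^ p \<in> bwords (exponent p) gs"
    and "\<And>h. h \<in> set gs \<Longrightarrow> h * g = g * h \<or> (\<exists>w\<in>bwords (exponent p) gs. h * g = g * w)"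
    and "bounded_pc p (exponent p) gs"
  shows "bounded_pc p (exponent p) (g # gs)"
  using assms bw_elem by fastforce

declare bwords.simps [simp del] bounded_pc.simps(2) [simp del]

definition bounded_presentation :: "nat \<Rightarrow> 'a::grp set \<Rightarrow> bool" where
  "bounded_presentation p S \<longleftrightarrow> (\<exists>gs. length gs = 5 \<and> gen (set gs) = S \<and> bounded_pc p (exponent p) gs)"

lemma bounded_presentationI:
  assumes "gpair p S x y" "length gs = 5" "x \<in> gen (set gs)" "y \<in> gen (set gs)" "set gs \<subseteq> S"
    "bounded_pc p (exponent p) gs"
  shows "bounded_presentation p S"
proof -
  have "gen (set gs) = S"
    by (rule gen_eqI[of S "{x, y}"]) (use assms gen_incl[of "set gs"] in \<open>auto simp: gpair_def\<close>)
  thus ?thesis using assms by (auto simp: bounded_presentation_def)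
qed

section \<open>Subgroups of prime index\<close>

lemma ord_prime_iff:
  fixes u :: "'a::grp"
  assumes "prime p" "u ^ p = 1" "u \<noteq> 1"
  shows "u ^ j = 1 \<longleftrightarrow> p dvd j"
proof
  assume j: "u ^ j = 1"
  show "p dvd j"
  proof (rule ccontr)
    assume "\<not> p dvd j"
    then obtain b where "(u ^ j) ^ b = u" using pow_inverse_exponent[of p j u 1] assms by auto
    thus False using j assms(3) by simp
  qed
qed (use assms pow_dvd_one in blast)

lemma prime_card_cyclic:
  fixes N :: "'a::grp set"
  assumes p: "prime p" and N: "subgrp N" "card N = p" and u: "u \<in> N" "u \<noteq> 1" and w: "w \<in> N"
  obtains j where "j < p" "w = u ^ j"
proof -
  have p0: "p > 0" using p by (rule prime_gt_0_nat)
  have fin: "finite N" using N p0 card_gt_0_iff by metis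
  have up: "u ^ p = 1" using pow_card_sg[OF N(1) fin u(1)] N by simp
  have "inj_on (\<lambda>i. u ^ i) {..<p}"
  proof (rule inj_onI)
    fix i j assume ij: "i \<in> {..<p}" "j \<in> {..<p}" "u ^ i = u ^ j"
    hence "u ^ (i + (p - j)) = u ^ (j + (p - j))" by (simp only: power_add)
    also have "\<dots> = 1" using ij up by simp
    finally have "p dvd i + (p - j)" using ord_prime_iff[OF p up u(2)] by blast
    thus "i = j" using ij by (simp add: dvd_complement_eq)
  qed
  hence "card ((\<lambda>i. u ^ i) ` {..<p}) = p" by (simp add: card_image)
  moreover have "(\<lambda>i. u ^ i) ` {..<p} \<subseteq> N" using N u by (auto simp: sg_pow)
  ultimately have "(\<lambda>i. u ^ i) ` {..<p} = N" using N fin by (metis card_subset_eq)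
  thus ?thesis using w that by auto
qed

text \<open>The quotient by \<open>M\<close> has prime order, so any element outside
  \<open>M\<close> generates it.\<close>

lemma prime_index_gen:
  fixes N :: "'a::grp set"
  assumes p: "prime p" and N: "subgrp N" "finite N" and M: "normal_sub M N" "card N = p * card M"
    and c: "c \<in> N" "c \<notin> M" and w: "w \<in> N"
  obtains i m where "i < p" "m \<in> M" "w = c ^ i * m"
proof -
  obtain f :: "'a \<Rightarrow> 'a set sym" where f: "ghom N f" "\<And>s. s \<in> N \<Longrightarrow> f s = 1 \<longleftrightarrow> s \<in> M"
    using quotient_hom[OF N(1) M(1)] by blast
  have "{u \<in> N. f u = 1} = M" using f(2) nrm_subset[OF M(1)] by auto
  hence "p * card M = card (f ` N) * card M"
    using card_ghom[OF f(1) N(1) N(1) subset_refl N(2)] M(2) by simp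
  moreover have "card M > 0"
    using nrm_subset[OF M(1)] N(2) sg_one[OF nrm_sg[OF M(1)]] by (auto simp: card_gt_0_iff intro: finite_subset)
  ultimately have "card (f ` N) = p" by simp
  moreover have "subgrp (f ` N)" using ghom_image_sg[OF f(1) N(1) N(1)] by simp
  ultimately obtain i where i: "i < p" "f w = f c ^ i"
    using prime_card_cyclic[OF p, of "f ` N" "f c" "f w"] c w f(2) by blast
  have "f (ginv (c ^ i) * w) = 1"
    using c w N i by (simp add: ghom_mult[OF f(1)] ghom_ginv[OF f(1)] ghom_pow[OF f(1)] sg_closed)
  hence "ginv (c ^ i) * w \<in> M" using f(2) c w N by (simp add: sg_closed)
  thus ?thesis using that[of i "ginv (c ^ i) * w"] i by simp
qed

lemma nrm_in_subgroup: "normal_sub M S \<Longrightarrow> M \<subseteq> N \<Longrightarrow> N \<subseteq> S \<Longrightarrow> normal_sub M N"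
  by (auto simp: normal_sub_def)

section \<open>The derived subgroup of order at most \<open>p\<close>\<close>

lemma bounded_presentation_abelian:
  fixes S :: "'a::grp set"
  assumes xy: "gpair p S x y" and D: "derived_sub S = {1}" and ab: "b \<le> a" "a + b = 5"
    and x: "x ^ (p ^ a) = 1" and y: "y ^ (p ^ b) = 1"
  shows "bounded_presentation p S"
proof -
  have S: "subgrp S" "x \<in> S" "y \<in> S" using gpair_sg[OF xy] gpair_mem[OF xy] by auto
  have "comm y x = 1" using comm_in_der[OF S(3,2)] D by auto
  hence c: "y * x = x * y" by (simp add: comm_eq_one_iff)
  have comm: "y ^ i * x ^ j = x ^ j * y ^ i" "x ^ i * x ^ j = x ^ j * x ^ i" "y ^ i * y ^ j = y ^ j * y ^ i" for i j
    by (auto intro: commute_pow c)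
  have c1: "y * x ^ j = x ^ j * y" "y ^ j * x = x * y ^ j" "x ^ j * x = x * x ^ j" "y ^ j * y = y * y ^ j" for j
    using comm(1)[of 1 j] comm(1)[of j 1] by (simp_all add: power_commutes)
  have pp: "(u ^ (p ^ i)) ^ p = u ^ (p ^ Suc i)" for u :: 'a and i
    by (simp add: mult.commute flip: power_mult)
  have pp1: "(u ^ p) ^ p = u ^ (p ^ 2)" for u :: 'a
    by (simp add: power2_eq_square flip: power_mult)
  \<comment> \<open>In each type the generating list consists of the successive \<open>p\<close>-th
    powers of \<open>x\<close>, followed by those of \<open>y\<close>.\<close>
  consider "a = 5" "b = 0" | "a = 4" "b = 1" | "a = 3" "b = 2" using ab by linarith
  thus ?thesis
  proof cases
    case 1
    show ?thesis
    proof (rule bounded_presentationI[OF xy, of "[x, x ^ p, x ^ (p^2), x ^ (p^3), x ^ (p^4)]"])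
      show "bounded_pc p (exponent p) [x, x ^ p, x ^ (p^2), x ^ (p^3), x ^ (p^4)]"
        by (intro bounded_pc_ConsI) (use 1 x in \<open>auto simp: c c1 comm pp pp1 bw_elem bw_one\<close>)
      show "y \<in> gen (set [x, x ^ p, x ^ (p^2), x ^ (p^3), x ^ (p^4)])"
        using 1 y by (simp add: sg_one)
    qed (use S in \<open>auto simp: sg_pow gen_mem\<close>)
  next
    case 2
    show ?thesis
      by (rule bounded_presentationI[OF xy, of "[x, x ^ p, x ^ (p^2), x ^ (p^3), y]"], simp_all add: S sg_pow gen_mem,
        intro bounded_pc_ConsI) (use 2 x y in \<open>auto simp: c c1 comm pp pp1 bw_elem bw_one\<close>)
  next
    case 3
    show ?thesis
      by (rule bounded_presentationI[OF xy, of "[x, x ^ p, x ^ (p^2), y, y ^ p]"], simp_all add: S sg_pow gen_mem,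
        intro bounded_pc_ConsI) (use 3 x y in \<open>auto simp: c c1 comm pp pp1 bw_elem bw_one\<close>)
  qed
qed

text \<open>One step of the central series below \<open>N\<close> already reaches the trivial
  group.\<close>

lemma central_of_order_p:
  fixes S :: "'a::grp set"
  assumes xy: "gpair p S x y" and N: "normal_sub N S" "card N = p" and u: "u \<in> N" "s \<in> S"
  shows "u * s = s * u"
proof -
  have "p > 1" using gpair_sg[OF xy] by auto
  hence "N \<noteq> {1}" using N by auto
  then obtain M where M: "normal_sub M S" "card N = p * card M" "\<And>u s. u \<in> N \<Longrightarrow> s \<in> S \<Longrightarrow> \<exists>w\<in>M. u * s = s * u * w"
    using central_series_step[OF gpair_sg(1,2,5,3)[OF xy] N(1)] by metis
  have "card M = 1" using M N \<open>p > 1\<close> by simp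
  then obtain m where "M = {m}" by (auto simp: card_1_singleton_iff)
  hence "M = {1}" using sg_one[OF nrm_sg[OF M(1)]] by auto
  thus ?thesis using M(3)[OF u] by auto
qed

text \<open>The derived subgroup is the normal closure of this single commutator, so a normal
  subgroup containing it cannot be smaller.\<close>

lemma comm_gens_notin:
  fixes S :: "'a::grp set"
  assumes xy: "gpair p S x y" and M: "normal_sub M S" "card M < card (derived_sub S)"
  shows "comm y x \<notin> M"
proof
  assume "comm y x \<in> M"
  hence "derived_sub S \<subseteq> M" using xy der_gen2[OF gpair_sg(1)[OF xy] _ M(1)] by (auto simp: gpair_def)
  hence "card (derived_sub S) \<le> card M"
    using gpair_sg(2)[OF xy] nrm_subset[OF M(1)] by (meson card_mono finite_subset)
  thus False using M by simp
qed

lemma nrm_one: "subgrp S \<Longrightarrow> normal_sub {1} S"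
  by (auto simp: normal_sub_def sg_one)

lemma gpair_mult_left:
  assumes "gpair p S x y"
  shows "gpair p S x (x ^ m * y)"
proof (rule gpair_change[OF assms])
  have S: "subgrp S" "x \<in> S" "y \<in> S" using gpair_sg(1)[OF assms] gpair_mem[OF assms] by auto
  show "x \<in> S" "x ^ m * y \<in> S" using S by (auto simp: sg_closed)
  show x: "x \<in> gen {x, x ^ m * y}" by (rule gen_mem) simp
  have "x ^ m * y \<in> gen {x, x ^ m * y}" by (rule gen_mem) simp
  thus "y \<in> gen {x, x ^ m * y}" using x by (simp add: sg_mult_cancel_left sg_pow)
qed

lemma pow_swap_one:
  fixes a :: "'a::monoid_mult"
  shows "a ^ m = 1 \<Longrightarrow> (a ^ n) ^ m = 1"
  by (simp add: mult.commute[of n] flip: power_mult) (simp add: power_mult)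

text \<open>Target form for a central commutator \<open>c\<close> of order \<open>p\<close>: only
  the positions of \<open>x ^ (p ^ a)\<close> and \<open>y ^ (p ^ b)\<close> in the group generated
  by \<open>c\<close> remain, and they must be coded exponents.\<close>

lemma bounded_presentation_class2_list:
  fixes S :: "'a::grp set"
  assumes xy: "gpair p S x y" and ab: "1 \<le> b" "b \<le> a" "a + b = 4"
    and c: "c \<in> S" "y * x = x * y * c" "c * x = x * c" "c * y = y * c" "c ^ p = 1"
    and x: "x ^ (p ^ a) = c ^ exponent p i" "i < 5" and y: "y ^ (p ^ b) = c ^ exponent p j" "j < 5"
  shows "bounded_presentation p S"
proof -
  have S: "subgrp S" "x \<in> S" "y \<in> S" using gpair_sg[OF xy] gpair_mem[OF xy] by auto
  interpret collection x y c 1 1 1 by standard (simp_all add: c)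
  have c1: "c * x ^ k = x ^ k * c" "c * y ^ k = y ^ k * c" for k
    using commute_pow[OF c(3), of 1 k] commute_pow[OF c(4), of 1 k] by simp_all
  have yx1: "y * x ^ p ^ Suc k = x ^ p ^ Suc k * y" for k
    using y_x_pow[of 1 "p ^ Suc k"] c(5) by (simp add: nf_def pow_dvd_one[of c p])
  have yx2: "y ^ p ^ Suc k * x = x * y ^ p ^ Suc k" for k
    using y_x_pow[of "p ^ Suc k" 1] c(5) by (simp add: nf_def pow_dvd_one[of c p])
  have yx3: "y ^ p * x ^ p = x ^ p * y ^ p"
    using y_x_pow[of p p] c(5) by (simp add: nf_def pow_dvd_one[of c p])
  have yx: "y * x ^ p = x ^ p * y" "y * x ^ p\<^sup>2 = x ^ p\<^sup>2 * y" "y ^ p * x = x * y ^ p"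
    using yx1[of 0] yx1[of 1] yx2[of 0] by (simp_all add: numeral_2_eq_2)
  have self: "u ^ k * u = u * u ^ k" "u ^ k * u ^ l = u ^ l * u ^ k" for u :: 'a and k l
    by (simp_all add: power_commutes add.commute flip: power_add)
  have pp: "(u ^ (p ^ i)) ^ p = u ^ (p ^ Suc i)" for u :: 'a and i
    by (simp add: mult.commute flip: power_mult)
  have pp1: "(u ^ p) ^ p = u ^ (p ^ 2)" for u :: 'a
    by (simp add: power2_eq_square flip: power_mult)
  have pc: "\<exists>w\<in>bwords (exponent p) gs. y * x = x * w" if "y * c \<in> bwords (exponent p) gs" for gs
    using that c(2) by (auto simp: mult.assoc)
  have b: "c ^ exponent p i \<in> bwords (exponent p) [c]" "c ^ exponent p j \<in> bwords (exponent p) [c]"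
    by (intro bw_pow x y)+
  note bw = b b[THEN bw_skip] b[THEN bw_skip, THEN bw_skip] bw_elem bw_one
  consider "a = 3" "b = 1" | "a = 2" "b = 2" using ab by linarith
  thus ?thesis
  proof cases
    case 1
    have *: "bounded_pc p (exponent p) [x, x ^ p, x ^ (p^2), y, c]"
      by (intro bounded_pc_ConsI)
        (use 1 x(1) y(1) c pc[of "[x ^ p, x ^ p\<^sup>2, y, c]"] in
        \<open>auto simp: bw c1 yx self pp pp1 bw_take bw_skip\<close>)
    show ?thesis by (rule bounded_presentationI[OF xy _ _ _ _ *]) (auto simp: S c sg_pow gen_mem)
  next
    case 2
    have *: "bounded_pc p (exponent p) [x, x ^ p, y, y ^ p, c]"
      by (intro bounded_pc_ConsI)
        (use 2 x(1) y(1) c pc[of "[x ^ p, y, y ^ p, c]"] in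
        \<open>auto simp: bw c1 yx yx3 self pp pp1 bw_take bw_skip\<close>)
    show ?thesis by (rule bounded_presentationI[OF xy _ _ _ _ *]) (auto simp: S c sg_pow gen_mem)
  qed
qed

text \<open>With \<open>x ^ (p ^ a) = c ^ s\<close> and \<open>y ^ (p ^ b) = c ^ t\<close>, a
  nonzero \<open>s\<close> is used to cancel \<open>t\<close> and is then absorbed by rescaling
  \<open>y\<close>; if \<open>s\<close> vanishes, \<open>t\<close> is absorbed by rescaling
  \<open>x\<close>.\<close>

lemma bounded_presentation_order_p:
  fixes S :: "'a::grp set"
  assumes xy: "gpair p S x y" and D: "card (derived_sub S) = p" and ab: "1 \<le> b" "b \<le> a" "a + b = 4"
    and x: "x ^ (p ^ a) \<in> derived_sub S" and y: "y ^ (p ^ b) \<in> derived_sub S"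
  shows "bounded_presentation p S"
proof -
  have S: "subgrp S" "x \<in> S" "y \<in> S" "prime p" "5 < p" using gpair_sg[OF xy] gpair_mem[OF xy] by auto
  have nD: "normal_sub (derived_sub S) S" by (rule nrm_der) fact
  define c where "c = comm y x"
  have c: "c \<in> derived_sub S" "c \<in> S" "y * x = x * y * c"
    using comm_in_der[of y S x] S mult_comm[of y x] nrm_subset[OF nD] by (auto simp: c_def)
  have c1: "c \<noteq> 1"
    using comm_gens_notin[OF xy nrm_one[OF S(1)]] D S by (auto simp: c_def)
  have cen: "c * x = x * c" "c * y = y * c" using central_of_order_p[OF xy nD D c(1)] S by auto
  have cp: "c ^ p = 1"
    using pow_card_sg[OF nrm_sg[OF nD] _ c(1)] D S(5) card_gt_0_iff[of "derived_sub S"] by auto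
  obtain s where s: "x ^ (p ^ a) = c ^ s"
    by (rule prime_card_cyclic[OF S(4) nrm_sg[OF nD] D c(1) c1 x])
  obtain t where t: "y ^ (p ^ b) = c ^ t"
    by (rule prime_card_cyclic[OF S(4) nrm_sg[OF nD] D c(1) c1 y])
  have conj: "y ^ l * x ^ k = x ^ k * y ^ l * c ^ (k * l)" for k l
  proof -
    interpret collection x y c 1 1 1 by standard (simp_all add: c cen)
    show ?thesis using y_x_pow[of l k] by (simp add: nf_def mult.assoc)
  qed
  show ?thesis
  proof (cases "p dvd s")
    case False
    then obtain f where f: "p dvd f * s + t" using additive_cong_solvable[OF S(4)] by blast
    \<comment> \<open>Chosen so that
      \<open>(x ^ m) ^ (p ^ b) = (x ^ (p ^ a)) ^ f = c ^ (f * s)\<close>, which cancels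
      \<open>c ^ t\<close>.\<close>
    define m where "m = p ^ (a - b) * f"
    define y' where "y' = x ^ m * y"
    have xy': "gpair p S x y'" unfolding y'_def by (rule gpair_mult_left[OF xy])
    interpret C: collection "x ^ m" y "c ^ m" 1 1 1
    proof
      show "y * x ^ m = x ^ m * y * c ^ m" using conj[of 1 m] by simp
      show "c ^ m * x ^ m = x ^ m * c ^ m * 1" using commute_pow[OF cen(1)] by simp
      show "c ^ m * y = y * c ^ m * 1" using commute_pow[OF cen(2), of m 1] by simp
    qed simp_all
    have "p dvd (p ^ b choose 2)"
      using dvd_choose_coprime[OF prime_coprime_small[OF S(4), of 2], of b] S(5) ab
      by (auto intro: dvd_trans[OF dvd_power[of b p]])
    hence "c ^ (m * (p ^ b choose 2)) = 1" by (intro pow_dvd_one[OF cp]) simp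
    hence "y' ^ (p ^ b) = x ^ (m * p ^ b) * y ^ (p ^ b)"
      using C.xy_pow[of "p ^ b"] by (simp add: C.nf_def y'_def flip: power_mult)
    also have "m * p ^ b = p ^ a * f" using ab by (simp add: m_def mult.commute mult.left_commute flip: power_add)
    also have "x ^ (p ^ a * f) * y ^ (p ^ b) = c ^ (f * s + t)"
      by (simp add: power_mult s t power_add) (simp flip: power_mult add: mult.commute)
    also have "\<dots> = 1" using pow_dvd_one[OF cp f] .
    finally have y'b: "y' ^ (p ^ b) = 1" .
    have ps: "\<not> p dvd s" by fact
    have "y' * x = x * y' * c"
    proof -
      have "y' * x = x ^ m * (y * x)" by (simp add: y'_def mult.assoc)
      also have "\<dots> = x ^ m * x * y * c" by (simp add: c mult.assoc)
      also have "\<dots> = x * y' * c" by (simp only: y'_def power_commutes mult.assoc[symmetric])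
      finally show ?thesis .
    qed
    moreover have cy': "c * y' = y' * c"
    proof -
      have "c * y' = x ^ m * (c * y)"
        unfolding y'_def using commute_pow[OF cen(1), of 1 m] by (simp flip: mult.assoc)
      thus ?thesis by (simp add: y'_def cen mult.assoc)
    qed
    ultimately interpret C': collection x y' c 1 1 1
      by unfold_locales (simp_all add: cen)
    \<comment> \<open>Replacing \<open>y'\<close> by its \<open>s\<close>-th power turns the
      commutator into \<open>c ^ s\<close>, that is, into \<open>x ^ (p ^ a)\<close>.\<close>
    have "gpair p S (x ^ 1) (y' ^ s)"
      by (rule gpair_pow[OF xy']) (use S ps in auto)
    moreover have "y' ^ s * x = x * y' ^ s * c ^ s"
      using C'.y_x_pow[of s 1] by (simp add: C'.nf_def mult.assoc)
    moreover have "c ^ s * x = x * c ^ s" "c ^ s * y' ^ s = y' ^ s * c ^ s"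
      using commute_pow[OF cen(1), of s 1] commute_pow[OF cy', of s s] by simp_all
    moreover have "(y' ^ s) ^ (p ^ b) = 1" using y'b by (rule pow_swap_one)
    moreover have "(c ^ s) ^ p = 1" using cp by (rule pow_swap_one)
    ultimately show ?thesis
      by (intro bounded_presentation_class2_list[OF _ ab, of p S x "y' ^ s" "c ^ s" 1 0])
        (use s c S in \<open>auto simp: sg_pow\<close>)
  next
    case True
    hence x1: "x ^ (p ^ a) = 1" using s pow_dvd_one[OF cp] by simp
    show ?thesis
    proof (cases "p dvd t")
      case True
      hence "y ^ (p ^ b) = 1" using t pow_dvd_one[OF cp] by simp
      thus ?thesis
        by (intro bounded_presentation_class2_list[OF xy ab c(2,3) cen cp, of 0 0]) (use x1 in auto)
    next
      case False
      have "gpair p S (x ^ t) (y ^ 1)"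
        by (rule gpair_pow[OF xy]) (use S False in auto)
      moreover have "y * x ^ t = x ^ t * y * c ^ t" using conj[of 1 t] by simp
      moreover have "c ^ t * x ^ t = x ^ t * c ^ t" "c ^ t * y = y * c ^ t"
        using commute_pow[OF cen(1), of t t] commute_pow[OF cen(2), of t 1] by simp_all
      moreover have "(x ^ t) ^ (p ^ a) = 1" using x1 by (rule pow_swap_one)
      moreover have "(c ^ t) ^ p = 1" using cp by (rule pow_swap_one)
      ultimately show ?thesis
        by (intro bounded_presentation_class2_list[OF _ ab, of p S "x ^ t" y "c ^ t" 0 1])
          (use t c S in \<open>auto simp: sg_pow\<close>)
    qed
  qed
qed

text \<open>Modulo \<open>K\<close> the commutator \<open>c\<close> is central and generates the
  derived subgroup. Its \<open>p\<close>-th power dies there, because moving \<open>y ^ p\<close>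
  past \<open>x\<close> costs \<open>c ^ p\<close>, while \<open>y ^ p\<close> lies in the derived
  subgroup and is therefore central modulo \<open>K\<close>.\<close>

lemma der_small_if_central:
  fixes S :: "'a::grp set"
  assumes xy: "gpair p S x y" and K: "normal_sub K S" "K \<subseteq> derived_sub S" and yp: "y ^ p \<in> derived_sub S"
    and c: "comm (comm y x) x \<in> K" "comm (comm y x) y \<in> K"
  shows "card (derived_sub S) \<le> p * card K"
proof -
  have S: "subgrp S" "finite S" "x \<in> S" "y \<in> S" "prime p" "5 < p"
    using gpair_sg[OF xy] gpair_mem[OF xy] by auto
  obtain f :: "'a \<Rightarrow> 'a set sym" where f: "ghom S f" "\<And>s. s \<in> S \<Longrightarrow> f s = 1 \<longleftrightarrow> s \<in> K"
    using quotient_hom[OF S(1) K(1)] by blast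
  have nD: "normal_sub (derived_sub S) S" by (rule nrm_der) fact
  define c' where "c' = comm y x"
  have cS: "c' \<in> S" using S by (simp add: c'_def comm_closed)
  have fc: "f c' * f x = f x * f c'" "f c' * f y = f y * f c'"
    using c f(2) ghom_comm_iff[OF f(1) S(1) cS] S cS by (auto simp: comm_closed c'_def)
  have fcc: "f c' * f s = f s * f c'" if "s \<in> S" for s
  proof -
    have "subgrp {s \<in> S. f s \<in> {t \<in> f ` S. t * f c' = f c' * t}}"
      by (intro ghom_vimage_sg[OF f(1) S(1)] sg_centralizer ghom_image_sg[OF f(1) S(1) S(1)]) simp
    hence "gen {x, y} \<subseteq> {s \<in> S. f s \<in> {t \<in> f ` S. t * f c' = f c' * t}}"
      by (rule gen_least) (use S fc in auto)
    thus ?thesis using that xy by (auto simp: gpair_def)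
  qed
  have cen: "g * f s = f s * g" if "g \<in> gen {f c'}" "s \<in> S" for g s
  proof -
    have "gen {f c'} \<subseteq> {t \<in> f ` S. t * f s = f s * t}"
      by (intro gen_least sg_centralizer ghom_image_sg[OF f(1) S(1) S(1)])
        (use fcc[OF that(2)] cS in auto)
    thus ?thesis using that by auto
  qed
  have "normal_sub {s \<in> S. f s \<in> gen {f c'}} S"
    unfolding normal_sub_def
  proof (intro conjI ballI)
    show "subgrp {s \<in> S. f s \<in> gen {f c'}}" by (intro ghom_vimage_sg[OF f(1) S(1)] sg_gen)
    fix n s assume n: "n \<in> {s \<in> S. f s \<in> gen {f c'}}" and s: "s \<in> S"
    have "f (ginv s * n * s) = ginv (f s) * (f n * f s)"
      using n s S by (simp add: ghom_mult[OF f(1)] ghom_ginv[OF f(1)] sg_closed mult.assoc)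
    also have "\<dots> = f n" using cen n s by simp
    finally show "ginv s * n * s \<in> {s \<in> S. f s \<in> gen {f c'}}" using n s S by (auto simp: sg_closed)
  qed auto
  moreover have "comm y x \<in> {s \<in> S. f s \<in> gen {f c'}}" using cS gen_mem[of "f c'"] by (auto simp: c'_def)
  ultimately have sub: "derived_sub S \<subseteq> {s \<in> S. f s \<in> gen {f c'}}"
    using der_gen2[OF S(1)] xy by (auto simp: gpair_def)
  interpret collection "f x" "f y" "f c'" 1 1 1
  proof
    have "f (y * x) = f (x * y * c')" using mult_comm[of y x] by (simp add: c'_def)
    thus "f y * f x = f x * f y * f c'" using S cS by (simp add: ghom_mult[OF f(1)] sg_closed)
  qed (simp_all add: fc)
  have "f y ^ p * f x = f x * f y ^ p"
    using cen[of "f (y ^ p)" x] sub yp S by (auto simp: ghom_pow[OF f(1)])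
  moreover have "f y ^ p * f x = f x * f y ^ p * f c' ^ p"
    using y_x_pow[of p 1] by (simp add: nf_def mult.assoc)
  ultimately have "f c' ^ p = 1" by simp
  hence "gen {f c'} = (\<lambda>i. f c' ^ i) ` {..<p}" using gen_single[of "f c'" p] S by simp
  hence "finite (gen {f c'})" "card (gen {f c'}) \<le> p" using card_image_le[of "{..<p}"] by auto
  moreover have "f ` derived_sub S \<subseteq> gen {f c'}" using sub by auto
  ultimately have "card (f ` derived_sub S) \<le> p" by (meson card_mono le_trans)
  moreover have "{u \<in> derived_sub S. f u = 1} = K" using f(2) K(2) nrm_subset[OF nD] by auto
  ultimately show ?thesis
    using card_ghom[OF f(1) S(1) nrm_sg[OF nD] nrm_subset[OF nD]] S(2) nrm_subset[OF nD]
    by (metis finite_subset mult_le_mono1)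
qed

section \<open>The derived subgroup of order \<open>p\<^sup>2\<close>\<close>

lemma prime_dvd_choose2: "prime p \<Longrightarrow> 5 < p \<Longrightarrow> p dvd (p choose 2)"
  using dvd_choose_coprime[of 2 p] prime_coprime_small[of p 2 1] by simp

lemma assoc_mult_swap: "a * b = b * a \<Longrightarrow> a * (b * t) = b * (a * t)" for a :: "'a::semigroup_mult"
  by (simp flip: mult.assoc)

lemma der_mult_pow:
  fixes S :: "'a::grp set"
  assumes S: "subgrp S" and u: "u \<in> S" "u ^ n \<in> derived_sub S" and v: "v \<in> S" "v ^ n \<in> derived_sub S"
  shows "(u * v) ^ n \<in> derived_sub S"
proof -
  obtain f :: "'a \<Rightarrow> 'a set sym" where f: "ghom S f" "\<And>s. s \<in> S \<Longrightarrow> f s = 1 \<longleftrightarrow> s \<in> derived_sub S"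
    using quotient_hom[OF S nrm_der[OF S]] by blast
  have "f u * f v = f v * f u"
    using ghom_comm_iff[OF f(1) S u(1) v(1)] f(2)[of "comm u v"] comm_in_der[OF u(1) v(1)]
      comm_closed[OF S u(1) v(1)] by auto
  hence "(f u * f v) ^ n = f u ^ n * f v ^ n" by (rule commute_mult_pow)
  hence "f ((u * v) ^ n) = f u ^ n * f v ^ n"
    using S u v by (simp add: ghom_pow[OF f(1)] ghom_mult[OF f(1)] sg_closed)
  also have "\<dots> = f (u ^ n) * f (v ^ n)" using S u v by (simp add: ghom_pow[OF f(1)])
  also have "\<dots> = 1" using f(2)[of "u ^ n"] f(2)[of "v ^ n"] S u v by (simp add: sg_closed)
  finally show ?thesis using f(2)[of "(u * v) ^ n"] S u v by (simp add: sg_closed)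
qed

text \<open>Target form: \<open>w\<close> generates the bottom subgroup, and \<open>d\<close>,
  \<open>z\<close>, \<open>x ^ (p^2)\<close> and \<open>y ^ p\<close> must be coded powers of it.
  The order of the list keeps every relation among later generators.\<close>

lemma bounded_presentation_order_p2_list:
  fixes S :: "'a::grp set"
  assumes xy: "gpair p S x y"
    and w: "w \<in> S" "w * x = x * w" "w * y = y * w" "w ^ p = 1"
    and c: "c \<in> S" "y * x = x * y * c" "c ^ p = 1" "c * w = w * c"
    and d: "c * x = x * c * w ^ exponent p i1" and z: "c * y = y * c * w ^ exponent p i2"
    and x2: "(x ^ p) ^ p = w ^ exponent p i3" and yp: "y ^ p = w ^ exponent p i4"
    and i: "i1 < 5" "i2 < 5" "i3 < 5" "i4 < 5"
  shows "bounded_presentation p S"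
proof -
  have S: "subgrp S" "x \<in> S" "y \<in> S" "prime p" "5 < p" using gpair_sg[OF xy] gpair_mem[OF xy] by auto
  have wc: "w ^ k * x = x * w ^ k" "w ^ k * y = y * w ^ k" "c * w ^ k = w ^ k * c" "w ^ k * w ^ l = w ^ l * w ^ k" for k l
    using commute_pow[OF w(2), of k 1] commute_pow[OF w(3), of k 1] commute_pow[OF c(4), of 1 k]
    by (simp_all add: add.commute flip: power_add)
  interpret collection x y c "w ^ exponent p i1" 1 "w ^ exponent p i2"
    by standard (simp_all add: c d z wc)
  have p1: "(w ^ k) ^ p = 1" for k using w(4) by (rule pow_swap_one)
  have yxp: "y * x ^ p = x ^ p * y"
    using y_x_pow[of 1 p] c(3) pow_dvd_one[OF p1 prime_dvd_choose2[OF S(4,5)]]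
    by (simp add: nf_def binomial_eq_0)
  have cxp: "c * x ^ p = x ^ p * c"
    using c_x_pow[of 1 p] p1 by (simp add: nf_def binomial_eq_0)
  have wxp: "w * x ^ p = x ^ p * w" using commute_pow[OF w(2), of 1 p] by simp
  have pc: "\<exists>v\<in>bwords (exponent p) [x ^ p, y, c, w]. y * x = x * v"
    using c(2) by (intro bexI[of _ "y * c"] bw_skip[OF bw_take[OF bw_elem]]) (auto simp: mult.assoc)
  have pd: "\<exists>v\<in>bwords (exponent p) [x ^ p, y, c, w]. c * x = x * v"
    using d i by (intro bexI[of _ "c * w ^ exponent p i1"] bw_skip[OF bw_skip[OF bw_take[OF bw_pow]]])
      (auto simp: mult.assoc)
  have pz: "\<exists>v\<in>bwords (exponent p) [c, w]. c * y = y * v"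
    using z i by (intro bexI[of _ "c * w ^ exponent p i2"] bw_take[OF bw_pow]) (auto simp: mult.assoc)
  have bw: "w ^ exponent p i3 \<in> bwords (exponent p) [y, c, w]" "w ^ exponent p i4 \<in> bwords (exponent p) [c, w]"
    using i by (auto intro: bw_skip bw_pow)
  have *: "bounded_pc p (exponent p) [x, x ^ p, y, c, w]"
    by (intro bounded_pc_ConsI) (use pc pd pz bw x2 yp c w in
      \<open>auto simp: yxp cxp wxp bw_elem bw_one power_commutes\<close>)
  show ?thesis by (rule bounded_presentationI[OF xy _ _ _ _ *]) (auto simp: S c w sg_pow gen_mem)
qed

text \<open>Setting shared by the larger cases: \<open>N\<close> is one step of the central series
  below the derived subgroup, so \<open>c\<close> generates the quotient and \<open>d\<close>,
  \<open>z\<close> lie in \<open>N\<close>.\<close>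

locale derived_step =
  fixes p :: nat and S N :: "'a::grp set" and x y :: 'a
  assumes xy: "gpair p S x y" and N: "normal_sub N S" "N \<subseteq> derived_sub S" and index: "card (derived_sub S) = p * card N"
    and DN: "\<And>u s. u \<in> derived_sub S \<Longrightarrow> s \<in> S \<Longrightarrow> \<exists>w\<in>N. u * s = s * u * w"
begin

abbreviation "c \<equiv> comm y x"
abbreviation "d \<equiv> comm c x"
abbreviation "z \<equiv> comm c y"

lemma S: "subgrp S" "finite S" "x \<in> S" "y \<in> S" "prime p" "5 < p"
  using gpair_sg[OF xy] gpair_mem[OF xy] by auto

lemma nD: "normal_sub (derived_sub S) S"
  by (rule nrm_der) (rule S)

lemma finD: "finite (derived_sub S)"
  using nrm_subset[OF nD] S(2) by (rule finite_subset)

lemma NS: "w \<in> N \<Longrightarrow> w \<in> S"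
  using nrm_subset[OF N(1)] by auto

lemma comm_N: "u \<in> derived_sub S \<Longrightarrow> s \<in> S \<Longrightarrow> comm u s \<in> N"
  using DN[of u s] comm_unique[of u s] by auto

lemma cD: "c \<in> derived_sub S" "c \<in> S"
  using comm_in_der[of y S x] S nrm_subset[OF nD] by auto

lemma c_notin: "c \<notin> N"
proof (rule comm_gens_notin[OF xy N(1)])
  have "card N > 0"
    using finite_subset[OF N(2) finD] sg_one[OF nrm_sg[OF N(1)]] by (auto simp: card_gt_0_iff)
  thus "card N < card (derived_sub S)" using index S by simp
qed

lemma dzN: "d \<in> N" "z \<in> N"
  using comm_N cD S by auto

lemma der_elem:
  assumes "u \<in> derived_sub S"
  obtains i w where "i < p" "w \<in> N" "u = c ^ i * w"
  by (rule prime_index_gen[OF S(5) nrm_sg[OF nD] finD nrm_in_subgroup[OF N(1,2) nrm_subset[OF nD]]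
      index cD(1) c_notin assms])

end

text \<open>Derived subgroup of order \<open>p^2\<close>; the abelianization then has type
  \<open>(p^2, p)\<close>.\<close>

locale order_p2 = derived_step +
  assumes cN: "card N = p" and xp: "x ^ (p ^ 2) \<in> derived_sub S" and yp: "y ^ p \<in> derived_sub S"
begin

lemma D: "card (derived_sub S) = p ^ 2"
  using index cN by (simp add: power2_eq_square)

lemma N_pow: "w \<in> N \<Longrightarrow> w ^ p = 1"
  using pow_card_sg[OF nrm_sg[OF N(1)] finite_subset[OF N(2) finD]] cN by simp

lemma N_central: "w \<in> N \<Longrightarrow> s \<in> S \<Longrightarrow> w * s = s * w"
  by (rule central_of_order_p[OF xy N(1) cN])

sublocale collection x y c d 1 z
proof
  show "y * x = x * y * c" "c * x = x * c * d" "c * y = y * c * z" by (rule mult_comm)+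
  show "d * x = x * d * 1" "d * y = y * d" "z * x = x * z" "z * y = y * z"
    "c * d = d * c" "c * z = z * c" "d * z = z * d"
    using N_central[OF dzN(1) S(3)] N_central[OF dzN(1) S(4)] N_central[OF dzN(2) S(3)] N_central[OF dzN(2) S(4)]
      N_central[OF dzN(1) cD(2)] N_central[OF dzN(2) cD(2)] N_central[OF dzN(1) NS[OF dzN(2)]]
    by auto
qed simp_all

text \<open>Otherwise \<open>c\<close> would be central and the derived subgroup too small.\<close>

lemma dz_one: "d \<noteq> 1 \<or> z \<noteq> 1"
proof (rule ccontr)
  assume "\<not> ?thesis"
  hence "card (derived_sub S) \<le> p * card {1::'a}"
    by (intro der_small_if_central[OF xy nrm_one[OF S(1)] _ yp]) (auto simp: sg_one[OF nrm_sg[OF nD]])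
  thus False using D S by (simp add: power2_eq_square)
qed

lemma c_pow2: "c ^ (p ^ 2) = 1"
  using pow_card_sg[OF nrm_sg[OF nD] finD cD(1)] D by simp

lemma c_N_x: "w \<in> N \<Longrightarrow> (c ^ i * w) * x = x * (c ^ i * w) * d ^ i"
  using N_central[of w x] N_central[of w "d ^ i"] S NS[OF dzN(1)]
  by (simp add: assoc_rule[OF cx_pow] mult.assoc sg_pow)

lemma c_N_y: "w \<in> N \<Longrightarrow> (c ^ i * w) * y = y * (c ^ i * w) * z ^ i"
  using N_central[of w y] N_central[of w "z ^ i"] S NS[OF dzN(2)]
  by (simp add: assoc_rule[OF cy_pow] mult.assoc sg_pow)

lemma N_elem:
  assumes "u \<in> N" "u \<noteq> 1" "w \<in> N"
  obtains j where "j < p" "w = u ^ j"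
  by (rule prime_card_cyclic[OF S(5) nrm_sg[OF N(1)] cN assms])

lemma N_pow_iff: "u \<in> N \<Longrightarrow> u \<noteq> 1 \<Longrightarrow> u ^ j = 1 \<longleftrightarrow> p dvd j"
  by (rule ord_prime_iff[OF S(5) N_pow])

text \<open>Two evaluations of the same product: collection of \<open>y ^ p\<close> past
  \<open>x\<close> yields \<open>c ^ p\<close>, the expression through \<open>c ^ i\<close> yields
  \<open>d ^ i\<close>. For \<open>z\<close>, note that \<open>y ^ p\<close> commutes with
  \<open>y\<close>.\<close>

lemma y_pow_eq:
  assumes "w \<in> N" "y ^ p = c ^ i * w"
  shows "c ^ p = d ^ i" "z ^ i = 1"
proof -
  have "y ^ p * x = x * y ^ p * c ^ p"
    using y_x_pow[of p 1] pow_dvd_one[OF N_pow[OF dzN(2)] prime_dvd_choose2[OF S(5,6)]]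
    by (simp add: nf_def binomial_eq_0 mult.assoc)
  moreover have "y ^ p * x = x * y ^ p * d ^ i" unfolding assms(2) by (rule c_N_x[OF assms(1)])
  ultimately show "c ^ p = d ^ i" by simp
  have "y ^ p * y = y * y ^ p * z ^ i" unfolding assms(2) by (rule c_N_y[OF assms(1)])
  thus "z ^ i = 1" by (simp add: power_commutes)
qed

text \<open>The power commutes with both generators, so its \<open>c\<close>-exponent
  \<open>i\<close> satisfies \<open>d ^ i = z ^ i = 1\<close> and is divisible by
  \<open>p\<close>.\<close>

lemma x_pow2_N: "x ^ (p ^ 2) \<in> N"
proof -
  obtain i w where iw: "i < p" "w \<in> N" "x ^ (p ^ 2) = c ^ i * w" using der_elem[OF xp] .
  have "x ^ (p ^ 2) * x = x * x ^ (p ^ 2) * d ^ i" unfolding iw(3) by (rule c_N_x[OF iw(2)])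
  hence d1: "d ^ i = 1" by (simp add: power_commutes)
  have p2: "p dvd (p ^ 2 choose 2)"
    using dvd_choose_coprime[OF prime_coprime_small[OF S(5), of 2], of 2] S(6)
    by (auto intro: dvd_trans[OF dvd_power[of 2 p]])
  have "y * x ^ (p ^ 2) = x ^ (p ^ 2) * y"
    using y_x_pow[of 1 "p ^ 2"] pow_dvd_one[OF N_pow[OF dzN(1)] p2] c_pow2
    by (simp add: nf_def binomial_eq_0)
  moreover have "x ^ (p ^ 2) * y = y * x ^ (p ^ 2) * z ^ i" unfolding iw(3) by (rule c_N_y[OF iw(2)])
  ultimately have z1: "z ^ i = 1" by simp
  have "p dvd i" using dz_one N_pow_iff[OF dzN(1), of i] N_pow_iff[OF dzN(2), of i] d1 z1 by auto
  hence "i = 0" using iw(1) by (auto dest: dvd_imp_le)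
  thus ?thesis using iw by simp
qed

lemma x_p_central:
  assumes "c ^ p = 1"
  shows "y * x ^ p = x ^ p * y" "c * x ^ p = x ^ p * c"
  using y_x_pow[of 1 p] assms pow_dvd_one[OF N_pow[OF dzN(1)] prime_dvd_choose2[OF S(5,6)]]
    c_x_pow[of 1 p] N_pow[OF dzN(1)]
  by (simp_all add: nf_def binomial_eq_0)

text \<open>Here \<open>x\<^sup>p\<close> is central, so multiplying \<open>y\<close> by a power of it does not change the commutators.\<close>

lemma kill_y_pow:
  assumes cp: "c ^ p = 1" and ypN: "y ^ p \<in> N" and x2: "x ^ (p ^ 2) \<noteq> 1"
  obtains y' where "gpair p S x y'" "y' ^ p = 1" "y' * x = x * y' * c" "c * y' = y' * c * z"
proof -
  obtain j where j: "y ^ p = (x ^ (p ^ 2)) ^ j" using N_elem[OF x_pow2_N x2 ypN] .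
  obtain f where f: "p dvd f * 1 + j"
    using additive_cong_solvable[OF S(5), of 1 j] S by (metis not_prime_unit nat_dvd_1_iff_1 S(5))
  define y' where "y' = x ^ (p * f) * y"
  have xpf: "y * x ^ (p * f) = x ^ (p * f) * y" "c * x ^ (p * f) = x ^ (p * f) * c"
    using commute_pow[OF x_p_central(1)[OF cp], of 1 f] commute_pow[OF x_p_central(2)[OF cp], of 1 f]
    by (simp_all add: power_mult)
  have "y' ^ p = (x ^ (p * f)) ^ p * y ^ p" unfolding y'_def by (rule commute_mult_pow) (simp add: xpf)
  also have "(x ^ (p * f)) ^ p = (x ^ (p ^ 2)) ^ f"
    by (simp add: power2_eq_square ac_simps flip: power_mult)
  also have "\<dots> * y ^ p = (x ^ (p ^ 2)) ^ (f * 1 + j)" by (simp only: j power_add mult_1_right)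
  also have "\<dots> = 1" using pow_dvd_one[OF N_pow[OF x_pow2_N] f] .
  finally have "y' ^ p = 1" .
  moreover have "y' * x = x * y' * c"
  proof -
    have "y' * x = x ^ (p * f) * (x * y * c)" by (simp only: y'_def mult.assoc yx)
    also have "\<dots> = x * y' * c" by (simp only: y'_def power_commutes mult.assoc[symmetric])
    finally show ?thesis .
  qed
  moreover have "c * y' = y' * c * z"
  proof -
    have "c * y' = x ^ (p * f) * (c * y)" by (simp only: y'_def mult.assoc[symmetric] xpf)
    thus ?thesis by (simp only: y'_def mult.assoc cy)
  qed
  ultimately show ?thesis using that gpair_mult_left[OF xy, of "p * f"] by (auto simp: y'_def)
qed

text \<open>If \<open>x ^ (p^2) = d ^ s\<close> is nontrivial, \<open>y ^ p\<close> is cancelled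
  against it and rescaling \<open>y\<close> by \<open>s\<close> makes \<open>d\<close> equal to it.
  Otherwise rescaling \<open>x\<close> by \<open>a\<close> turns \<open>d\<close> into
  \<open>d ^ (a^2)\<close>, so \<open>y ^ p = d ^ j\<close> matters only modulo squares.\<close>

lemma bounded_presentation_z_trivial:
  assumes cp: "c ^ p = 1" and ypN: "y ^ p \<in> N" and z: "z = 1"
  shows "bounded_presentation p S"
proof -
  have d1: "d \<noteq> 1" using dz_one z by simp
  have cxd: "c * d = d * c" using N_central[OF dzN(1) cD(2)] by simp
  have xx: "(x ^ p) ^ p = x ^ (p ^ 2)" by (simp add: power2_eq_square flip: power_mult)
  show ?thesis
  proof (cases "x ^ (p ^ 2) = 1")
    case False
    obtain s where s: "s < p" "x ^ (p ^ 2) = d ^ s" using N_elem[OF dzN(1) d1 x_pow2_N] .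
    have ps: "\<not> p dvd s" using False s N_pow_iff[OF dzN(1) d1] by simp
    obtain y' where y': "gpair p S x y'" "y' ^ p = 1" "y' * x = x * y' * c" "c * y' = y' * c * z"
      using kill_y_pow[OF cp ypN False] .
    have y'S: "y' \<in> S" using gpair_mem[OF y'(1)] by simp
    have dy': "d * y' = y' * d" using N_central[OF dzN(1) y'S] .
    interpret C: collection x y' c d 1 1
      by standard (use y' z dy' in \<open>simp_all add: cx dx cd\<close>)
    have "gpair p S (x ^ 1) (y' ^ s)" by (rule gpair_pow[OF y'(1)]) (use S ps in auto)
    moreover have "y' ^ s * x = x * y' ^ s * c ^ s"
      using C.y_x_pow[of s 1] by (simp add: C.nf_def binomial_eq_0 mult.assoc)
    moreover have "c ^ s * x = x * c ^ s * d ^ s"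
      using cx_pow[of s] by (simp add: mult.assoc)
    moreover have "c ^ s * y' ^ s = y' ^ s * c ^ s" using commute_pow[of c y' s s] y' z by simp
    moreover have "d ^ s * x = x * d ^ s" using commute_pow[of d x s 1] dx by simp
    moreover have "d ^ s * y' ^ s = y' ^ s * d ^ s" using commute_pow[OF dy'] .
    moreover have "c ^ s * d ^ s = d ^ s * c ^ s" using commute_pow[OF cxd] .
    moreover have "(y' ^ s) ^ p = 1" "(c ^ s) ^ p = 1" "(d ^ s) ^ p = 1"
      using pow_swap_one[OF y'(2)] pow_swap_one[OF cp] pow_swap_one[OF N_pow[OF dzN(1)]] by auto
    ultimately show ?thesis
      by (intro bounded_presentation_order_p2_list[of p S x "y' ^ s" "d ^ s" "c ^ s" 1 0 1 0])
        (use cD NS[OF dzN(1)] S s xx in \<open>auto simp: sg_pow\<close>)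
  next
    case True
    obtain j where j: "j < p" "y ^ p = d ^ j" using N_elem[OF dzN(1) d1 ypN] .
    show ?thesis
    proof (cases "j = 0")
      case True
      show ?thesis
        by (rule bounded_presentation_order_p2_list[of p S x y d c 1 0 0 0])
          (use xy j True \<open>x ^ (p ^ 2) = 1\<close> xx cD NS[OF dzN(1)] N_pow[OF dzN(1)] cp cxd z in
            \<open>auto simp: yx cx cy dx dy\<close>)
    next
      case False
      hence "\<not> p dvd j" using j by (auto dest: dvd_imp_le)
      then obtain i a where ia: "i < 2" "\<not> p dvd a" "[exponent p (Suc i) * a ^ 2 = j] (mod p)"
        using power_class_representative[OF S(5), of j 2] by auto
      \<comment> \<open>The commutator of \<open>y\<close> with \<open>x ^ a\<close>, read off from
        \<open>y_x_pow\<close>.\<close>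
      define c' where "c' = c ^ a * d ^ (a choose 2)"
      have "gpair p S (x ^ a) (y ^ 1)" by (rule gpair_pow[OF xy]) (use S ia in auto)
      moreover have "y * x ^ a = x ^ a * y * c'"
        using y_x_pow[of 1 a] unfolding nf_def by (simp add: z binomial_eq_0 mult.assoc c'_def)
      moreover have "c' * x ^ a = x ^ a * c' * d ^ (a ^ 2)"
      proof -
        have "c' * x ^ a = c ^ a * (d ^ (a choose 2) * x ^ a)" by (simp add: c'_def mult.assoc)
        also have "d ^ (a choose 2) * x ^ a = x ^ a * d ^ (a choose 2)"
          using commute_pow[of d x] dx by simp
        also have "c ^ a * (x ^ a * d ^ (a choose 2)) = x ^ a * (c ^ a * (d ^ (a * a) * d ^ (a choose 2)))"
          using c_x_pow[of a a] by (simp add: nf_def binomial_eq_0 flip: mult.assoc)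
        also have "d ^ (a * a) * d ^ (a choose 2) = d ^ (a choose 2) * d ^ (a ^ 2)"
          by (simp add: power2_eq_square add.commute flip: power_add)
        finally show ?thesis by (simp add: c'_def mult.assoc)
      qed
      moreover have "c' * y = y * c'"
        using commute_pow[of c y a 1] commute_pow[of d y "a choose 2" 1] cy dy z
        by (simp add: c'_def) (metis mult.assoc)
      moreover have "d ^ a ^ 2 * x ^ a = x ^ a * d ^ a ^ 2" "d ^ a ^ 2 * y = y * d ^ a ^ 2"
        using commute_pow[of d x "a ^ 2" a] commute_pow[of d y "a ^ 2" 1] dx dy by simp_all
      moreover have "c' \<in> S" using cD NS[OF dzN(1)] S by (simp add: c'_def sg_closed)
      moreover have "c' ^ p = 1"
        unfolding c'_def commute_mult_pow[OF commute_pow[OF cxd]]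
        using pow_swap_one[OF cp] pow_swap_one[OF N_pow[OF dzN(1)]] by simp
      moreover have "c' * d ^ a ^ 2 = d ^ a ^ 2 * c'"
        using N_central[of "d ^ a ^ 2" c'] \<open>c' \<in> S\<close> dzN(1) nrm_sg[OF N(1)] by (simp add: sg_pow)
      moreover have "((x ^ a) ^ p) ^ p = 1"
        using pow_swap_one[OF \<open>x ^ (p ^ 2) = 1\<close>, of a] by (simp add: power2_eq_square mult.assoc flip: power_mult)
      moreover have "y ^ p = (d ^ a ^ 2) ^ exponent p (Suc i)"
        using pow_cong_mod[OF N_pow[OF dzN(1)] ia(3)] j by (simp add: mult.commute flip: power_mult)
      moreover have "(d ^ a ^ 2) ^ p = 1" using pow_swap_one[OF N_pow[OF dzN(1)]] .
      ultimately show ?thesis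
        by (intro bounded_presentation_order_p2_list[of p S "x ^ a" y "d ^ a ^ 2" c' 1 0 0 "Suc i"])
          (use NS[OF dzN(1)] S ia in \<open>auto simp: sg_pow\<close>)
    qed
  qed
qed

text \<open>The mirror image, with different weights: rescaling \<open>y\<close> by \<open>k\<close>
  turns \<open>z\<close> into \<open>z ^ (k^2)\<close>, so \<open>x ^ (p^2)\<close> matters modulo
  squares, while rescaling \<open>x\<close> by \<open>j\<close> turns \<open>z\<close> into
  \<open>z ^ j\<close> and absorbs \<open>y ^ p\<close> outright.\<close>

lemma bounded_presentation_d_trivial:
  assumes cp: "c ^ p = 1" and ypN: "y ^ p \<in> N" and d: "d = 1"
  shows "bounded_presentation p S"
proof -
  have z1: "z \<noteq> 1" using dz_one d by simp
  have xx: "(x ^ p) ^ p = x ^ (p ^ 2)" by (simp add: power2_eq_square flip: power_mult)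
  show ?thesis
  proof (cases "x ^ (p ^ 2) = 1")
    case False
    obtain s where s: "s < p" "x ^ (p ^ 2) = z ^ s" using N_elem[OF dzN(2) z1 x_pow2_N] .
    have "\<not> p dvd s" using False s N_pow_iff[OF dzN(2) z1] by simp
    then obtain i k where ik: "i < 2" "\<not> p dvd k" "[exponent p (Suc i) * k ^ 2 = s] (mod p)"
      using power_class_representative[OF S(5), of s 2] by auto
    obtain y' where y': "gpair p S x y'" "y' ^ p = 1" "y' * x = x * y' * c" "c * y' = y' * c * z"
      using kill_y_pow[OF cp ypN False] .
    have y'S: "y' \<in> S" using gpair_mem[OF y'(1)] by simp
    have zy': "z * y' = y' * z" using N_central[OF dzN(2) y'S] .
    interpret C: collection x y' c 1 1 z
      by standard (use y' d zy' cx in \<open>simp_all add: zx cz\<close>)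
    define c' where "c' = c ^ k * z ^ (k choose 2)"
    have c'S: "c' \<in> S" using cD NS[OF dzN(2)] S by (simp add: c'_def sg_closed)
    have zN: "z ^ l \<in> N" for l using dzN(2) nrm_sg[OF N(1)] by (simp add: sg_pow)
    have "gpair p S (x ^ 1) (y' ^ k)" by (rule gpair_pow[OF y'(1)]) (use S ik in auto)
    moreover have "y' ^ k * x = x * y' ^ k * c'"
      using C.y_x_pow[of k 1] by (simp add: C.nf_def binomial_eq_0 mult.assoc c'_def)
    moreover have "c' * x = x * c'"
      using commute_pow[of c x k 1] commute_pow[of z x "k choose 2" 1] cx zx d
      by (simp add: c'_def) (metis mult.assoc)
    moreover have "c' * y' ^ k = y' ^ k * c' * z ^ k ^ 2"
    proof -
      have "c' * y' ^ k = c ^ k * (z ^ (k choose 2) * y' ^ k)" by (simp add: c'_def mult.assoc)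
      also have "z ^ (k choose 2) * y' ^ k = y' ^ k * z ^ (k choose 2)" using commute_pow[OF zy'] .
      also have "c ^ k * (y' ^ k * z ^ (k choose 2)) = y' ^ k * (c ^ k * (z ^ (k * k) * z ^ (k choose 2)))"
        using C.c_y_pow[of k k] by (simp add: flip: mult.assoc)
      also have "z ^ (k * k) * z ^ (k choose 2) = z ^ (k choose 2) * z ^ (k ^ 2)"
        by (simp add: power2_eq_square add.commute flip: power_add)
      finally show ?thesis by (simp add: c'_def mult.assoc)
    qed
    moreover have "z ^ k ^ 2 * x = x * z ^ k ^ 2" "z ^ k ^ 2 * y' ^ k = y' ^ k * z ^ k ^ 2"
      "c' * z ^ k ^ 2 = z ^ k ^ 2 * c'"
      using N_central[OF zN] S y'S c'S by (simp_all add: sg_pow)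
    moreover have "c' ^ p = 1"
      unfolding c'_def commute_mult_pow[OF commute_pow[OF cz]]
      using pow_swap_one[OF cp] pow_swap_one[OF N_pow[OF dzN(2)]] by simp
    moreover have "(y' ^ k) ^ p = 1" using pow_swap_one[OF y'(2)] .
    moreover have "(x ^ p) ^ p = (z ^ k ^ 2) ^ exponent p (Suc i)"
      using pow_cong_mod[OF N_pow[OF dzN(2)] ik(3)] s xx by (simp add: mult.commute flip: power_mult)
    moreover have "(z ^ k ^ 2) ^ p = 1" using pow_swap_one[OF N_pow[OF dzN(2)]] .
    ultimately show ?thesis
      by (intro bounded_presentation_order_p2_list[of p S x "y' ^ k" "z ^ k ^ 2" c' 0 1 "Suc i" 0])
        (use NS[OF dzN(2)] S ik c'S in \<open>auto simp: sg_pow\<close>)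
  next
    case True
    obtain j where j: "j < p" "y ^ p = z ^ j" using N_elem[OF dzN(2) z1 ypN] .
    show ?thesis
    proof (cases "j = 0")
      case True
      show ?thesis
        by (rule bounded_presentation_order_p2_list[of p S x y z c 0 1 0 0])
          (use xy j True \<open>x ^ (p ^ 2) = 1\<close> xx cD NS[OF dzN(2)] N_pow[OF dzN(2)] cp cz d in
            \<open>auto simp: yx cx cy zx zy\<close>)
    next
      case False
      hence "\<not> p dvd j" using j by (auto dest: dvd_imp_le)
      hence "gpair p S (x ^ j) (y ^ 1)" by (intro gpair_pow[OF xy]) (use S in auto)
      moreover have "y * x ^ j = x ^ j * y * c ^ j"
        using y_x_pow[of 1 j] unfolding nf_def by (simp add: d binomial_eq_0 mult.assoc)
      moreover have "c ^ j * x ^ j = x ^ j * c ^ j" using commute_pow[of c x] cx d by simp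
      moreover have "c ^ j * y = y * c ^ j * z ^ j" using c_y_pow[of j 1] by simp
      moreover have "z ^ j * x ^ j = x ^ j * z ^ j" "z ^ j * y = y * z ^ j" "c ^ j * z ^ j = z ^ j * c ^ j"
        using commute_pow[OF zx] commute_pow[OF zy, of j 1] commute_pow[OF cz] by simp_all
      moreover have "(c ^ j) ^ p = 1" "(z ^ j) ^ p = 1"
        using pow_swap_one[OF cp] pow_swap_one[OF N_pow[OF dzN(2)]] by auto
      moreover have "((x ^ j) ^ p) ^ p = 1"
        using pow_swap_one[OF \<open>x ^ (p ^ 2) = 1\<close>, of j] by (simp add: power2_eq_square mult.assoc flip: power_mult)
      ultimately show ?thesis
        by (intro bounded_presentation_order_p2_list[of p S "x ^ j" y "z ^ j" "c ^ j" 0 1 0 1])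
          (use cD NS[OF dzN(2)] S j in \<open>auto simp: sg_pow\<close>)
    qed
  qed
qed

end

text \<open>Here \<open>y\<^sup>p\<close> generates the derived subgroup; the group is metacyclic and unique.\<close>

lemma bounded_presentation_metacyclic:
  fixes S :: "'a::grp set"
  assumes xy: "gpair p S x y" and cS: "c \<in> S" "d \<in> S"
    and yx: "y * x = x * y * c" and cx: "c * x = x * c * d" and cy: "c * y = y * c"
    and dx: "d * x = x * d" and dy: "d * y = y * d" and dp: "d ^ p = 1" and cp: "c ^ p = d"
    and yp: "y ^ p = c * d ^ j" and xp: "x ^ (p ^ 2) = d ^ s'"
  shows "bounded_presentation p S"
proof -
  have S: "subgrp S" "x \<in> S" "y \<in> S" "prime p" "5 < p" using gpair_sg[OF xy] gpair_mem[OF xy] by auto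
  have cd: "c * d = d * c" unfolding cp[symmetric] by (simp add: power_commutes)
  have c2: "c ^ (p ^ 2) = 1" using dp by (simp add: cp power2_eq_square power_mult)
  have pp2: "p dvd p ^ 2" by (simp add: power2_eq_square)
  have p2: "p dvd (p ^ 2 choose 3)" "p ^ 2 dvd (p ^ 2 choose 2)" "p dvd (p choose 2)"
    using dvd_choose_coprime[OF prime_coprime_small[OF S(4), of 2], of 2] prime_dvd_choose2[OF S(4,5)] S(5)
      dvd_trans[OF pp2 dvd_choose_coprime[OF prime_coprime_small[OF S(4), of 3]]] by simp_all
  interpret A: collection x y c d 1 1 by standard (simp_all add: yx cx cy dx dy cd)
  \<comment> \<open>Since \<open>c ^ p = d\<close>, passing to \<open>x ^ n\<close> turns the
    commutator into \<open>c ^ n = c * d ^ j = y ^ p\<close>, and \<open>d\<close> is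
    unchanged.\<close>
  define n where "n = 1 + p * j"
  define x1 where "x1 = x ^ n"
  define c1 where "c1 = c * d ^ j"
  have "\<not> p dvd n" using S(4) unfolding n_def by (metis dvd_add_left_iff dvd_triv_left not_prime_unit)
  hence "gpair p S (x ^ n) (y ^ 1)" by (intro gpair_pow[OF xy]) (use S in auto)
  hence xy1: "gpair p S x1 y" by (simp add: x1_def)
  have "p dvd (n choose 2)"
  proof -
    have "2 * (n choose 2) = n * (p * j)" by (simp add: choose_two n_def)
    hence "p dvd 2 * (n choose 2)" by simp
    moreover have "coprime p 2" using prime_coprime_small[OF S(4), of 2 1] S(5) by (simp add: coprime_commute)
    ultimately show ?thesis by (simp add: coprime_dvd_mult_right_iff)
  qed
  moreover have "c ^ n = c1" by (simp add: n_def c1_def power_mult cp)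
  ultimately have yx1: "y * x1 = x1 * y * c1"
    using A.y_x_pow[of 1 n] pow_dvd_one[OF dp] by (simp add: A.nf_def binomial_eq_0 mult.assoc x1_def)
  have dn: "d ^ n = d" using pow_dvd_one[OF dp, of "p * j"] by (simp add: n_def)
  have dx1: "d ^ k * x1 = x1 * d ^ k" for k unfolding x1_def using commute_pow[OF dx] .
  have cx1: "c1 * x1 = x1 * c1 * d"
  proof -
    have "c * x ^ n = x ^ n * c * d" using A.c_x_pow[of 1 n] by (simp add: A.nf_def binomial_eq_0 mult.assoc dn)
    hence "c1 * x1 = x1 * (c * (d * d ^ j))"
      unfolding c1_def mult.assoc dx1 unfolding x1_def by (simp flip: mult.assoc)
    thus ?thesis by (simp add: c1_def mult.assoc power_commutes)
  qed
  have cdj: "c * d ^ j = d ^ j * c" using commute_pow[OF cd, of 1 j] by simp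
  have cp1: "c1 ^ p = d" unfolding c1_def commute_mult_pow[OF cdj] cp using pow_swap_one[OF dp] by simp
  have cy1: "c1 * y = y * c1"
    using commute_pow[OF dy, of j 1] cy by (simp add: c1_def) (metis mult.assoc)
  have yp1: "y ^ p = c1" by (simp add: yp c1_def)
  have cd1: "c1 * d = d * c1" unfolding cp1[symmetric] by (simp add: power_commutes)
  have c21: "c1 ^ (p ^ 2) = 1" using dp by (simp add: cp1 power2_eq_square power_mult)
  have xp1: "x1 ^ (p ^ 2) = d ^ (s' * n)"
    unfolding x1_def power_mult xp[symmetric] by (simp add: mult.commute flip: power_mult)
  \<comment> \<open>As \<open>y ^ (p^2) = d\<close>, multiplying \<open>x1\<close> by
    \<open>y ^ m\<close> cancels \<open>x1 ^ (p^2)\<close>; afterwards no parameter is left.\<close>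
  obtain m where m: "p dvd m * 1 + s' * n"
    using additive_cong_solvable[OF S(4), of 1 "s' * n"] S(4) by (metis nat_dvd_1_iff_1 not_prime_1)
  define x2 where "x2 = x1 * y ^ m"
  have xy2: "gpair p S x2 y"
    unfolding x2_def by (rule gpair_swap[OF gpair_mult_right[OF gpair_swap[OF xy1]]])
  have x2S: "x2 \<in> S" using gpair_mem[OF xy2] by simp
  have c1S: "c1 \<in> S" using S cS by (simp add: c1_def sg_closed)
  have cym: "c1 * y ^ m = y ^ m * c1" using commute_pow[OF cy1, of 1 m] by simp
  have dym: "d ^ k * y ^ m = y ^ m * d ^ k" for k using commute_pow[OF dy] .
  have yx2: "y * x2 = x2 * y * c1"
  proof -
    have "y * x2 = x1 * y * (c1 * y ^ m)" by (simp only: x2_def yx1 mult.assoc[symmetric])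
    also have "\<dots> = x1 * (y * y ^ m) * c1" by (simp only: cym mult.assoc)
    also have "y * y ^ m = y ^ m * y" by (simp add: power_commutes)
    finally show ?thesis by (simp only: x2_def mult.assoc)
  qed
  have cx2: "c1 * x2 = x2 * c1 * d"
  proof -
    have "c1 * x2 = x1 * c1 * (d * y ^ m)" by (simp only: x2_def cx1 mult.assoc[symmetric])
    also have "d * y ^ m = y ^ m * d" using dym[of 1] by simp
    also have "x1 * c1 * (y ^ m * d) = x1 * (c1 * y ^ m) * d" by (simp only: mult.assoc)
    finally show ?thesis by (simp only: cym x2_def mult.assoc)
  qed
  have dx2: "d * x2 = x2 * d"
  proof -
    have "d * x2 = x1 * (d * y ^ m)" using dx1[of 1] by (simp add: x2_def flip: mult.assoc)
    thus ?thesis using dym[of 1] by (simp add: x2_def mult.assoc)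
  qed
  interpret B: collection x1 y c1 d 1 1
    by standard (use dx1[of 1] in \<open>simp_all add: yx1 cx1 cy1 dy cd1\<close>)
  interpret C: collection x1 "y ^ m" "c1 ^ m" "d ^ m" 1 1
  proof
    show "y ^ m * x1 = x1 * y ^ m * c1 ^ m"
      using B.y_x_pow[of m 1] by (simp add: B.nf_def binomial_eq_0 mult.assoc)
    show "c1 ^ m * x1 = x1 * c1 ^ m * d ^ m"
      using B.c_x_pow[of m 1] by (simp add: B.nf_def binomial_eq_0 mult.assoc)
  qed (use commute_pow[OF cy1] commute_pow[OF cd1] dx1 dym in simp_all)
  have p21: "y ^ (p ^ 2) = d" by (simp add: power2_eq_square power_mult yp1 cp1)
  have "x2 ^ (p ^ 2) = x1 ^ (p ^ 2) * (y ^ m) ^ (p ^ 2)"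
    using C.xy_pow[of "p ^ 2"] pow_dvd_one[OF pow_swap_one[OF c21] p2(2)] pow_dvd_one[OF pow_swap_one[OF dp] p2(1)]
    by (simp add: C.nf_def x2_def)
  also have "(y ^ m) ^ (p ^ 2) = d ^ m" by (simp only: power_mult[symmetric] mult.commute[of m]) (simp only: power_mult p21)
  also have "x1 ^ (p ^ 2) * d ^ m = 1"
    using pow_dvd_one[OF dp m] by (simp add: xp1 add.commute flip: power_add)
  finally have xp2: "x2 ^ (p ^ 2) = 1" .
  interpret E: collection x2 y c1 d 1 1
    by standard (use dx2 in \<open>simp_all add: yx2 cx2 cy1 dy cd1\<close>)
  have yxp: "y * x2 ^ p = x2 ^ p * (y * d)"
    using E.y_x_pow[of 1 p] pow_dvd_one[OF dp p2(3)] by (simp add: E.nf_def binomial_eq_0 cp1)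
  have cxp: "c1 * x2 ^ p = x2 ^ p * c1"
    using E.c_x_pow[of 1 p] dp by (simp add: E.nf_def binomial_eq_0)
  have dxp: "d * x2 ^ p = x2 ^ p * d" using commute_pow[OF dx2, of 1 p] by simp
  have pc: "\<exists>v\<in>bwords (exponent p) [x2 ^ p, y, c1, d]. y * x2 = x2 * v"
    using yx2 by (intro bexI[of _ "y * c1"] bw_skip[OF bw_take[OF bw_elem]]) (auto simp: mult.assoc)
  have pd: "\<exists>v\<in>bwords (exponent p) [x2 ^ p, y, c1, d]. c1 * x2 = x2 * v"
    using cx2 by (intro bexI[of _ "c1 * d"] bw_skip[OF bw_skip[OF bw_take[OF bw_elem]]]) (auto simp: mult.assoc)
  have py: "\<exists>v\<in>bwords (exponent p) [y, c1, d]. y * x2 ^ p = x2 ^ p * v"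
    using yxp by (intro bexI[of _ "y * d"] bw_take[OF bw_elem]) (auto simp: mult.assoc)
  have pp: "(x2 ^ p) ^ p = 1" using xp2 by (simp add: power2_eq_square flip: power_mult)
  have *: "bounded_pc p (exponent p) [x2, x2 ^ p, y, c1, d]"
    by (intro bounded_pc_ConsI) (use pc pd py pp in
      \<open>auto simp: yp1 cp1 dp dx2 cxp dxp cy1 dy cd1 bw_elem bw_one power_commutes\<close>)
  show ?thesis by (rule bounded_presentationI[OF xy2 _ _ _ _ *]) (auto simp: S x2S c1S cS sg_pow gen_mem)
qed

context order_p2
begin

text \<open>The \<open>c\<close>-exponent \<open>i\<close> of \<open>y ^ p\<close> decides. For
  \<open>i = 0\<close> one has \<open>c ^ p = 1\<close>, and a change of \<open>x\<close> arranges
  that \<open>z\<close> or \<open>d\<close> is trivial; for \<open>i\<close> nonzero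
  \<open>z\<close> is trivial and the group is metacyclic.\<close>

lemma bounded_presentation: "bounded_presentation p S"
proof -
  obtain i w where iw: "i < p" "w \<in> N" "y ^ p = c ^ i * w" using der_elem[OF yp] .
  show ?thesis
  proof (cases "i = 0")
    case True
    hence ypN: "y ^ p \<in> N" and cp: "c ^ p = 1" using iw y_pow_eq[OF iw(2,3)] by auto
    show ?thesis
    proof (cases "z = 1")
      case True
      show ?thesis by (rule bounded_presentation_z_trivial[OF cp ypN True])
    next
      case False
      obtain k where k: "d = z ^ k" using N_elem[OF dzN(2) False dzN(1)] .
      obtain m where m: "p dvd m * 1 + k"
        using additive_cong_solvable[OF S(5), of 1 k] S(5) by (metis nat_dvd_1_iff_1 not_prime_1)
      \<comment> \<open>This replaces \<open>d\<close> by \<open>d * z ^ m = 1\<close>.\<close>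
      define x' where "x' = x * y ^ m"
      have xy': "gpair p S x' y"
        unfolding x'_def by (rule gpair_swap[OF gpair_mult_right[OF gpair_swap[OF xy]]])
      have "(y ^ m) ^ (p ^ 2) = (y ^ p) ^ (p * m)"
        by (simp add: power2_eq_square ac_simps flip: power_mult)
      hence "(y ^ m) ^ (p ^ 2) \<in> derived_sub S" using yp by (simp add: sg_pow nrm_sg[OF nD])
      hence xp': "x' ^ (p ^ 2) \<in> derived_sub S"
        unfolding x'_def using S xp by (intro der_mult_pow) (auto simp: sg_pow)
      interpret B: order_p2 p S N x' y
        by unfold_locales (use xy' index N DN cN xp' yp in auto)
      have zm: "z ^ a * u = u * z ^ a" if "u \<in> S" for u a
        using N_central[of "z ^ a" u] that dzN(2) nrm_sg[OF N(1)] by (simp add: sg_pow)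
      have ymS: "y ^ m \<in> S" using S by (simp add: sg_pow)
      have cym: "c * y ^ m = y ^ m * c * z ^ m" using c_y_pow[of 1 m] by simp
      have c': "comm y x' = c * z ^ m"
      proof (rule comm_unique[THEN iffD1, symmetric])
        have "y * x' = x * y * (c * y ^ m)" by (simp only: x'_def yx mult.assoc[symmetric])
        also have "\<dots> = x * (y * y ^ m) * (c * z ^ m)" by (simp only: cym mult.assoc)
        also have "y * y ^ m = y ^ m * y" by (simp add: power_commutes)
        finally show "y * x' = x' * y * (c * z ^ m)" by (simp only: x'_def mult.assoc)
      qed
      have "z ^ m * d = 1"
        using pow_dvd_one[OF N_pow[OF dzN(2)] m] by (simp only: k power_add mult_1_right)
      hence dzm: "d * z ^ m = 1" using zm[of d m] NS[OF dzN(1)] by simp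
      have "c * x' = x' * c"
      proof -
        have "c * x' = x * c * (d * y ^ m)" by (simp only: x'_def cx mult.assoc[symmetric])
        also have "d * y ^ m = y ^ m * d" using commute_pow[OF dy, of 1 m] by simp
        also have "x * c * (y ^ m * d) = x * (c * y ^ m) * d" by (simp only: mult.assoc)
        also have "\<dots> = x' * c * (z ^ m * d)" by (simp only: cym x'_def mult.assoc)
        finally show ?thesis using \<open>z ^ m * d = 1\<close> by simp
      qed
      hence "B.c * x' = x' * B.c"
        unfolding c' using zm[of x' m] B.S(3) by (metis mult.assoc)
      hence d': "B.d = 1" by (simp add: comm_eq_one_iff)
      show ?thesis
      proof (rule B.bounded_presentation_d_trivial[OF _ ypN d'])
        show "B.c ^ p = 1"
          unfolding c' commute_mult_pow[OF zm[OF cD(2), of m, symmetric]] cp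
          using pow_swap_one[OF N_pow[OF dzN(2)]] by simp
      qed
    qed
  next
    case False
    hence pi: "\<not> p dvd i" using iw(1) by (auto dest: dvd_imp_le)
    have z1: "z = 1" using y_pow_eq(2)[OF iw(2,3)] N_pow_iff[OF dzN(2), of i] pi by auto
    hence d1: "d \<noteq> 1" using dz_one by simp
    have cp: "c ^ p = d ^ i" by (rule y_pow_eq(1)[OF iw(2,3)])
    obtain j where j: "j < p" "w = d ^ j" using N_elem[OF dzN(1) d1 iw(2)] .
    \<comment> \<open>Rescaling \<open>x\<close> by \<open>i\<close> makes the new commutator agree
      with \<open>y ^ p\<close> up to powers of \<open>d\<close>, and gives
      \<open>c' ^ p = d'\<close>.\<close>
    define c' where "c' = c ^ i * d ^ (i choose 2)"
    define d' where "d' = d ^ (i * i)"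
    have gp: "gpair p S (x ^ i) (y ^ 1)" by (rule gpair_pow[OF xy pi]) (use S in auto)
    have dp: "d ^ p = 1" by (rule N_pow[OF dzN(1)])
    have dc: "d ^ a * c ^ b = c ^ b * d ^ a" for a b using commute_pow[OF cd, of b a] by simp
    have yx': "y * x ^ i = x ^ i * y * c'"
      using y_x_pow[of 1 i] unfolding nf_def by (simp add: z1 binomial_eq_0 mult.assoc c'_def)
    have cx': "c' * x ^ i = x ^ i * c' * d'"
    proof -
      have "c' * x ^ i = c ^ i * (d ^ (i choose 2) * x ^ i)" by (simp add: c'_def mult.assoc)
      also have "d ^ (i choose 2) * x ^ i = x ^ i * d ^ (i choose 2)"
        using commute_pow[of d x] dx by simp
      also have "c ^ i * (x ^ i * d ^ (i choose 2)) = x ^ i * (c ^ i * (d ^ (i * i) * d ^ (i choose 2)))"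
        using c_x_pow[of i i] by (simp add: nf_def binomial_eq_0 flip: mult.assoc)
      also have "d ^ (i * i) * d ^ (i choose 2) = d ^ (i choose 2) * d'"
        by (simp add: d'_def add.commute flip: power_add)
      finally show ?thesis by (simp add: c'_def mult.assoc)
    qed
    have cp': "c' ^ p = d'"
      unfolding c'_def d'_def commute_mult_pow[OF dc[symmetric]] using pow_swap_one[OF dp]
      by (simp only: power_mult[symmetric] mult.commute[of i p]) (simp add: power_mult cp)
    have d'1: "d' \<noteq> 1" unfolding d'_def using N_pow_iff[OF dzN(1) d1, of "i * i"] pi S(5)
      by (simp add: prime_dvd_mult_iff)
    have d'N: "d' \<in> N" using dzN(1) nrm_sg[OF N(1)] by (simp add: d'_def sg_pow)
    have c'S: "c' \<in> S" using cD S NS[OF dzN(1)] by (simp add: c'_def sg_closed)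
    \<comment> \<open>Compensates the power of \<open>d\<close> that \<open>c'\<close> carries
      beyond \<open>c ^ i\<close>.\<close>
    obtain l where l: "p dvd l * 1 + (i choose 2)"
      using additive_cong_solvable[OF S(5), of 1 "i choose 2"] S(5) by (metis nat_dvd_1_iff_1 not_prime_1)
    have "d ^ (l + j) \<in> N" using dzN(1) nrm_sg[OF N(1)] by (simp add: sg_pow)
    then obtain j' where j': "d ^ (l + j) = d' ^ j'" using N_elem[OF d'N d'1] by metis
    have "y ^ p = c ^ i * d ^ ((i choose 2) + l) * d ^ j"
      using pow_dvd_one[OF dp l] iw(3) j by (simp add: add.commute)
    also have "\<dots> = c' * d' ^ j'" by (simp add: c'_def power_add mult.assoc flip: j')
    finally have yp': "y ^ p = c' * d' ^ j'" .
    have "(x ^ i) ^ (p ^ 2) = (x ^ (p ^ 2)) ^ i" by (simp add: mult.commute flip: power_mult)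
    hence "(x ^ i) ^ (p ^ 2) \<in> N" using x_pow2_N nrm_sg[OF N(1)] by (simp add: sg_pow)
    then obtain s where s: "(x ^ i) ^ (p ^ 2) = d' ^ s" using N_elem[OF d'N d'1] by metis
    have "c * y = y * c" using cy z1 by simp
    hence cy': "c' * y = y * c'"
      using commute_pow[of c y i 1] commute_pow[OF dy, of "i choose 2" 1]
      by (simp add: c'_def) (metis mult.assoc)
    show ?thesis
      by (rule bounded_presentation_metacyclic[of p S "x ^ i" y c' d' j' s])
        (use gp c'S NS[OF d'N] yx' cx' cy' N_central[OF d'N, of "x ^ i"] N_central[OF d'N S(4)]
          pow_swap_one[OF dp] cp' yp' s S in \<open>auto simp: d'_def sg_pow\<close>)
  qed
qed

end

section \<open>The derived subgroup of order \<open>p\<^sup>3\<close>\<close>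

context collection
begin

text \<open>These four are the commutators \<open>c\<close>, \<open>d\<close>, \<open>e\<close>,
  \<open>z\<close> formed with \<open>x ^ a\<close> and \<open>y ^ f\<close> instead of
  \<open>x\<close> and \<open>y\<close>. The leading weights \<open>a*f\<close>,
  \<open>a^2*f\<close>, \<open>a^3*f\<close>, \<open>a*f^2\<close> govern how parameters
  rescale.\<close>

definition "sc_c a f = c ^ (a * f) * (d ^ (f * (a choose 2)) * (e ^ (f * (a choose 3)) * z ^ (a * (f choose 2))))"
definition "sc_d a f = d ^ (a * f * a) * e ^ (f * (a choose 2) * a + a * f * (a choose 2))"
definition "sc_e a f = e ^ (a * f * a * a)"
definition "sc_z a f = z ^ (a * f * f)"

lemma cdez_commute:
  "c ^ i * d ^ j = d ^ j * c ^ i" "c ^ i * e ^ j = e ^ j * c ^ i" "c ^ i * z ^ j = z ^ j * c ^ i"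
  "d ^ i * e ^ j = e ^ j * d ^ i" "d ^ i * z ^ j = z ^ j * d ^ i" "e ^ i * z ^ j = z ^ j * e ^ i"
  "c ^ i * c ^ j = c ^ j * c ^ i" "d ^ i * d ^ j = d ^ j * d ^ i" "e ^ i * e ^ j = e ^ j * e ^ i"
  "z ^ i * z ^ j = z ^ j * z ^ i"
  by (rule commute_pow cd ce cz de dz ez refl)+

lemma commute_mult:
  fixes a b t :: 'a
  assumes "a * b = b * a" "a * t = t * a"
  shows "a * (b * t) = (b * t) * a"
proof -
  have "a * (b * t) = b * (a * t)" by (simp only: assms(1) mult.assoc[symmetric])
  thus ?thesis by (simp only: assms(2) mult.assoc)
qed

lemma commute_mult': "b * a = a * b \<Longrightarrow> t * a = a * t \<Longrightarrow> (b * t) * a = a * (b * t)" for a b t :: 'a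
  using commute_mult[of a b t] by simp

lemmas cdez_intros = commute_mult commute_mult' cdez_commute cdez_commute[symmetric]

lemma scale: "collection (x ^ a) (y ^ f) (sc_c a f) (sc_d a f) (sc_e a f) (sc_z a f)"
proof
  have rearrange: "d ^ j * (e ^ k * (e ^ l * z ^ m)) = e ^ k * (z ^ m * (d ^ j * e ^ l))" for j k l m
  proof -
    have "d ^ j * (e ^ k * (e ^ l * z ^ m)) = d ^ j * (e ^ k * (z ^ m * e ^ l))" by (simp only: cdez_commute(6))
    also have "\<dots> = (d ^ j * (e ^ k * z ^ m)) * e ^ l" by (simp only: mult.assoc)
    also have "d ^ j * (e ^ k * z ^ m) = (e ^ k * z ^ m) * d ^ j" by (intro cdez_intros)
    finally show ?thesis by (simp only: mult.assoc)
  qed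
  show "y ^ f * x ^ a = x ^ a * y ^ f * sc_c a f"
    unfolding y_x_pow by (simp add: nf_def sc_c_def mult.assoc)
  have "sc_c a f * x ^ a = nf 0 0 (a * f) (f * (a choose 2)) (f * (a choose 3)) (a * (f choose 2)) * x ^ a"
    by (simp add: sc_c_def nf_def)
  also have "\<dots> = x ^ a * (c ^ (a * f) * (d ^ (f * (a choose 2)) * (d ^ (a * f * a) *
      (e ^ (f * (a choose 3)) * (e ^ (f * (a choose 2) * a + a * f * (a choose 2)) * z ^ (a * (f choose 2)))))))"
    unfolding nf_x_pow by (simp add: nf_def binomial_eq_0 power_add mult.assoc)
  also have "\<dots> = x ^ a * sc_c a f * sc_d a f"
    unfolding sc_c_def sc_d_def by (simp only: rearrange mult.assoc)
  finally show "sc_c a f * x ^ a = x ^ a * sc_c a f * sc_d a f" .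
  have "sc_d a f * x ^ a = nf 0 0 0 (a * f * a) (f * (a choose 2) * a + a * f * (a choose 2)) 0 * x ^ a"
    by (simp add: sc_d_def nf_def)
  also have "\<dots> = x ^ a * sc_d a f * sc_e a f"
    unfolding nf_x_pow by (simp add: nf_def binomial_eq_0 power_add mult.assoc sc_d_def sc_e_def)
  finally show "sc_d a f * x ^ a = x ^ a * sc_d a f * sc_e a f" .
  have dey: "d ^ i * y ^ f = y ^ f * d ^ i" "e ^ i * y ^ f = y ^ f * e ^ i" "z ^ i * y ^ f = y ^ f * z ^ i"
    "e ^ i * x ^ a = x ^ a * e ^ i" "z ^ i * x ^ a = x ^ a * z ^ i" for i
    by (rule commute_pow dy ey zy ex zx)+
  have "sc_c a f * y ^ f = c ^ (a * f) * y ^ f * (d ^ (f * (a choose 2)) * (e ^ (f * (a choose 3)) * z ^ (a * (f choose 2))))"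
    unfolding sc_c_def by (simp only: mult.assoc dey assoc_mult_swap[OF dey(1)] assoc_mult_swap[OF dey(2)])
  also have "\<dots> = y ^ f * c ^ (a * f) * (z ^ (a * f * f) *
      (d ^ (f * (a choose 2)) * (e ^ (f * (a choose 3)) * z ^ (a * (f choose 2)))))"
    unfolding c_y_pow by (simp only: mult.assoc)
  also have "z ^ (a * f * f) * (d ^ (f * (a choose 2)) * (e ^ (f * (a choose 3)) * z ^ (a * (f choose 2)))) =
      d ^ (f * (a choose 2)) * (e ^ (f * (a choose 3)) * z ^ (a * (f choose 2))) * z ^ (a * f * f)"
    by (intro cdez_intros)
  also have "y ^ f * c ^ (a * f) * \<dots> = y ^ f * sc_c a f * sc_z a f"
    unfolding sc_c_def sc_z_def by (simp only: mult.assoc)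
  finally show "sc_c a f * y ^ f = y ^ f * sc_c a f * sc_z a f" .
  show "sc_d a f * y ^ f = y ^ f * sc_d a f"
    unfolding sc_d_def by (intro commute_mult' dey)
  show "sc_e a f * x ^ a = x ^ a * sc_e a f" "sc_e a f * y ^ f = y ^ f * sc_e a f"
    "sc_z a f * x ^ a = x ^ a * sc_z a f" "sc_z a f * y ^ f = y ^ f * sc_z a f"
    unfolding sc_e_def sc_z_def by (rule dey)+
  show "sc_c a f * sc_d a f = sc_d a f * sc_c a f" "sc_c a f * sc_e a f = sc_e a f * sc_c a f"
    "sc_d a f * sc_e a f = sc_e a f * sc_d a f" "sc_c a f * sc_z a f = sc_z a f * sc_c a f"
    "sc_d a f * sc_z a f = sc_z a f * sc_d a f" "sc_e a f * sc_z a f = sc_z a f * sc_e a f"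
    unfolding sc_c_def sc_d_def sc_e_def sc_z_def by (intro cdez_intros)+
qed

lemma sc_pow:
  assumes "c ^ p = 1" "d ^ p = 1" "e ^ p = 1" "z ^ p = 1"
  shows "sc_c a f ^ p = 1" "sc_d a f ^ p = 1" "sc_e a f ^ p = 1" "sc_z a f ^ p = 1"
proof -
  have m: "(s * t) ^ p = 1" if "s * t = t * s" "s ^ p = 1" "t ^ p = 1" for s t :: 'a
    using that by (simp add: commute_mult_pow)
  show "sc_c a f ^ p = 1" "sc_d a f ^ p = 1" "sc_e a f ^ p = 1" "sc_z a f ^ p = 1"
    unfolding sc_c_def sc_d_def sc_e_def sc_z_def
    by (intro m pow_swap_one assms cdez_intros)+
qed

lemma sc_closed:
  assumes "subgrp S" "c \<in> S" "d \<in> S" "e \<in> S" "z \<in> S"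
  shows "sc_c a f \<in> S" "sc_d a f \<in> S" "sc_e a f \<in> S" "sc_z a f \<in> S"
  using assms by (auto simp: sc_c_def sc_d_def sc_e_def sc_z_def sg_closed)

text \<open>The scaled pair satisfies the collection relations again, with commutators still killed
  by \<open>p\<close>.\<close>

lemma scaled_pow_prime:
  assumes "prime p" "p > 4" "c ^ p = 1" "d ^ p = 1" "e ^ p = 1" "z ^ p = 1"
  shows "(x ^ a * y ^ f) ^ p = (x ^ p) ^ a * (y ^ p) ^ f"
proof -
  interpret C: collection "x ^ a" "y ^ f" "sc_c a f" "sc_d a f" "sc_e a f" "sc_z a f" by (rule scale)
  show ?thesis using C.xy_pow_prime[OF assms(1,2) sc_pow[OF assms(3-6)]]
    by (simp add: mult.commute[of _ p] flip: power_mult)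
qed

end

text \<open>Target form for a derived subgroup of order \<open>p^3\<close>: \<open>w\<close>
  generates the bottom, and both \<open>e\<close> and \<open>z\<close> are coded powers of it. In
  class three \<open>w\<close> is \<open>z\<close> with \<open>e = 1\<close>, in class four
  \<open>w\<close> is \<open>e\<close>.\<close>

lemma bounded_presentation_order_p3_list:
  fixes S :: "'a::grp set"
  assumes xy: "gpair p S x y" and col: "collection x y c d e z"
    and cl: "c \<in> S" "d \<in> S" "w \<in> S" "w * x = x * w" "w * y = y * w" "c * w = w * c" "d * w = w * d"
    and pw: "c ^ p = 1" "d ^ p = 1" "w ^ p = 1"
    and xp: "x ^ p \<in> bwords (exponent p) [y, c, d, w]" and yp: "y ^ p \<in> bwords (exponent p) [c, d, w]"
    and e: "e = w ^ exponent p i1" "i1 < 5" and z: "z = w ^ exponent p i2" "i2 < 5"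
  shows "bounded_presentation p S"
proof -
  have S: "x \<in> S" "y \<in> S" using gpair_mem[OF xy] by auto
  interpret collection x y c d e z by (rule col)
  have pc: "\<exists>v\<in>bwords (exponent p) [y, c, d, w]. y * x = x * v"
    by (intro bexI[of _ "y * c"] bw_take[OF bw_elem]) (auto simp: yx mult.assoc)
  have pd: "\<exists>v\<in>bwords (exponent p) [y, c, d, w]. c * x = x * v"
    by (intro bexI[of _ "c * d"] bw_skip[OF bw_take[OF bw_elem]]) (auto simp: cx mult.assoc)
  have pe: "\<exists>v\<in>bwords (exponent p) [y, c, d, w]. d * x = x * v"
    using e(2) by (intro bexI[of _ "d * w ^ exponent p i1"] bw_skip[OF bw_skip[OF bw_take[OF bw_pow]]])
      (auto simp: dx e(1) mult.assoc)
  have pz: "\<exists>v\<in>bwords (exponent p) [c, d, w]. c * y = y * v"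
    using z(2) by (intro bexI[of _ "c * w ^ exponent p i2"] bw_take[OF bw_skip[OF bw_pow]])
      (auto simp: cy z(1) mult.assoc)
  have *: "bounded_pc p (exponent p) [x, y, c, d, w]"
    by (intro bounded_pc_ConsI) (use pc pd pe pz xp yp cl pw dy cd in \<open>auto simp: bw_elem bw_one\<close>)
  show ?thesis by (rule bounded_presentationI[OF xy _ _ _ _ *]) (auto simp: S cl gen_mem)
qed

text \<open>If \<open>b = 0\<close>, then \<open>y\<close> lies in the derived subgroup, so
  \<open>[y, x]\<close> falls into the next term of the central series and cannot generate the
  derived subgroup.\<close>

lemma abelian_type_pos:
  fixes S :: "'a::grp set"
  assumes xy: "gpair p S x y" and D: "card (derived_sub S) \<noteq> 1"
    and iff: "\<And>i j. x ^ i * y ^ j \<in> derived_sub S \<longleftrightarrow> p ^ a dvd i \<and> p ^ b dvd j"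
  shows "0 < b"
proof (rule ccontr)
  assume "\<not> 0 < b"
  hence yD: "y \<in> derived_sub S" using iff[of 0 1] by simp
  have S: "subgrp S" "x \<in> S" "5 < p" using gpair_sg[OF xy] gpair_mem[OF xy] by auto
  have "derived_sub S \<noteq> {1}" using D by auto
  then obtain M where M: "normal_sub M S" "card (derived_sub S) = p * card M"
      "\<And>u s. u \<in> derived_sub S \<Longrightarrow> s \<in> S \<Longrightarrow> \<exists>w\<in>M. u * s = s * u * w"
    using central_series_step[OF gpair_sg(1,2,5,3)[OF xy] nrm_der[OF S(1)]] by metis
  obtain w where "w \<in> M" "y * x = x * y * w" using M(3)[OF yD S(2)] by blast
  hence "comm y x \<in> M" using comm_unique[of y x w] by simp
  moreover have "card M > 0"
    using nrm_subset[OF M(1)] gpair_sg(2)[OF xy] sg_one[OF nrm_sg[OF M(1)]]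
    by (auto simp: card_gt_0_iff intro: finite_subset)
  hence "card M < card (derived_sub S)" using M(2) S(3) by simp
  ultimately show False using comm_gens_notin[OF xy M(1)] by simp
qed

lemma pow_p_in_der:
  fixes S :: "'a::grp set"
  assumes xy: "gpair p S x y" and xp: "x ^ p \<in> derived_sub S" and yp: "y ^ p \<in> derived_sub S" and u: "u \<in> S"
  shows "u ^ p \<in> derived_sub S"
proof -
  have S: "subgrp S" "finite S" "x \<in> S" "y \<in> S" using gpair_sg[OF xy] gpair_mem[OF xy] by auto
  have "subgrp {u \<in> S. u ^ p \<in> derived_sub S}"
    by (rule finite_sgI[OF S(2) _ S(1)])
      (use S der_mult_pow[OF S(1)] nrm_sg[OF nrm_der[OF S(1)]] in \<open>auto simp: sg_closed\<close>)
  hence "gen {x, y} \<subseteq> {u \<in> S. u ^ p \<in> derived_sub S}" by (rule gen_least) (use S xp yp in auto)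
  thus ?thesis using u xy by (auto simp: gpair_def)
qed

section \<open>Class three: separated generating pairs or bounded presentations\<close>

text \<open>The Beauville condition in a form stable under transfer: conjugates of powers taken from
  the two triples agree only if they are trivial.\<close>

definition separated :: "'a::grp set \<Rightarrow> bool" where
  "separated S \<longleftrightarrow> (\<exists>x1 y1 x2 y2. {x1, y1, x2, y2} \<subseteq> S \<and> gen {x1, y1} = S \<and> gen {x2, y2} = S \<and>
     (\<forall>u\<in>{x1, y1, x1 * y1}. \<forall>v\<in>{x2, y2, x2 * y2}. \<forall>i j. \<forall>g\<in>S. \<forall>h\<in>S.
        ginv g * u ^ i * g = ginv h * v ^ j * h \<longrightarrow> u ^ i = 1))"

text \<open>Adding \<open>p - 1\<close> times the right-hand exponents on both sides plays the role
  of dividing by the right-hand side.\<close>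

lemma independent_cong:
  fixes X Y :: "'a::grp"
  assumes XY: "X * Y = Y * X" and p: "p > 0"
    and ind: "\<And>i j. X ^ i * Y ^ j = 1 \<Longrightarrow> p dvd i \<and> p dvd j"
    and one: "X ^ p = 1" "Y ^ p = 1"
    and eq: "X ^ a * Y ^ b = X ^ a' * Y ^ b'"
  shows "[a = a'] (mod p) \<and> [b = b'] (mod p)"
proof -
  have c: "Y ^ i * X ^ j = X ^ j * Y ^ i" for i j using commute_pow[OF XY, of j i] by simp
  have m: "X ^ i * Y ^ j * (X ^ k * Y ^ l) = X ^ (i + k) * Y ^ (j + l)" for i j k l
    by (simp only: power_add mult.assoc assoc_mult_swap[OF c])
  have "X ^ (a + (p - 1) * a') * Y ^ (b + (p - 1) * b') = X ^ (a' + (p - 1) * a') * Y ^ (b' + (p - 1) * b')"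
    unfolding m[symmetric] eq ..
  also have "k + (p - 1) * k = p * k" for k using p by (cases p) auto
  hence "X ^ (a' + (p - 1) * a') * Y ^ (b' + (p - 1) * b') = 1" using one by (simp add: power_mult)
  finally have "p dvd a + (p - 1) * a'" "p dvd b + (p - 1) * b'" using ind by blast+
  moreover have "[k = l] (mod p)" if "p dvd k + (p - 1) * l" for k l
  proof -
    have "k + (p - 1) * l + l = k + p * l" using p by (cases p) auto
    moreover have "[k + (p - 1) * l + l = 0 + l] (mod p)" using that by (intro cong_add) (simp_all add: cong_0_iff)
    ultimately have "[k + p * l = 0 + l] (mod p)" by (simp only:)
    thus ?thesis by (simp add: cong_def)
  qed
  ultimately show ?thesis by blast
qed

text \<open>Cramer's rule: eliminating \<open>j\<close> leaves \<open>i\<close> times the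
  determinant.\<close>

lemma cong_det:
  assumes p: "prime p" and c: "[a * i = a' * j] (mod p)" "[b * i = b' * j] (mod p)"
    and det: "\<not> int p dvd int a * int b' - int a' * int b"
  shows "p dvd i"
proof -
  have c': "[int a * int i = int a' * int j] (mod int p)" "[int b * int i = int b' * int j] (mod int p)"
    using c by (metis cong_int_iff of_nat_mult)+
  have "[int a * int i * int b' - int b * int i * int a' = int a' * int j * int b' - int b' * int j * int a'] (mod int p)"
    by (intro cong_diff cong_mult c' cong_refl)
  hence "int p dvd int i * (int a * int b' - int a' * int b)"
    by (simp add: cong_0_iff algebra_simps)
  thus ?thesis using det p by (simp add: prime_dvd_mult_iff)
qed

text \<open>The class-three case: the \<open>p\<close>-th powers are central and depend linearly on the class of
  an element modulo the derived subgroup.\<close>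

locale class_three = derived_step +
  assumes cN: "card N = p ^ 2"
    and N_central: "\<And>w s. w \<in> N \<Longrightarrow> s \<in> S \<Longrightarrow> w * s = s * w"
    and powD: "\<And>u. u \<in> S \<Longrightarrow> u ^ p \<in> derived_sub S"
begin

lemma D: "card (derived_sub S) = p ^ 3"
  using index cN by (simp add: power2_eq_square power3_eq_cube)

sublocale collection x y c d 1 z
proof
  show "y * x = x * y * c" "c * x = x * c * d" "c * y = y * c * z" by (rule mult_comm)+
  show "d * x = x * d * 1" "d * y = y * d" "z * x = x * z" "z * y = y * z"
    "c * d = d * c" "c * z = z * c" "d * z = z * d"
    using N_central[OF dzN(1) S(3)] N_central[OF dzN(1) S(4)] N_central[OF dzN(2) S(3)] N_central[OF dzN(2) S(4)]
      N_central[OF dzN(1) cD(2)] N_central[OF dzN(2) cD(2)] N_central[OF dzN(1) NS[OF dzN(2)]]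
    by auto
qed simp_all

lemma c_der: "u \<in> derived_sub S \<Longrightarrow> c * u = u * c"
proof -
  assume "u \<in> derived_sub S"
  then obtain i w where u: "w \<in> N" "u = c ^ i * w" using der_elem by metis
  have "w * c = c * w" by (rule N_central[OF u(1) cD(2)])
  thus ?thesis unfolding u(2) using commute_pow[of c c 1 i] by (simp add: mult.assoc assoc_mult_swap)
qed

text \<open>Collection of \<open>c\<close> past \<open>x ^ p\<close> costs \<open>d ^ p\<close>, yet
  \<open>c\<close> commutes with \<open>x ^ p\<close>, an element of the derived subgroup.\<close>

lemma d_pow: "d ^ p = 1"
proof -
  have "c * x ^ p = x ^ p * (c * d ^ p)" using c_x_pow[of 1 p] by (simp add: nf_def binomial_eq_0)
  thus ?thesis using c_der[OF powD[OF S(3)]] by simp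
qed

lemma z_pow: "z ^ p = 1"
proof -
  have "c * y ^ p = y ^ p * c * z ^ p" using c_y_pow[of 1 p] by simp
  thus ?thesis using c_der[OF powD[OF S(4)]] by simp
qed

text \<open>If one central subgroup of order at most \<open>p\<close> contained both
  \<open>d\<close> and \<open>z\<close>, then \<open>c\<close> would be central modulo it and the
  derived subgroup would have order at most \<open>p^2\<close>.\<close>

lemma dz_gen:
  assumes u: "u \<in> N" "u ^ p = 1" and "d \<in> gen {u}" "z \<in> gen {u}"
  shows False
proof -
  have sub: "gen {u} \<subseteq> N" by (rule gen_least) (use u nrm_sg[OF N(1)] in auto)
  have "normal_sub (gen {u}) S"
    unfolding normal_sub_def
  proof (intro conjI ballI)
    fix n s assume n: "n \<in> gen {u}" and s: "s \<in> S"
    have "n * s = s * n" using N_central[of n s] n s sub by auto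
    thus "ginv s * n * s \<in> gen {u}" using n by (simp add: mult.assoc)
  qed (use sub NS in auto)
  hence "card (derived_sub S) \<le> p * card (gen {u})"
    using sub N(2) assms powD[OF S(4)] by (intro der_small_if_central[OF xy]) auto
  moreover have "card (gen {u}) \<le> p"
    using gen_single[OF u(2)] S card_image_le[of "{..<p}" "\<lambda>i. u ^ i"] by auto
  ultimately have "p ^ 3 \<le> p * p" unfolding D[symmetric] by (meson le_trans mult_le_mono2)
  thus False using S by (simp add: power3_eq_cube)
qed

lemma dz_independent:
  assumes "d ^ i * z ^ j = 1"
  shows "p dvd i \<and> p dvd j"
proof -
  have *: "v \<in> gen {u}" if v: "v ^ p = 1" "v ^ k * u ^ l = 1" "\<not> p dvd k" for u v :: 'a and k l
  proof -
    have "v ^ k = ginv (u ^ l)" using v(2) by (metis ginv_ginv ginv_unique)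
    hence vk: "v ^ k \<in> gen {u}" using gen_mem[of u "{u}"] by (simp add: sg_ginv sg_pow)
    obtain b where "(v ^ k) ^ b = v" using pow_inverse_exponent[OF S(5) v(3), of v 1] v(1) by auto
    thus ?thesis using sg_pow[OF sg_gen vk, of b] by simp
  qed
  have "z ^ j * d ^ i = 1" using assms cdez_commute(5)[of i j] by simp
  thus ?thesis
    using *[of d i z j] *[of z j d i] dz_gen[OF dzN(1) d_pow] dz_gen[OF dzN(2) z_pow] assms d_pow z_pow
      gen_mem[of d "{d}"] gen_mem[of z "{z}"] by blast
qed

text \<open>By independence the products \<open>d ^ i * z ^ j\<close> already number
  \<open>p^2\<close>, the order of \<open>N\<close>.\<close>

lemma N_elem:
  assumes "w \<in> N"
  obtains i j where "w = d ^ i * z ^ j"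
proof -
  let ?f = "\<lambda>(i, j). d ^ i * z ^ j"
  have "inj_on ?f ({..<p} \<times> {..<p})"
  proof (rule inj_onI, clarsimp)
    fix i j i' j' assume "i < p" "j < p" "i' < p" "j' < p" "d ^ i * z ^ j = d ^ i' * z ^ j'"
    thus "i = i' \<and> j = j'"
      using independent_cong[OF dz _ dz_independent d_pow z_pow, of i j i' j'] S(6)
      by (auto simp: cong_less_modulus_unique_nat)
  qed
  hence "card (?f ` ({..<p} \<times> {..<p})) = card N"
    using cN by (simp add: card_image power2_eq_square)
  moreover have "?f ` ({..<p} \<times> {..<p}) \<subseteq> N"
    using dzN nrm_sg[OF N(1)] by (auto simp: sg_closed)
  moreover have "finite N" using N(2) finD by (rule finite_subset)
  ultimately have "?f ` ({..<p} \<times> {..<p}) = N" by (metis card_subset_eq)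
  thus ?thesis using assms that by auto
qed

lemma N_pow: "w \<in> N \<Longrightarrow> w ^ p = 1"
  using N_elem[of w] commute_mult_pow[OF cdez_commute(5)] pow_swap_one[OF d_pow] pow_swap_one[OF z_pow]
  by (metis mult_1_right)

text \<open>Commuting with \<open>x\<close> kills the \<open>c\<close>-exponent, because moving
  \<open>c ^ i\<close> past \<open>x\<close> sheds \<open>d ^ i\<close>.\<close>

lemma self_commuting_der:
  assumes u: "u \<in> derived_sub S" "u * x = x * u"
  shows "u \<in> N"
proof -
  obtain i w where iw: "i < p" "w \<in> N" "u = c ^ i * w" using der_elem[OF u(1)] .
  have "u * x = x * (c ^ i * d ^ i) * w"
    unfolding iw(3) by (simp add: mult.assoc N_central[OF iw(2) S(3)] assoc_rule[OF cx_pow])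
  also have "\<dots> = x * u * d ^ i"
    unfolding iw(3) using N_central[OF iw(2), of "d ^ i"] NS[OF dzN(1)] S by (simp add: mult.assoc sg_pow)
  finally have "d ^ i = 1" using u(2) by simp
  hence "p dvd i" using dz_independent[of i 0] by simp
  hence "i = 0" using iw(1) by (auto dest: dvd_imp_le)
  thus ?thesis using iw by simp
qed

lemma x_pow: "x ^ p \<in> N"
  by (rule self_commuting_der[OF powD[OF S(3)]]) (simp add: power_commutes)

text \<open>Since \<open>x ^ p\<close> is now known to be central, its collection past
  \<open>y\<close> forces this; the same fact for \<open>y ^ p\<close> depends on it.\<close>

lemma c_pow: "c ^ p = 1"
proof -
  have "y * x ^ p = x ^ p * (y * (c ^ p * d ^ (p choose 2)))"
    using y_x_pow[of 1 p] by (simp add: nf_def binomial_eq_0)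
  moreover have "d ^ (p choose 2) = 1" using pow_dvd_one[OF d_pow prime_dvd_choose2[OF S(5,6)]] .
  ultimately show ?thesis using N_central[OF x_pow S(4)] by simp
qed

lemma y_pow: "y ^ p \<in> N"
proof (rule self_commuting_der[OF powD[OF S(4)]])
  have "y ^ p * x = x * (y ^ p * (c ^ p * z ^ (p choose 2)))"
    using y_x_pow[of p 1] by (simp add: nf_def binomial_eq_0)
  thus "y ^ p * x = x * y ^ p"
    using pow_dvd_one[OF z_pow prime_dvd_choose2[OF S(5,6)]] c_pow by simp
qed

lemma pow_linear: "(x ^ a * y ^ b) ^ p = (x ^ p) ^ a * (y ^ p) ^ b"
  by (rule scaled_pow_prime[OF S(5)]) (use S c_pow d_pow z_pow in auto)

text \<open>Write \<open>y ^ p = d ^ k * z ^ l\<close>. If \<open>l\<close> vanishes, rescaling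
  \<open>x\<close> by \<open>a\<close> changes \<open>d\<close> to \<open>d ^ (a^2)\<close> and
  \<open>k\<close> counts modulo squares. Otherwise a shear \<open>x ^ m * y\<close> moves
  \<open>z\<close> onto the line of \<open>y ^ p\<close>, and rescaling \<open>x\<close> makes them
  equal.\<close>

lemma bounded_presentation_if_x_pow_trivial:
  assumes xp: "x ^ p = 1"
  shows "bounded_presentation p S"
proof -
  obtain k l where kl: "y ^ p = d ^ k * z ^ l" using N_elem[OF y_pow] .
  have dS: "d \<in> S" "z \<in> S" using NS dzN by auto
  show ?thesis
  proof (cases "p dvd l")
    case True
    hence yp: "y ^ p = d ^ k" using kl pow_dvd_one[OF z_pow] by simp
    have "\<exists>a i. \<not> p dvd a \<and> i < 5 \<and> y ^ p = (d ^ (a * a)) ^ exponent p i"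
    proof (cases "p dvd k")
      case True
      thus ?thesis using yp pow_dvd_one[OF d_pow] S(6) by (intro exI[of _ 1] exI[of _ 0]) auto
    next
      case False
      then obtain i a where ia: "i < 2" "\<not> p dvd a" "[exponent p (Suc i) * a ^ 2 = k] (mod p)"
        using power_class_representative[OF S(5), of k 2] by auto
      have "y ^ p = d ^ (exponent p (Suc i) * a ^ 2)" using pow_cong_mod[OF d_pow ia(3)] yp by simp
      thus ?thesis using ia
        by (intro exI[of _ a] exI[of _ "Suc i"]) (simp add: power2_eq_square mult.commute flip: power_mult)
    qed
    then obtain a i where a: "\<not> p dvd a" "i < 5" "y ^ p = (d ^ (a * a)) ^ exponent p i" by blast
    have "gpair p S (x ^ a) (y ^ 1)" by (rule gpair_pow[OF xy a(1)]) (use S in auto)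
    moreover have "collection (x ^ a) (y ^ 1) (sc_c a 1) (sc_d a 1) (sc_e a 1) (sc_z a 1)" by (rule scale)
    moreover have "(x ^ a) ^ p = 1" using pow_swap_one[OF xp] .
    moreover have "sc_d a 1 = d ^ (a * a)" "sc_e a 1 = 1" by (simp_all add: sc_d_def sc_e_def)
    moreover have "sc_z a 1 \<in> N" unfolding sc_z_def using dzN(2) nrm_sg[OF N(1)] by (simp add: sg_pow)
    moreover note sc_closed[OF S(1) cD(2) dS(1) sg_one[OF S(1)] dS(2), of a 1]
      sc_pow[OF c_pow d_pow _ z_pow, of a 1]
    ultimately show ?thesis
      using N_central[of "sc_z a 1"] a S
      by (intro bounded_presentation_order_p3_list[of p S "x ^ a" y "sc_c a 1" "sc_d a 1" 1 "sc_z a 1" "sc_z a 1" 0 1])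
        (auto simp: sg_pow intro: bw_one bw_skip bw_pow)
  next
    case False
    \<comment> \<open>With this \<open>m\<close> the new \<open>z' = z * d ^ m\<close> satisfies
      \<open>z' ^ l = d ^ k * z ^ l = y ^ p\<close>; the shear leaves \<open>y ^ p\<close> alone as
      \<open>x ^ p = 1\<close>.\<close>
    obtain m where m: "[l * m = k] (mod p)" using linear_cong_solvable[OF S(5) False] by blast
    define y' where "y' = x ^ m * y"
    have xy': "gpair p S x y'" unfolding y'_def by (rule gpair_mult_left[OF xy])
    have y'S: "y' \<in> S" using gpair_mem[OF xy'] by simp
    define z' where "z' = z * d ^ m"
    have z'N: "z' \<in> N" unfolding z'_def using dzN nrm_sg[OF N(1)] by (simp add: sg_closed)
    have yx': "y' * x = x * y' * c"
    proof -
      have "y' * x = x ^ m * (x * y * c)" by (simp only: y'_def mult.assoc yx)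
      also have "\<dots> = x * y' * c" by (simp only: y'_def power_commutes mult.assoc[symmetric])
      finally show ?thesis .
    qed
    have cy': "c * y' = y' * c * z'"
    proof -
      have "c * x ^ m = x ^ m * c * d ^ m" using c_x_pow[of 1 m] by (simp add: nf_def binomial_eq_0 mult.assoc)
      hence "c * y' = x ^ m * c * (d ^ m * y)" by (simp only: y'_def mult.assoc[symmetric])
      also have "d ^ m * y = y * d ^ m" using commute_pow[OF dy, of m 1] by simp
      also have "x ^ m * c * (y * d ^ m) = x ^ m * (c * y) * d ^ m" by (simp only: mult.assoc)
      finally show ?thesis by (simp only: cy y'_def z'_def mult.assoc)
    qed
    interpret B: collection x y' c d 1 z'
      by standard (use yx' cx cy' dx N_central[OF dzN(1) y'S] N_central[OF z'N S(3)] N_central[OF z'N y'S]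
        cd N_central[OF z'N cD(2)] N_central[OF z'N dS(1)] in simp_all)
    have "y' ^ p = d ^ k * z ^ l" using pow_linear[of m 1] by (simp add: y'_def xp kl)
    also have "d ^ k = d ^ (m * l)" using pow_cong_mod[OF d_pow m] by (simp add: mult.commute)
    also have "d ^ (m * l) * z ^ l = z' ^ l"
      unfolding z'_def using commute_pow[OF dz, of m 1] commute_mult_pow[of z "d ^ m" l]
        cdez_commute(5)[of "m * l" l] by (simp add: power_mult)
    finally have y'p: "y' ^ p = z' ^ l" .
    have zp': "z' ^ p = 1" by (rule N_pow[OF z'N])
    have "gpair p S (x ^ l) (y' ^ 1)" by (rule gpair_pow[OF xy' False]) (use S in auto)
    moreover have "collection (x ^ l) (y' ^ 1) (B.sc_c l 1) (B.sc_d l 1) (B.sc_e l 1) (B.sc_z l 1)" by (rule B.scale)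
    moreover have "(x ^ l) ^ p = 1" using pow_swap_one[OF xp] .
    moreover have "B.sc_e l 1 = 1" by (simp add: B.sc_e_def)
    moreover have zz: "B.sc_z l 1 = y' ^ p" by (simp add: B.sc_z_def y'p)
    moreover have "B.sc_z l 1 \<in> N" unfolding B.sc_z_def using z'N nrm_sg[OF N(1)] by (simp add: sg_pow)
    moreover note B.sc_closed[OF S(1) cD(2) dS(1) sg_one[OF S(1)] NS[OF z'N], of l 1]
      B.sc_pow[OF c_pow d_pow _ zp', of l 1]
    ultimately show ?thesis
      using N_central[of "B.sc_z l 1"] S y'S
      by (intro bounded_presentation_order_p3_list[of p S "x ^ l" y' "B.sc_c l 1" "B.sc_d l 1" 1 "B.sc_z l 1" "B.sc_z l 1" 0 1])
        (auto simp: sg_pow zz intro: bw_one bw_elem)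
  qed
qed

text \<open>The triples lie on the lines \<open>(1,0)\<close>, \<open>(0,1)\<close>,
  \<open>(1,1)\<close> and \<open>(1,2)\<close>, \<open>(1,3)\<close>, \<open>(2,5)\<close> modulo
  the derived subgroup. Different lines force exponents divisible by \<open>p\<close>; the remaining
  powers are central and again on different lines, now in the span of \<open>x ^ p\<close> and
  \<open>y ^ p\<close>.\<close>

lemma separated_if_pow_independent:
  assumes iff: "\<And>i j. x ^ i * y ^ j \<in> derived_sub S \<Longrightarrow> p dvd i \<and> p dvd j"
    and ind: "\<And>i j. (x ^ p) ^ i * (y ^ p) ^ j = 1 \<Longrightarrow> p dvd i \<and> p dvd j"
  shows "separated S"
proof -
  obtain f :: "'a \<Rightarrow> 'a set sym" where f: "ghom S f" "\<And>s. s \<in> S \<Longrightarrow> f s = 1 \<longleftrightarrow> s \<in> derived_sub S"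
    using quotient_hom[OF S(1) nD] by blast
  have fc: "f u * f v = f v * f u" if "u \<in> S" "v \<in> S" for u v
    using ghom_comm_iff[OF f(1) S(1) that] f(2)[of "comm u v"] comm_in_der[OF that] comm_closed[OF S(1) that]
    by auto
  have fxy: "f (x ^ a * y ^ b) = f x ^ a * f y ^ b" for a b
    using S by (simp add: ghom_mult[OF f(1)] ghom_pow[OF f(1)] sg_pow)
  \<comment> \<open>The same coordinates \<open>(a, b)\<close> describe \<open>u\<close> modulo the
    derived subgroup and its \<open>p\<close>-th power, so one determinant serves both stages
    below.\<close>
  define rep where "rep u a b \<longleftrightarrow> u \<in> S \<and> f u = f x ^ a * f y ^ b \<and> u ^ p = (x ^ p) ^ a * (y ^ p) ^ b"
    for u a b
  have rep_main: "u ^ i = 1"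
    if u: "rep u a b" and v: "rep v a' b'" and det: "\<not> int p dvd int a * int b' - int a' * int b"
      and gh: "g \<in> S" "h \<in> S" and eq: "ginv g * u ^ i * g = ginv h * v ^ j * h" for u v a b a' b' g h i j
  proof -
    have uS: "u \<in> S" "v \<in> S" using u v by (auto simp: rep_def)
    have det': "\<not> int p dvd int a' * int b - int a * int b'"
      using det by (metis dvd_minus_iff minus_diff_eq)
    have conj: "f (ginv g * t * g) = f t" if "t \<in> S" "g \<in> S" for t g
      using that S fc[OF that] by (simp add: ghom_mult[OF f(1)] ghom_ginv[OF f(1)] sg_closed mult.assoc)
    have pw: "f x ^ (a * i) * f y ^ (b * i) = f (u ^ i)" if "rep u a b" for u a b i
      using that S commute_mult_pow[OF commute_pow[OF fc[OF S(3,4)], of a b], of i]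
      by (simp add: rep_def ghom_pow[OF f(1)] power_mult)
    have "f (u ^ i) = f (v ^ j)" using arg_cong[OF eq, of f] gh uS S by (simp add: conj sg_pow)
    hence "f x ^ (a * i) * f y ^ (b * i) = f x ^ (a' * j) * f y ^ (b' * j)"
      using pw[OF u] pw[OF v] by simp
    moreover have "f x ^ p = 1" "f y ^ p = 1"
      using f(2) powD S by (simp_all add: sg_pow flip: ghom_pow[OF f(1) S(1)])
    moreover have "p dvd i \<and> p dvd j" if "f x ^ i * f y ^ j = 1" for i j
      using that iff[of i j] f(2)[of "x ^ i * y ^ j"] S by (simp add: fxy sg_closed)
    ultimately have cg: "[a * i = a' * j] (mod p) \<and> [b * i = b' * j] (mod p)"
      using S(6) by (intro independent_cong[OF fc[OF S(3,4)]]) auto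
    \<comment> \<open>First stage, in the abelianization, where conjugation is invisible.\<close>
    have "p dvd i" using cong_det[OF S(5) _ _ det] cg by blast
    then obtain i' where i': "i = p * i'" by auto
    have "p dvd j" using cong_det[OF S(5) _ _ det', of j i] cg by (auto simp: cong_sym_eq)
    then obtain j' where j': "j = p * j'" by auto
    have inN: "t ^ (p * k) \<in> N" if "rep t a b" for t a b k
      using that x_pow y_pow nrm_sg[OF N(1)] by (simp add: rep_def power_mult sg_closed)
    have cj: "ginv g * t * g = t" if "t \<in> N" "g \<in> S" for t g
      using N_central[OF that] by (simp add: mult.assoc)
    \<comment> \<open>Second stage: the powers are central by now, so the conjugating elements drop
      out.\<close>
    have "u ^ i = v ^ j" using eq cj[OF inN[OF u] gh(1)] cj[OF inN[OF v] gh(2)] by (simp add: i' j')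
    moreover have xyp: "x ^ p * y ^ p = y ^ p * x ^ p" using N_central[OF x_pow] S by (simp add: sg_pow)
    have pw': "(x ^ p) ^ (a * k) * (y ^ p) ^ (b * k) = u ^ (p * k)" if "rep u a b" for u a b k
      using that commute_mult_pow[OF commute_pow[OF xyp, of a b], of k]
      by (simp add: rep_def power_mult)
    ultimately have "(x ^ p) ^ (a * i') * (y ^ p) ^ (b * i') = (x ^ p) ^ (a' * j') * (y ^ p) ^ (b' * j')"
      unfolding pw'[OF u] pw'[OF v] i' j' by simp
    hence "[a * i' = a' * j'] (mod p) \<and> [b * i' = b' * j'] (mod p)"
      using S(6) ind N_pow[OF x_pow] N_pow[OF y_pow] by (intro independent_cong[OF xyp]) auto
    hence "p dvd i'" using cong_det[OF S(5) _ _ det] by blast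
    then obtain k where "i' = p * k" by auto
    hence "u ^ i = ((u ^ p) ^ p) ^ k" by (simp add: i' power_mult)
    moreover have "u ^ p \<in> N" using inN[OF u, of 1] by simp
    ultimately show ?thesis using N_pow by simp
  qed
  have rep: "rep (x ^ a * y ^ b) a b" for a b
    using S by (simp add: rep_def fxy pow_linear sg_closed)
  have y3: "x * y ^ 2 * y = x * y ^ 3" by (simp add: power2_eq_square power3_eq_cube mult.assoc)
  have gp2: "gpair p S (x * y ^ 2) y" by (rule gpair_swap[OF gpair_mult_right[OF gpair_swap[OF xy]]])
  have gp3: "gpair p S (x * y ^ 2) (x * y ^ 3)" using gpair_mult_left[OF gp2, of 1] y3 by simp
  have repxy: "rep (x * y ^ 2 * (x * y ^ 3)) 2 5"
  proof -
    have "f (x * y ^ 2 * (x * y ^ 3)) = f x ^ 2 * f y ^ 5"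
    proof -
      have "f (x * y ^ 2 * (x * y ^ 3)) = f x * (f y ^ 2 * f x) * f y ^ 3"
        using S by (simp add: ghom_mult[OF f(1)] ghom_pow[OF f(1)] sg_closed mult.assoc)
      also have "f y ^ 2 * f x = f x * f y ^ 2" using commute_pow[OF fc[OF S(4,3)], of 2 1] by simp
      also have "f x * (f x * f y ^ 2) * f y ^ 3 = f x ^ 2 * f y ^ 5"
        by (simp add: eval_nat_numeral mult.assoc)
      finally show ?thesis .
    qed
    moreover have "(x * y ^ 2 * (x * y ^ 3)) ^ p = (x ^ p) ^ 2 * (y ^ p) ^ 5"
    proof -
      \<comment> \<open>Linearity of the power map is stated for the chosen generators, hence the
        product of the second pair calls for the locale at that pair.\<close>
      interpret B: class_three p S N "x * y ^ 2" "x * y ^ 3"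
        by unfold_locales (use gp3 index N DN cN N_central powD in auto)
      have "(x * y ^ 2 * (x * y ^ 3)) ^ p = (x * y ^ 2) ^ p * (x * y ^ 3) ^ p"
        using B.pow_linear[of 1 1] by simp
      also have "\<dots> = x ^ p * ((y ^ p) ^ 2 * x ^ p) * (y ^ p) ^ 3"
        using pow_linear[of 1 2] pow_linear[of 1 3] by (simp add: mult.assoc)
      also have "(y ^ p) ^ 2 * x ^ p = x ^ p * (y ^ p) ^ 2"
        using N_central[OF x_pow, of "(y ^ p) ^ 2"] S by (simp add: sg_pow)
      also have "x ^ p * (x ^ p * (y ^ p) ^ 2) * (y ^ p) ^ 3 = (x ^ p) ^ 2 * (y ^ p) ^ 5"
        by (simp add: eval_nat_numeral mult.assoc)
      finally show ?thesis .
    qed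
    ultimately show ?thesis using S by (simp add: rep_def sg_closed)
  qed
  have r1: "rep u a b" if "(u, a, b) \<in> {(x, 1, 0), (y, 0, 1), (x * y, 1, 1)}" for u a b
    using that rep[of 1 0] rep[of 0 1] rep[of 1 1] by auto
  have r2: "rep u a b" if "(u, a, b) \<in> {(x * y ^ 2, 1, 2), (x * y ^ 3, 1, 3), (x * y ^ 2 * (x * y ^ 3), 2, 5)}" for u a b
    using that rep[of 1 2] rep[of 1 3] repxy by auto
  \<comment> \<open>The nine determinants between the two triples lie in this set; this is where
    \<open>p > 5\<close> enters.\<close>
  have small: "\<not> int p dvd k" if "k \<in> {1, 2, 3, 5, -1, -2, -3, -5}" for k
  proof
    assume "int p dvd k"
    hence "int p \<le> \<bar>k\<bar>" using that by (intro zdvd_imp_le) auto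
    thus False using that S(6) by auto
  qed
  show ?thesis
    unfolding separated_def
  proof (intro exI conjI ballI allI impI)
    show "gen {x, y} = S" "gen {x * y ^ 2, x * y ^ 3} = S" using xy gp3 by (auto simp: gpair_def)
    show "{x, y, x * y ^ 2, x * y ^ 3} \<subseteq> S" using gpair_mem[OF xy] gpair_mem[OF gp3] by auto
    fix u v i j g h
    assume u: "u \<in> {x, y, x * y}" and v: "v \<in> {x * y ^ 2, x * y ^ 3, x * y ^ 2 * (x * y ^ 3)}"
      and gh: "g \<in> S" "h \<in> S" and eq: "ginv g * u ^ i * g = ginv h * v ^ j * h"
    obtain a b :: nat where ab: "(u, a, b) \<in> {(x, 1, 0), (y, 0, 1), (x * y, 1, 1)}" using u by auto
    obtain a' b' :: nat where ab': "(v, a', b') \<in> {(x * y ^ 2, 1, 2), (x * y ^ 3, 1, 3), (x * y ^ 2 * (x * y ^ 3), 2, 5)}"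
      using v by auto
    have "int a * int b' - int a' * int b \<in> {1, 2, 3, 5, -1, -2, -3, -5}"
      using ab ab' by auto
    thus "u ^ i = 1" using rep_main[OF r1[OF ab] r2[OF ab'] small gh eq] by blast
  qed
qed

end

section \<open>Class four: scaling away all parameters\<close>

text \<open>The generators are adapted: modulo \<open>N3\<close> the commutator \<open>c\<close>
  commutes with \<open>y\<close> but not with \<open>x\<close>. This distinguishes the direction of
  \<open>y\<close>.\<close>

locale class_four = derived_step p S N2 x y
  for p :: nat and S N2 :: "'a::grp set" and x y :: 'a +
  fixes N3 :: "'a set"
  assumes cN: "card N2 = p ^ 2"
    and N3: "normal_sub N3 S" "N3 \<subseteq> N2" "card N3 = p"
    and NN: "\<And>u s. u \<in> N2 \<Longrightarrow> s \<in> S \<Longrightarrow> \<exists>w\<in>N3. u * s = s * u * w"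
    and powD: "\<And>u. u \<in> S \<Longrightarrow> u ^ p \<in> derived_sub S"
    and zN: "comm (comm y x) y \<in> N3" and dN: "comm (comm y x) x \<notin> N3"
    and noncentral: "\<exists>w\<in>N2. \<exists>s\<in>S. w * s \<noteq> s * w"
begin

abbreviation "e \<equiv> comm d x"

lemma N3_central: "w \<in> N3 \<Longrightarrow> s \<in> S \<Longrightarrow> w * s = s * w"
  by (rule central_of_order_p[OF xy N3(1,3)])

lemma sub: "w \<in> N2 \<Longrightarrow> w \<in> S" "w \<in> N3 \<Longrightarrow> w \<in> S" "w \<in> N3 \<Longrightarrow> w \<in> N2" "w \<in> N2 \<Longrightarrow> w \<in> derived_sub S"
  using NS N3(2) N(2) by auto

lemma comm_N3: "u \<in> N2 \<Longrightarrow> s \<in> S \<Longrightarrow> comm u s \<in> N3"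
  using NN[of u s] comm_unique[of u s] by auto

lemma eN3: "e \<in> N3"
  by (rule comm_N3[OF dzN(1) S(3)])

text \<open>Commutation with \<open>w \<in> N2\<close> is a homomorphism into the central subgroup \<open>N3\<close>, hence trivial
  on the derived subgroup.\<close>

lemma N2_der:
  assumes w: "w \<in> N2" and u: "u \<in> derived_sub S"
  shows "w * u = u * w"
proof -
  have "comm s t \<in> {v \<in> S. v * w = w * v}" if s: "s \<in> S" and t: "t \<in> S" for s t
  proof -
    define \<alpha> \<beta> where "\<alpha> = comm w s" and "\<beta> = comm w t"
    have ab: "\<alpha> \<in> N3" "\<beta> \<in> N3" using comm_N3[OF w] s t by (auto simp: \<alpha>_def \<beta>_def)
    have ws: "w * s = s * w * \<alpha>" and wt: "w * t = t * w * \<beta>" by (simp_all only: \<alpha>_def \<beta>_def flip: mult_comm)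
    have at: "\<alpha> * t = t * \<alpha>" and bs: "\<beta> * s = s * \<beta>" and ba: "\<beta> * \<alpha> = \<alpha> * \<beta>"
      using N3_central[OF ab(1) t] N3_central[OF ab(2) s] N3_central[OF ab(2) sub(2)[OF ab(1)]] by auto
    define k where "k = comm s t"
    have kS: "k \<in> S" using comm_closed[OF S(1) s t] by (simp add: k_def)
    have k: "s * t = t * s * k" unfolding k_def by (rule mult_comm)
    have gk: "(\<alpha> * \<beta>) * v = v * (\<alpha> * \<beta>)" if "v \<in> S" for v
      using N3_central[of "\<alpha> * \<beta>" v] that ab nrm_sg[OF N3(1)] by (simp add: sg_mult)
    have 1: "w * (s * t) = s * t * w * (\<alpha> * \<beta>)"
    proof -
      have "w * (s * t) = s * w * (\<alpha> * t)" by (simp only: ws mult.assoc[symmetric])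
      also have "\<dots> = s * (w * t) * \<alpha>" by (simp only: at mult.assoc)
      also have "\<dots> = s * t * w * (\<beta> * \<alpha>)" by (simp only: wt mult.assoc)
      finally show ?thesis by (simp only: ba)
    qed
    have 2: "w * (t * s) = t * s * w * (\<alpha> * \<beta>)"
    proof -
      have "w * (t * s) = t * w * (\<beta> * s)" by (simp only: wt mult.assoc[symmetric])
      also have "\<dots> = t * (w * s) * \<beta>" by (simp only: bs mult.assoc)
      also have "\<dots> = t * s * w * (\<alpha> * \<beta>)" by (simp only: ws mult.assoc)
      finally show ?thesis .
    qed
    have "t * s * (w * k) * (\<alpha> * \<beta>) = t * s * w * ((\<alpha> * \<beta>) * k)" unfolding gk[OF kS] by (simp only: mult.assoc)
    also have "\<dots> = w * (t * s) * k" by (simp only: 2 mult.assoc)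
    also have "\<dots> = w * (s * t)" by (simp only: k mult.assoc)
    also have "\<dots> = s * t * w * (\<alpha> * \<beta>)" by (rule 1)
    also have "\<dots> = t * s * (k * w) * (\<alpha> * \<beta>)" by (subst k) (simp only: mult.assoc)
    finally have "w * k = k * w" by simp
    thus ?thesis using kS by (simp add: k_def)
  qed
  hence "derived_sub S \<subseteq> {v \<in> S. v * w = w * v}" by (intro der_least sg_centralizer S)
  thus ?thesis using u by auto
qed

lemma N2_elem:
  assumes "u \<in> N2"
  obtains j w where "j < p" "w \<in> N3" "u = d ^ j * w"
  using prime_index_gen[OF S(5) nrm_sg[OF N(1)] finite_subset[OF N(2) finD]
      nrm_in_subgroup[OF N3(1,2) nrm_subset[OF N(1)]] _ dzN(1) dN assms]
    cN N3(3) by (auto simp: power2_eq_square)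

lemma c_der: "u \<in> derived_sub S \<Longrightarrow> c * u = u * c"
proof -
  assume "u \<in> derived_sub S"
  then obtain i w where u: "w \<in> N2" "u = c ^ i * w" using der_elem by metis
  have "w * c = c * w" by (rule N2_der[OF u(1) cD(1)])
  thus ?thesis unfolding u(2) using commute_pow[of c c 1 i] by (simp add: mult.assoc assoc_mult_swap)
qed

text \<open>A Hall-Witt argument: \<open>c * (y * x)\<close> is collected in two orders, and the
  results differ exactly by the commutator of \<open>d\<close> and \<open>y\<close>.\<close>

lemma d_y: "d * y = y * d"
proof -
  define \<zeta> where "\<zeta> = comm d y"
  have zt: "\<zeta> \<in> N3" unfolding \<zeta>_def by (rule comm_N3[OF dzN(1) S(4)])
  have dy: "d * y = y * d * \<zeta>" unfolding \<zeta>_def by (rule mult_comm)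
  have cx: "c * x = x * c * d" and yx: "y * x = x * y * c" and cy: "c * y = y * c * z" by (rule mult_comm)+
  have zx: "z * x = x * z" and zd: "z * d = d * z" and zc: "z * c = c * z"
    using N3_central[OF zN] S(3) sub(1)[OF dzN(1)] cD by auto
  have dc: "d * c = c * d" using c_der[OF sub(4)[OF dzN(1)]] by simp
  have "c * (y * x) = y * c * (z * x)" by (simp only: cy mult.assoc[symmetric])
  also have "\<dots> = y * (c * x) * z" by (simp only: zx mult.assoc)
  also have "\<dots> = (y * x) * c * (d * z)" by (simp only: cx mult.assoc)
  also have "\<dots> = x * y * c * (c * (d * z))" by (simp only: yx mult.assoc)
  finally have 1: "c * (y * x) = x * y * c * (c * (d * z))" .
  have "c * (y * x) = (c * x) * (y * c)" by (simp only: yx mult.assoc)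
  also have "\<dots> = x * c * (d * y) * c" by (simp only: cx mult.assoc)
  also have "\<dots> = x * (c * y) * d * (\<zeta> * c)" by (simp only: dy mult.assoc)
  also have "\<zeta> * c = c * \<zeta>" by (rule N3_central[OF zt cD(2)])
  also have "x * (c * y) * d * (c * \<zeta>) = x * y * c * (z * (d * c)) * \<zeta>" by (simp only: cy mult.assoc)
  also have "z * (d * c) = c * (d * z)" by (simp only: dc mult.assoc[symmetric] zc) (simp only: mult.assoc zd)
  finally have "c * (y * x) = x * y * c * (c * (d * z)) * \<zeta>" .
  hence "\<zeta> = 1" unfolding 1 by (simp only: grp_left_cancel_one)
  thus ?thesis using dy by simp
qed

sublocale collection x y c d e z
proof
  show "y * x = x * y * c" "c * x = x * c * d" "c * y = y * c * z" "d * x = x * d * e" by (rule mult_comm)+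
  show "d * y = y * d" by (rule d_y)
  show "e * x = x * e" "e * y = y * e" "z * x = x * z" "z * y = y * z"
    "c * d = d * c" "c * e = e * c" "d * e = e * d" "c * z = z * c" "d * z = z * d" "e * z = z * e"
    using N3_central[OF eN3 S(3)] N3_central[OF eN3 S(4)] N3_central[OF zN S(3)] N3_central[OF zN S(4)]
      c_der[OF sub(4)[OF dzN(1)]] N3_central[OF eN3 cD(2)] N3_central[OF zN cD(2)]
      N3_central[OF eN3 sub(1)[OF dzN(1)]] N3_central[OF zN sub(1)[OF dzN(1)]] N3_central[OF eN3 sub(2)[OF zN]]
    by auto
qed

text \<open>Otherwise \<open>d\<close> would be central, and with it \<open>N2\<close>, which is
  generated by \<open>d\<close> and \<open>N3\<close>.\<close>

lemma e_ne_one: "e \<noteq> 1"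
proof
  assume "e = 1"
  hence dx: "d * x = x * d" by (simp only: dx mult_1_right)
  have "gen {x, y} \<subseteq> {s \<in> S. s * d = d * s}"
    by (rule gen_least[OF sg_centralizer[OF S(1)]]) (use S dx dy in auto)
  hence ds: "d * s = s * d" if "s \<in> S" for s using that xy by (auto simp: gpair_def)
  have "w * s = s * w" if w: "w \<in> N2" and s: "s \<in> S" for w s
  proof -
    obtain j v where v: "v \<in> N3" "w = d ^ j * v" using N2_elem[OF w] by metis
    show ?thesis unfolding v(2)
      using commute_pow[OF ds[OF s], of j 1] N3_central[OF v(1) s]
      by (intro commute_mult') simp_all
  qed
  thus False using noncentral by blast
qed

lemma N3_pow: "w \<in> N3 \<Longrightarrow> w ^ p = 1"
  using pow_card_sg[OF nrm_sg[OF N3(1)]] finite_subset[OF N3(2) finite_subset[OF N(2) finD]] N3(3) by simp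

lemma e_pow: "e ^ p = 1" and z_pow: "z ^ p = 1"
  by (rule N3_pow eN3 zN)+

lemma e_pow_choose: "e ^ (p choose 2) = 1"
  using pow_dvd_one[OF e_pow prime_dvd_choose2[OF S(5,6)]] .

lemma d_pow: "d ^ p = 1"
proof -
  have "c * x ^ p = x ^ p * (c * d ^ p)"
    using c_x_pow[of 1 p] e_pow_choose unfolding nf_def by (simp add: binomial_eq_0)
  thus ?thesis using c_der[OF powD[OF S(3)]] by simp
qed

lemma N3_elem:
  assumes "w \<in> N3"
  obtains j where "w = e ^ j"
  using prime_card_cyclic[OF S(5) nrm_sg[OF N3(1)] N3(3) eN3 e_ne_one assms] by metis

lemma e_pow_iff: "e ^ j = 1 \<longleftrightarrow> p dvd j"
  by (rule ord_prime_iff[OF S(5) e_pow e_ne_one])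

text \<open>For \<open>u = c ^ i * d ^ j * v\<close>, moving past \<open>x\<close> costs
  \<open>d ^ i * e ^ j\<close>. As \<open>d\<close> is not in \<open>N3\<close>, first
  \<open>i\<close> and then \<open>j\<close> must vanish.\<close>

lemma self_commuting_der:
  assumes u: "u \<in> derived_sub S" "u * x = x * u"
  shows "u \<in> N3"
proof -
  obtain i w where iw: "i < p" "w \<in> N2" "u = c ^ i * w" using der_elem[OF u(1)] .
  obtain j v where jv: "j < p" "v \<in> N3" "w = d ^ j * v" using N2_elem[OF iw(2)] .
  have vS: "v \<in> S" using sub jv by auto
  have ux: "u = c ^ i * d ^ j * v" by (simp add: iw jv mult.assoc)
  have "c ^ i * d ^ j * x = x * (c ^ i * d ^ j) * (d ^ i * e ^ j)"
    using nf_x[of 0 0 i j 0 0] by (simp add: nf_def binomial_eq_0 power_add mult.assoc)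
  moreover have "u * x = c ^ i * d ^ j * x * v"
    unfolding ux by (simp add: mult.assoc N3_central[OF jv(2) S(3)])
  moreover have "v * (d ^ i * e ^ j) = d ^ i * e ^ j * v"
    by (rule N3_central[OF jv(2)]) (use S sub dzN(1) eN3 in \<open>simp add: sg_closed\<close>)
  ultimately have "x * u * (d ^ i * e ^ j) = x * u"
    using u(2) by (simp add: ux mult.assoc)
  hence de1: "d ^ i * e ^ j = 1" by (simp only: grp_left_cancel_one)
  hence "d ^ i = ginv (e ^ j)" by (metis ginv_ginv ginv_unique)
  hence din: "d ^ i \<in> N3" using eN3 nrm_sg[OF N3(1)] by (simp add: sg_closed)
  have "p dvd i"
  proof (rule ccontr)
    assume "\<not> p dvd i"
    then obtain b where "(d ^ i) ^ b = d" using pow_inverse_exponent[of p i d 1] S(5) d_pow by auto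
    thus False using sg_pow[OF nrm_sg[OF N3(1)] din, of b] dN by simp
  qed
  hence "i = 0" using iw(1) by (auto dest: dvd_imp_le)
  moreover from this have "j = 0" using de1 e_pow_iff jv(1) by (auto dest: dvd_imp_le)
  ultimately show ?thesis using ux jv by simp
qed

lemma x_pow: "x ^ p \<in> N3"
  by (rule self_commuting_der[OF powD[OF S(3)]]) (simp add: power_commutes)

lemma c_pow: "c ^ p = 1"
proof -
  have "p dvd (p choose 3)"
    using dvd_choose_coprime[OF prime_coprime_small[OF S(5), of 3 1]] S(6) by simp
  hence "y * x ^ p = x ^ p * (y * c ^ p)"
    using y_x_pow[of 1 p] pow_dvd_one[OF d_pow prime_dvd_choose2[OF S(5,6)]] pow_dvd_one[OF e_pow]
    unfolding nf_def by (simp add: binomial_eq_0)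
  thus ?thesis using N3_central[OF x_pow S(4)] by simp
qed

lemma y_pow: "y ^ p \<in> N3"
proof (rule self_commuting_der[OF powD[OF S(4)]])
  have "y ^ p * x = x * (y ^ p * (c ^ p * z ^ (p choose 2)))"
    using y_x_pow[of p 1] unfolding nf_def by (simp add: binomial_eq_0)
  thus "y ^ p * x = x * y ^ p"
    using pow_dvd_one[OF z_pow prime_dvd_choose2[OF S(5,6)]] c_pow by simp
qed

lemma pow_linear: "(x ^ a * y ^ b) ^ p = (x ^ p) ^ a * (y ^ p) ^ b"
  by (rule scaled_pow_prime[OF S(5)]) (use S c_pow d_pow e_pow z_pow in auto)

text \<open>Under scaling by \<open>(a, f)\<close> the constants \<open>s\<close>, \<open>t\<close>,
  \<alpha> acquire the weights \<open>a\<close>, \<open>f\<close> and \<open>a*f^2\<close>, all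
  measured against the weight \<open>a^3*f\<close> of \<open>e\<close>; the congruences ask for
  coded values afterwards.\<close>

lemma bounded_presentation_scaled:
  assumes st: "x ^ p = e ^ s" "y ^ p = e ^ t" "z = e ^ \<alpha>" and af: "\<not> p dvd a" "\<not> p dvd f"
    and i: "i1 < 5" "i2 < 5" "i3 < 5"
    and eq: "[exponent p i1 * (a * f * a * a) = s * a] (mod p)" "[exponent p i2 * (a * f * a * a) = t * f] (mod p)"
      "[exponent p i3 * (a * f * a * a) = \<alpha> * (a * f * f)] (mod p)"
  shows "bounded_presentation p S"
proof -
  have cl: "d \<in> S" "e \<in> S" "z \<in> S" using sub dzN(1) eN3 zN by auto
  have xe: "(x ^ a) ^ p = sc_e a f ^ exponent p i1"
  proof -
    have "(x ^ a) ^ p = (x ^ p) ^ a" by (simp only: power_mult[symmetric] mult.commute)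
    also have "\<dots> = e ^ (s * a)" by (simp only: st power_mult)
    also have "\<dots> = e ^ (exponent p i1 * (a * f * a * a))" by (rule pow_cong_mod[OF e_pow cong_sym[OF eq(1)]])
    finally show ?thesis by (simp only: sc_e_def power_mult[symmetric] mult.commute)
  qed
  have ye: "(y ^ f) ^ p = sc_e a f ^ exponent p i2"
  proof -
    have "(y ^ f) ^ p = (y ^ p) ^ f" by (simp only: power_mult[symmetric] mult.commute)
    also have "\<dots> = e ^ (t * f)" by (simp only: st power_mult)
    also have "\<dots> = e ^ (exponent p i2 * (a * f * a * a))" by (rule pow_cong_mod[OF e_pow cong_sym[OF eq(2)]])
    finally show ?thesis by (simp only: sc_e_def power_mult[symmetric] mult.commute)
  qed
  have ze: "sc_z a f = sc_e a f ^ exponent p i3"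
  proof -
    have "sc_z a f = e ^ (\<alpha> * (a * f * f))" unfolding sc_z_def by (subst st(3)) (simp only: power_mult)
    also have "\<dots> = e ^ (exponent p i3 * (a * f * a * a))" by (rule pow_cong_mod[OF e_pow cong_sym[OF eq(3)]])
    finally show ?thesis by (simp only: sc_e_def power_mult[symmetric] mult.commute)
  qed
  interpret C: collection "x ^ a" "y ^ f" "sc_c a f" "sc_d a f" "sc_e a f" "sc_z a f" by (rule scale)
  show ?thesis
  proof (rule bounded_presentation_order_p3_list[OF gpair_pow[OF xy af] scale])
    show "sc_c a f \<in> S" "sc_d a f \<in> S" "sc_e a f \<in> S" by (rule sc_closed[OF S(1) cD(2) cl])+
    show "sc_e a f * x ^ a = x ^ a * sc_e a f" "sc_e a f * y ^ f = y ^ f * sc_e a f"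
      "sc_c a f * sc_e a f = sc_e a f * sc_c a f" "sc_d a f * sc_e a f = sc_e a f * sc_d a f"
      by (rule C.ex C.ey C.ce C.de)+
    show "sc_c a f ^ p = 1" "sc_d a f ^ p = 1" "sc_e a f ^ p = 1"
      by (rule sc_pow[OF c_pow d_pow e_pow z_pow])+
    show "(x ^ a) ^ p \<in> bwords (exponent p) [y ^ f, sc_c a f, sc_d a f, sc_e a f]"
      unfolding xe by (intro bw_skip bw_pow i)
    show "(y ^ f) ^ p \<in> bwords (exponent p) [sc_c a f, sc_d a f, sc_e a f]"
      unfolding ye by (intro bw_skip bw_pow i)
    show "sc_e a f = sc_e a f ^ exponent p (Suc 0)" by simp
    show "sc_z a f = sc_e a f ^ exponent p i3" by (rule ze)
  qed (use i in simp_all)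
qed

text \<open>Two constants, \<open>s\<close> and \<alpha>, against two scaling factors: \<alpha> can
  be normalised to \<open>1\<close> through \<open>f\<close>, after which \<open>s\<close> counts
  modulo fourth powers. This case dictates the number of exponent codes.\<close>

lemma bounded_presentation_if_y_pow_trivial:
  assumes yp: "y ^ p = 1"
  shows "bounded_presentation p S"
proof -
  obtain s where s: "x ^ p = e ^ s" using N3_elem[OF x_pow] .
  obtain \<alpha> where \<alpha>: "z = e ^ \<alpha>" using N3_elem[OF zN] .
  have y0: "y ^ p = e ^ 0" using yp by simp
  have p1: "\<not> p dvd 1" using S(6) by simp
  show ?thesis
  proof (cases "p dvd \<alpha>")
    case True
    hence a0: "[\<alpha> * k = 0] (mod p)" for k by (simp add: cong_0_iff)
    show ?thesis
    proof (cases "p dvd s")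
      case True
      show ?thesis
        by (rule bounded_presentation_scaled[OF s y0 \<alpha> p1 p1, of 0 0 0]) (use True a0[of 1] in \<open>auto simp: cong_0_iff cong_sym_eq[of 0]\<close>)
    next
      case False
      show ?thesis
        by (rule bounded_presentation_scaled[OF s y0 \<alpha> p1 False, of 1 0 0]) (use a0[of "s * s"] in \<open>auto simp: cong_sym_eq\<close>)
    qed
  next
    case False
    show ?thesis
    proof (cases "p dvd s")
      case True
      obtain f where f: "[\<alpha> * f = 1] (mod p)" using linear_cong_solvable[OF S(5) False] .
      have pf: "\<not> p dvd f"
        using f p1 cong_dvd_iff[OF f] by (auto simp: dvd_mult)
      have "[1 * f = \<alpha> * f * f] (mod p)" by (rule cong_mult[OF cong_sym[OF f] cong_refl])
      thus ?thesis
        by (intro bounded_presentation_scaled[OF s y0 \<alpha> p1 pf, of 0 0 1])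
          (use True in \<open>auto simp: cong_0_iff cong_sym_eq[of 0] mult.assoc\<close>)
    next
      case ps: False
      have "\<not> p dvd \<alpha> * s" using False ps S(5) by (simp add: prime_dvd_mult_iff)
      then obtain i a where ia: "i < 4" "\<not> p dvd a" "[exponent p (Suc i) * a ^ 4 = \<alpha> * s] (mod p)"
        using power_class_representative[OF S(5), of _ 4] by auto
      \<comment> \<open>Makes the new \<open>z\<close> equal to the new \<open>e\<close>;
        substituted into the condition for \<open>s\<close>, it leaves \<open>a^4\<close> against
        \<alpha> times \<open>s\<close>.\<close>
      obtain f where f: "[\<alpha> * f = a * a] (mod p)" using linear_cong_solvable[OF S(5) False] .
      have pf: "\<not> p dvd f"
        using ia(2) cong_dvd_iff[OF f] S(5) by (auto simp: prime_dvd_mult_iff)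
      have "[exponent p (Suc i) * a * a * a * (\<alpha> * f) = exponent p (Suc i) * a * a * a * (a * a)] (mod p)"
        by (rule cong_mult[OF cong_refl f])
      also have "exponent p (Suc i) * a * a * a * (a * a) = exponent p (Suc i) * a ^ 4 * a" by (simp add: eval_nat_numeral)
      also have "[\<dots> = \<alpha> * s * a] (mod p)" by (rule cong_mult[OF ia(3) cong_refl])
      finally have "[\<alpha> * (exponent p (Suc i) * (a * f * a * a)) = \<alpha> * (s * a)] (mod p)" by (simp add: ac_simps)
      moreover have "coprime \<alpha> p" using prime_imp_coprime[OF S(5) False] by (simp add: coprime_commute)
      ultimately have 1: "[exponent p (Suc i) * (a * f * a * a) = s * a] (mod p)"
        by (simp add: cong_mult_lcancel_nat)
      have "[a * f * (a * a) = a * f * (\<alpha> * f)] (mod p)" by (rule cong_mult[OF cong_refl cong_sym[OF f]])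
      hence 2: "[exponent p (Suc 0) * (a * f * a * a) = \<alpha> * (a * f * f)] (mod p)" by (simp add: ac_simps)
      show ?thesis
        by (rule bounded_presentation_scaled[OF s y0 \<alpha> ia(2) pf _ _ _ 1 _ 2, of 0]) (use ia in auto)
    qed
  qed
qed

text \<open>In the condition for \<open>t\<close> the factor \<open>f\<close> cancels, so
  \<open>a\<close> normalises \<open>t\<close> modulo cubes and \<open>f\<close> remains free to
  normalise \<alpha>.\<close>

lemma bounded_presentation_if_x_pow_trivial:
  assumes xp: "x ^ p = 1"
  shows "bounded_presentation p S"
proof -
  obtain t where t: "y ^ p = e ^ t" using N3_elem[OF y_pow] .
  obtain \<alpha> where \<alpha>: "z = e ^ \<alpha>" using N3_elem[OF zN] .
  have x0: "x ^ p = e ^ 0" using xp by simp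
  have p1: "\<not> p dvd 1" using S(6) by simp
  show ?thesis
  proof (cases "p dvd t")
    case True
    thus ?thesis using t e_pow_iff by (intro bounded_presentation_if_y_pow_trivial) simp
  next
    case False
    then obtain i a where ia: "i < 3" "\<not> p dvd a" "[exponent p (Suc i) * a ^ 3 = t] (mod p)"
      using power_class_representative[OF S(5), of _ 3] by auto
    have 2: "[exponent p (Suc i) * (a * f * a * a) = t * f] (mod p)" for f
      using cong_mult[OF ia(3) cong_refl[of f]] by (simp add: ac_simps power3_eq_cube)
    show ?thesis
    proof (cases "p dvd \<alpha>")
      case True
      show ?thesis
        by (rule bounded_presentation_scaled[OF x0 t \<alpha> ia(2) p1 _ _ _ _ 2, of 0 0])
          (use ia True in \<open>auto simp: cong_sym_eq[of 0] cong_0_iff\<close>)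
    next
      case False
      obtain f where f: "[\<alpha> * f = a * a] (mod p)" using linear_cong_solvable[OF S(5) False] .
      have pf: "\<not> p dvd f"
        using ia(2) cong_dvd_iff[OF f] S(5) by (auto simp: prime_dvd_mult_iff)
      have "[a * f * (a * a) = a * f * (\<alpha> * f)] (mod p)" by (rule cong_mult[OF cong_refl cong_sym[OF f]])
      hence 3: "[exponent p (Suc 0) * (a * f * a * a) = \<alpha> * (a * f * f)] (mod p)" by (simp add: ac_simps)
      show ?thesis
        by (rule bounded_presentation_scaled[OF x0 t \<alpha> ia(2) pf _ _ _ _ 2 3, of 0]) (use ia in auto)
    qed
  qed
qed

text \<open>Both \<open>p\<close>-th powers lie in the group of order \<open>p\<close> generated by
  \<open>e\<close>. If \<open>y ^ p\<close> is nontrivial, replacing \<open>x\<close> by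
  \<open>x * y ^ m\<close> makes \<open>x ^ p\<close> trivial, and the adapted position of the
  generators survives because \<open>z\<close> is central.\<close>

lemma bounded_presentation: "bounded_presentation p S"
proof (cases "y ^ p = 1")
  case True
  thus ?thesis by (rule bounded_presentation_if_y_pow_trivial)
next
  case False
  obtain s where s: "x ^ p = e ^ s" using N3_elem[OF x_pow] .
  obtain t where t: "y ^ p = e ^ t" using N3_elem[OF y_pow] .
  have pt: "\<not> p dvd t" using False t e_pow_iff by simp
  obtain m where m: "p dvd m * t + s" using additive_cong_solvable[OF S(5) pt] .
  define x' where "x' = x * y ^ m"
  have xy': "gpair p S x' y"
    unfolding x'_def by (rule gpair_swap[OF gpair_mult_right[OF gpair_swap[OF xy]]])
  have x'S: "x' \<in> S" using gpair_mem[OF xy'] by simp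
  have zmN: "z ^ m \<in> N3" using zN nrm_sg[OF N3(1)] by (simp add: sg_pow)
  have zm: "z ^ m * u = u * z ^ m" if "u \<in> S" for u using N3_central[OF zmN that] .
  have cym: "c * y ^ m = y ^ m * c * z ^ m" using c_y_pow[of 1 m] by simp
  have dym: "d * y ^ m = y ^ m * d" using commute_pow[OF dy, of 1 m] by simp
  have c': "comm y x' = c * z ^ m"
  proof (rule comm_unique[THEN iffD1, symmetric])
    have "y * x' = x * y * (c * y ^ m)" by (simp only: x'_def yx mult.assoc[symmetric])
    also have "\<dots> = x * (y * y ^ m) * (c * z ^ m)" by (simp only: cym mult.assoc)
    also have "y * y ^ m = y ^ m * y" by (simp add: power_commutes)
    finally show "y * x' = x' * y * (c * z ^ m)" by (simp only: x'_def mult.assoc)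
  qed
  have "comm (c * z ^ m) y = z"
  proof (rule comm_unique[THEN iffD1, symmetric])
    have "c * z ^ m * y = c * y * z ^ m" by (simp only: zm[OF S(4)] mult.assoc)
    also have "\<dots> = y * (c * (z * z ^ m))" by (simp only: cy mult.assoc)
    also have "z * z ^ m = z ^ m * z" by (simp add: power_commutes)
    finally show "c * z ^ m * y = y * (c * z ^ m) * z" by (simp only: mult.assoc)
  qed
  hence zN': "comm (comm y x') y \<in> N3" using c' zN by simp
  have "comm (c * z ^ m) x' = d * z ^ m"
  proof (rule comm_unique[THEN iffD1, symmetric])
    have "c * z ^ m * x' = c * x' * z ^ m" by (simp only: zm[OF x'S] mult.assoc)
    also have "c * x' = x * c * (d * y ^ m)" by (simp only: x'_def cx mult.assoc[symmetric])
    also have "\<dots> = x * (c * y ^ m) * d" by (simp only: dym mult.assoc)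
    also have "\<dots> = x' * c * z ^ m * d" by (simp only: cym x'_def mult.assoc)
    finally show "c * z ^ m * x' = x' * (c * z ^ m) * (d * z ^ m)" by (simp only: mult.assoc)
  qed
  hence dN': "comm (comm y x') x' \<notin> N3"
    using c' dN zmN sg_mult_cancel_right[OF nrm_sg[OF N3(1)], of "z ^ m" d] by simp
  interpret B: class_four p S N2 x' y N3
    by unfold_locales (use xy' index N cN N3 DN NN powD zN' dN' noncentral in auto)
  have "x' ^ p = e ^ s * (e ^ t) ^ m" using pow_linear[of 1 m] by (simp only: x'_def s t power_one_right)
  also have "\<dots> = e ^ (m * t + s)" by (simp only: power_mult[symmetric] power_add[symmetric] ac_simps)
  also have "\<dots> = 1" using m e_pow_iff by simp
  finally show ?thesis by (rule B.bounded_presentation_if_x_pow_trivial)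
qed

end

text \<open>Modulo \<open>N3\<close> the element \<open>z\<close> is a power \<open>d ^ k\<close>;
  the shear \<open>x ^ m * y\<close> adds \<open>m\<close> to \<open>k\<close> and leaves
  \<open>c\<close> and \<open>d\<close> as they are.\<close>

lemma class_four_generators:
  fixes S :: "'a::grp set"
  assumes xy: "gpair p S x y" and D: "card (derived_sub S) = p ^ 3"
    and N2: "normal_sub N2 S" "N2 \<subseteq> derived_sub S" "card N2 = p ^ 2"
    and N3: "normal_sub N3 S" "N3 \<subseteq> N2" "card N3 = p"
    and DN: "\<And>u s. u \<in> derived_sub S \<Longrightarrow> s \<in> S \<Longrightarrow> \<exists>w\<in>N2. u * s = s * u * w"
    and NN: "\<And>u s. u \<in> N2 \<Longrightarrow> s \<in> S \<Longrightarrow> \<exists>w\<in>N3. u * s = s * u * w"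
    and dN: "comm (comm y x) x \<notin> N3"
  shows "\<exists>m. comm (comm (x ^ m * y) x) (x ^ m * y) \<in> N3 \<and> comm (comm (x ^ m * y) x) x \<notin> N3"
proof -
  have S: "subgrp S" "finite S" "x \<in> S" "y \<in> S" "prime p" "5 < p"
    using gpair_sg[OF xy] gpair_mem[OF xy] by auto
  have nD: "normal_sub (derived_sub S) S" by (rule nrm_der) (rule S)
  define c d z where "c = comm y x" and "d = comm c x" and "z = comm c y"
  have cD: "c \<in> derived_sub S" "c \<in> S" using comm_in_der[of y S x] S nrm_subset[OF nD] by (auto simp: c_def)
  have comm_N2: "comm u s \<in> N2" if "u \<in> derived_sub S" "s \<in> S" for u s using DN[OF that] comm_unique[of u s] by auto
  have dz: "d \<in> N2" "z \<in> N2" using comm_N2[OF cD(1)] S by (auto simp: d_def z_def)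
  have N2S: "N2 \<subseteq> S" by (rule nrm_subset[OF N2(1)])
  have finN2: "finite N2" using N2S S(2) by (rule finite_subset)
  have dN3: "d \<notin> N3" using dN by (simp add: d_def c_def)
  have "card N2 = p * card N3" using N2(3) N3(3) by (simp add: power2_eq_square)
  then obtain k w where kw: "w \<in> N3" "z = d ^ k * w"
    using prime_index_gen[OF S(5) nrm_sg[OF N2(1)] finN2 nrm_in_subgroup[OF N3(1,2) N2S] _ dz(1) dN3 dz(2)]
    by metis
  obtain m where m: "p dvd m * 1 + k"
    using additive_cong_solvable[OF S(5), of 1 k] S(5) by (metis nat_dvd_1_iff_1 not_prime_1)
  define y' where "y' = x ^ m * y"
  have y'S: "y' \<in> S" using S by (simp add: y'_def sg_closed)
  have c': "comm y' x = c"
  proof (rule comm_unique[THEN iffD1, symmetric])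
    have yx: "y * x = x * y * c" unfolding c_def by (rule mult_comm)
    have "y' * x = x ^ m * (x * y * c)" by (simp only: y'_def mult.assoc yx)
    also have "\<dots> = x * y' * c" by (simp only: y'_def power_commutes mult.assoc[symmetric])
    finally show "y' * x = x * y' * c" .
  qed
  obtain f :: "'a \<Rightarrow> 'a set sym" where f: "ghom S f" "\<And>s. s \<in> S \<Longrightarrow> f s = 1 \<longleftrightarrow> s \<in> N3"
    using quotient_hom[OF S(1) N3(1)] by blast
  have N2c: "f u * f s = f s * f u" if us: "u \<in> N2" "s \<in> S" for u s
  proof -
    obtain v where "v \<in> N3" "u * s = s * u * v" using NN[OF us] by blast
    hence "comm u s \<in> N3" using comm_unique[of u s v] by simp
    thus ?thesis using ghom_comm_iff[OF f(1) S(1), of u s] f(2)[of "comm u s"] us N2S comm_closed[OF S(1)] by auto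
  qed
  have "{u \<in> N2. f u = 1} = N3" using f(2) N3(2) N2S by auto
  hence "p ^ 2 = card (f ` N2) * p"
    using card_ghom[OF f(1) S(1) nrm_sg[OF N2(1)] N2S finN2] N2(3) N3(3) by simp
  hence "card (f ` N2) = p" using S(6) by (simp add: power2_eq_square)
  hence fdp: "f d ^ p = 1"
    using pow_card_sg[OF ghom_image_sg[OF f(1) S(1) nrm_sg[OF N2(1)] N2S], of "f d"] finN2 dz(1) by simp
  have dS: "d \<in> S" "w \<in> S" using dz kw N3 N2S by auto
  have fz: "f z = f d ^ k"
    using kw dS f(2)[OF dS(2)] S(1) by (simp add: ghom_mult[OF f(1)] ghom_pow[OF f(1)] sg_pow)
  interpret collection "f x" "f y" "f c" "f d" 1 "f z"
  proof
    have eq: "f (u * v) = f (v * u * comm u v)" for u v by (simp flip: mult_comm)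
    show "f y * f x = f x * f y * f c" using eq[of y x] S cD by (simp add: c_def ghom_mult[OF f(1)] sg_closed)
    show "f c * f x = f x * f c * f d" using eq[of c x] S cD dz N2S
      by (simp add: d_def ghom_mult[OF f(1)] sg_closed subset_iff)
    show "f c * f y = f y * f c * f z" using eq[of c y] S cD dz N2S
      by (simp add: z_def ghom_mult[OF f(1)] sg_closed subset_iff)
    show "f d * f x = f x * f d * 1" "f d * f y = f y * f d" "f z * f x = f x * f z" "f z * f y = f y * f z"
      "f c * f d = f d * f c" "f c * f z = f z * f c" "f d * f z = f z * f d"
      using N2c[OF dz(1) S(3)] N2c[OF dz(1) S(4)] N2c[OF dz(2) S(3)] N2c[OF dz(2) S(4)]
        N2c[OF dz(1) cD(2)] N2c[OF dz(2) cD(2)] N2c[OF dz(1), of z] dz(2) N2S by auto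
  qed simp_all
  have fy': "f y' = f x ^ m * f y" using S by (simp add: y'_def ghom_mult[OF f(1)] ghom_pow[OF f(1)] sg_pow)
  have "f c * f y' = f x ^ m * f c * (f d ^ m * f y)"
    using c_x_pow[of 1 m] unfolding fy' nf_def by (simp add: binomial_eq_0 flip: mult.assoc)
  also have "f d ^ m * f y = f y * f d ^ m" using commute_pow[OF dy, of m 1] by simp
  also have "f x ^ m * f c * (f y * f d ^ m) = f x ^ m * (f c * f y) * f d ^ m" by (simp only: mult.assoc)
  also have "\<dots> = f y' * f c * (f z * f d ^ m)" by (simp only: cy fy' mult.assoc)
  also have "f z * f d ^ m = f d ^ (m * 1 + k)" by (simp add: fz add.commute flip: power_add)
  also have "\<dots> = 1" using pow_dvd_one[OF fdp m] .
  finally have "f c * f y' = f y' * f c" by simp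
  hence "comm c y' \<in> N3"
    using ghom_comm_iff[OF f(1) S(1) cD(2) y'S] f(2)[of "comm c y'"] comm_closed[OF S(1) cD(2) y'S] by simp
  thus ?thesis using c' dN3 by (intro exI[of _ m]) (simp add: d_def flip: y'_def)
qed

text \<open>The order of the derived subgroup is \<open>p ^ (5 - (a + b))\<close>, and
  \<open>b\<close> is positive unless it is trivial, which leaves the four cases.\<close>

lemma classification:
  fixes S :: "'a::grp set"
  assumes "gpair p S x0 y0"
  shows "bounded_presentation p S \<or> separated S"
proof -
  obtain x y a b where xy: "gpair p S x y" and ba: "b \<le> a" and cS: "card S = p ^ (a + b) * card (derived_sub S)"
    and iff: "\<And>i j. x ^ i * y ^ j \<in> derived_sub S \<longleftrightarrow> p ^ a dvd i \<and> p ^ b dvd j"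
    using abelian_type[OF assms] by metis
  have S: "subgrp S" "finite S" "x \<in> S" "y \<in> S" "prime p" "5 < p" "card S = p ^ 5"
    using gpair_sg[OF xy] gpair_mem[OF xy] by auto
  have nD: "normal_sub (derived_sub S) S" by (rule nrm_der) (rule S)
  have xa: "x ^ (p ^ a) \<in> derived_sub S" and yb: "y ^ (p ^ b) \<in> derived_sub S"
    using iff[of "p ^ a" 0] iff[of 0 "p ^ b"] by simp_all
  define k where "k = 5 - (a + b)"
  have "p ^ (a + b) dvd p ^ 5" using cS S(7) by (metis dvd_triv_left)
  hence ab5: "a + b \<le> 5" using S(6) by (simp add: power_dvd_imp_le)
  hence "p ^ (a + b) * p ^ k = p ^ (a + b) * card (derived_sub S)" using cS S(7) by (simp add: k_def flip: power_add)
  hence cD: "card (derived_sub S) = p ^ k" using S(6) by simp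
  have bpos: "0 < b" if "k \<noteq> 0"
    by (rule abelian_type_pos[OF xy _ iff]) (use cD that S(6) in simp)
  have "k = 0 \<or> 0 < b" using bpos by blast
  then consider "k = 0" "a + b = 5" | "k = 1" "0 < b" "a + b = 4" | "k = 2" "a = 2" "b = 1" | "k = 3" "a = 1" "b = 1"
    using ab5 ba unfolding k_def by linarith
  thus ?thesis
  proof cases
    case 1
    hence "card (derived_sub S) = 1" using cD by simp
    then obtain v where "derived_sub S = {v}" by (auto simp: card_1_singleton_iff)
    hence "derived_sub S = {1}" using sg_one[OF nrm_sg[OF nD]] by auto
    thus ?thesis using bounded_presentation_abelian[OF xy _ ba 1(2)] xa yb by auto
  next
    case 2
    thus ?thesis using bounded_presentation_order_p[OF xy _ _ ba 2(3) xa yb] cD by simp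
  next
    case 3
    have "1 < card (derived_sub S)" unfolding cD 3 using S(6) one_less_power[of p 2] by simp
    hence "derived_sub S \<noteq> {1}" by auto
    then obtain N where N: "normal_sub N S" "N \<subseteq> derived_sub S" "card (derived_sub S) = p * card N"
        "\<And>u s. u \<in> derived_sub S \<Longrightarrow> s \<in> S \<Longrightarrow> \<exists>w\<in>N. u * s = s * u * w"
      using central_series_step[OF S(1,2,7,5) nD] by metis
    interpret order_p2 p S N x y
      by unfold_locales (use xy cD 3 N xa yb S(6) in \<open>auto simp: power2_eq_square\<close>)
    show ?thesis using bounded_presentation by simp
  next
    case 4
    hence cD3: "card (derived_sub S) = p ^ 3" using cD by simp
    hence "1 < card (derived_sub S)" using S(6) one_less_power[of p 3] by simp
    hence "derived_sub S \<noteq> {1}" by auto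
    then obtain N2 where N2: "normal_sub N2 S" "N2 \<subseteq> derived_sub S" "card (derived_sub S) = p * card N2"
        "\<And>u s. u \<in> derived_sub S \<Longrightarrow> s \<in> S \<Longrightarrow> \<exists>w\<in>N2. u * s = s * u * w"
      using central_series_step[OF S(1,2,7,5) nD] by metis
    have cN2: "card N2 = p ^ 2" using N2(3) cD3 S(6) by (simp add: power2_eq_square power3_eq_cube)
    hence "1 < card N2" using S(6) one_less_power[of p 2] by simp
    hence "N2 \<noteq> {1}" by auto
    then obtain N3 where N3: "normal_sub N3 S" "N3 \<subseteq> N2" "card N2 = p * card N3"
        "\<And>u s. u \<in> N2 \<Longrightarrow> s \<in> S \<Longrightarrow> \<exists>w\<in>N3. u * s = s * u * w"
      using central_series_step[OF S(1,2,7,5) N2(1)] by metis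
    have cN3: "card N3 = p" using N3(3) cN2 S(6) by (simp add: power2_eq_square)
    have powD: "u ^ p \<in> derived_sub S" if "u \<in> S" for u
      by (rule pow_p_in_der[OF xy _ _ that]) (use xa yb 4 in simp_all)
    show ?thesis
    proof (cases "\<exists>w\<in>N2. \<exists>s\<in>S. w * s \<noteq> s * w")
      case False
      have three: "class_three p S N2 x' y'" if "gpair p S x' y'" for x' y'
        by unfold_locales (use that N2 cN2 False powD in auto)
      interpret class_three p S N2 x y by (rule three[OF xy])
      show ?thesis
      proof (cases "\<exists>i j. (x ^ p) ^ i * (y ^ p) ^ j = 1 \<and> \<not> (p dvd i \<and> p dvd j)")
        case False
        thus ?thesis using separated_if_pow_independent iff 4 by auto
      next
        case True
        \<comment> \<open>A dependency yields a generator with trivial \<open>p\<close>-th power: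
          \<open>x ^ i * y ^ j\<close> if \<open>p\<close> does not divide \<open>i\<close>,
          otherwise \<open>y\<close>.\<close>
        then obtain i j where ij: "(x ^ p) ^ i * (y ^ p) ^ j = 1" "\<not> (p dvd i \<and> p dvd j)" by blast
        show ?thesis
        proof (cases "p dvd i")
          case False
          have p1: "\<not> p dvd 1" using S(6) by simp
          have "gpair p S (x ^ i * y ^ j) y"
            using gpair_swap[OF gpair_mult_right[OF gpair_swap[OF gpair_pow[OF xy False p1]]]] by simp
          then interpret B: class_three p S N2 "x ^ i * y ^ j" y by (rule three)
          show ?thesis using B.bounded_presentation_if_x_pow_trivial pow_linear ij(1) by simp
        next
          case True
          hence "(y ^ p) ^ j = 1" "\<not> p dvd j" using ij pow_dvd_one[OF N_pow[OF x_pow] True] by auto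
          hence yp: "y ^ p = 1" using ord_prime_iff[OF S(5) N_pow[OF y_pow], of j] by blast
          interpret B: class_three p S N2 y x by (rule three[OF gpair_swap[OF xy]])
          show ?thesis using B.bounded_presentation_if_x_pow_trivial yp by simp
        qed
      qed
    next
      case True
      \<comment> \<open>If this failed for both orders of the generators, \<open>c\<close> would be
        central modulo \<open>N3\<close> and the derived subgroup would have order at most
        \<open>p^2\<close>.\<close>
      have "\<exists>x y. gpair p S x y \<and> comm (comm y x) x \<notin> N3"
      proof (rule ccontr)
        assume "\<not> ?thesis"
        hence no: "comm (comm y x) x \<in> N3" if "gpair p S x y" for x y using that by blast
        obtain f :: "'a \<Rightarrow> 'a set sym" where f: "ghom S f" "\<And>s. s \<in> S \<Longrightarrow> f s = 1 \<longleftrightarrow> s \<in> N3"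
          using quotient_hom[OF S(1) N3(1)] by blast
        have cS: "comm y x \<in> S" "comm x y \<in> S" using S by (simp_all add: comm_closed)
        have inv: "comm y x = ginv (comm x y)" by (simp add: comm_def ginv_mult)
        have "f (comm x y) * f y = f y * f (comm x y)"
          using ghom_comm_iff[OF f(1) S(1) cS(2) S(4)] no[OF gpair_swap[OF xy]] f(2)[of "comm (comm x y) y"]
            comm_closed[OF S(1) cS(2) S(4)] by simp
        hence "f y * ginv (f (comm x y)) = ginv (f (comm x y)) * f y"
          by (metis eq_mult_ginv_iff ginv_left_assoc mult.assoc)
        hence "f (comm y x) * f y = f y * f (comm y x)"
          using cS by (simp add: inv ghom_ginv[OF f(1) S(1)])
        hence "comm (comm y x) y \<in> N3"
          using ghom_comm_iff[OF f(1) S(1) cS(1) S(4)] f(2)[of "comm (comm y x) y"]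
            comm_closed[OF S(1) cS(1) S(4)] by simp
        hence "card (derived_sub S) \<le> p * card N3"
          using no[OF xy] N2(2) N3(1,2) powD[OF S(4)] by (intro der_small_if_central[OF xy]) auto
        thus False using cD3 cN3 S(6) by (simp add: power3_eq_cube)
      qed
      then obtain x y where xy: "gpair p S x y" "comm (comm y x) x \<notin> N3" by blast
      obtain m where m: "comm (comm (x ^ m * y) x) (x ^ m * y) \<in> N3" "comm (comm (x ^ m * y) x) x \<notin> N3"
        using class_four_generators[OF xy(1) cD3 N2(1,2) cN2 N3(1,2) cN3 N2(4) N3(4) xy(2)] by blast
      interpret class_four p S N2 x "x ^ m * y" N3
        by unfold_locales (use gpair_mult_left[OF xy(1)] N2 cN2 N3 cN3 powD m True in auto)
      show ?thesis using bounded_presentation by simp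
    qed
  qed
qed

section \<open>A family of pairwise non-isomorphic groups\<close>

text \<open>The parameter of the presentation is an invariant: the commutator and the \<open>p\<close>-th power map
  identify the classes modulo the Frattini subgroup with the centre in two ways, and the linear map
  comparing them has trace and determinant determined up to \<open>\<delta>\<close> and \<open>\<delta>\<^sup>2\<close>, where \<open>\<delta>\<close> is the
  determinant of the change of generators.\<close>

lemma parameter_arith:
  fixes p :: nat and a b a' b' n t t' :: int
  assumes p: "prime (int p)"
    and n: "[n = a * b' - a' * b] (mod int p)"
    and 1: "[n * (t * b) = a'] (mod int p)" and 2: "[n * (a + b) = b'] (mod int p)"
    and 3: "[n * (t * b') = t' * a + a'] (mod int p)" and 4: "[n * (a' + b') = t' * b + b'] (mod int p)"
    and n0: "\<not> int p dvd n"
  shows "[t = t'] (mod int p)"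
proof -
  let ?q = "int p"
  note mods = cong_iff_dvd_diff
  have d: "?q dvd n - (a * b' - a' * b)" "?q dvd n * (t * b) - a'" "?q dvd n * (a + b) - b'"
    "?q dvd n * (t * b') - (t' * a + a')" "?q dvd n * (a' + b') - (t' * b + b')"
    using assms by (simp_all add: mods)
  obtain k1 k2 k3 k4 k5 where k: "n = a * b' - a' * b + ?q * k1" "a' = n * (t * b) + ?q * k2"
      "b' = n * (a + b) + ?q * k3" "n * (t * b') = t' * a + a' + ?q * k4" "n * (a' + b') = t' * b + b' + ?q * k5"
  proof -
    from d obtain k1 k2 k3 k4 k5 where "n - (a * b' - a' * b) = ?q * k1" "n * (t * b) - a' = ?q * k2"
      "n * (a + b) - b' = ?q * k3" "n * (t * b') - (t' * a + a') = ?q * k4"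
      "n * (a' + b') - (t' * b + b') = ?q * k5" unfolding dvd_def by blast
    thus ?thesis by (intro that[of k1 "- k2" "- k3" k4 k5]) (simp_all add: algebra_simps)
  qed
  \<comment> \<open>The determinant of \<open>v = (a, b)\<close> and
    \<open>M v = (t*b, a + b)\<close>, where \<open>M\<close> is the comparison map. By
    \<open>1\<close> and \<open>2\<close>, \<open>(a', b')\<close> is \<open>n\<close> times
    \<open>M v\<close>, so the determinant \<open>n\<close> equals \<open>n * A\<close>.\<close>
  define A where "A = a * a + a * b - t * b * b"
  have "?q dvd n * (A - 1)"
  proof -
    have "n * (A - 1) = a * (n * (a + b)) - (n * (t * b)) * b - n" by (simp add: A_def algebra_simps)
    also have "\<dots> = a * (b' - ?q * k3) - (a' - ?q * k2) * b - n" using k(2,3) by simp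
    also have "\<dots> = ?q * (- a * k3 + k2 * b - k1)" using k(1) by (simp add: algebra_simps)
    finally show ?thesis by simp
  qed
  hence A1: "?q dvd A - 1" using n0 p by (simp add: prime_dvd_mult_iff)
  \<comment> \<open>By Cayley-Hamilton \<open>M^2 = M + t\<close>, hence \<open>3\<close> and
    \<open>4\<close> become \<open>s * v + r * M v = 0\<close>. Since \<open>v\<close> and
    \<open>M v\<close> are independent, \<open>r\<close> vanishes (trace, giving
    \<open>n = 1\<close>) and then \<open>s\<close> (determinant).\<close>
  define s r where "s = n * n * t - t'" and "r = n * n - n"
  have e3: "?q dvd s * a + r * t * b"
  proof -
    have "s * a + r * t * b = n * (t * (n * (a + b))) - n * (t * b) - t' * a" by (simp add: s_def r_def algebra_simps)
    also have "\<dots> = n * (t * (b' - ?q * k3)) - (a' - ?q * k2) - t' * a" using k(2,3) by simp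
    also have "\<dots> = ?q * (k4 - n * t * k3 + k2)" using k(4) by (simp add: algebra_simps)
    finally show ?thesis by simp
  qed
  have e4: "?q dvd s * b + r * (a + b)"
  proof -
    have "s * b + r * (a + b) = n * (n * (t * b)) + n * (n * (a + b)) - n * (a + b) - t' * b"
      by (simp add: s_def r_def algebra_simps)
    also have "\<dots> = n * (a' - ?q * k2) + n * (b' - ?q * k3) - (b' - ?q * k3) - t' * b" using k(2,3) by simp
    also have "\<dots> = ?q * (k5 - n * k2 - n * k3 + k3)" using k(5) by (simp add: algebra_simps)
    finally show ?thesis by simp
  qed
  have "?q dvd (s * b + r * (a + b)) * a - (s * a + r * t * b) * b"
    by (intro dvd_diff dvd_mult2 e3 e4)
  also have "(s * b + r * (a + b)) * a - (s * a + r * t * b) * b = r * A" by (simp add: A_def algebra_simps)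
  finally have "?q dvd r * A" .
  hence "?q dvd r * A - r * (A - 1)" using dvd_mult[OF A1, of r] by (rule dvd_diff)
  hence r0: "?q dvd r" by (simp add: algebra_simps)
  have "?q dvd n * (n - 1)" using r0 by (simp add: r_def algebra_simps)
  hence n1: "?q dvd n - 1" using n0 p by (simp add: prime_dvd_mult_iff)
  have sa: "?q dvd s * a" using e3 r0 by (metis dvd_add_left_iff dvd_mult2)
  have sb: "?q dvd s * b" using e4 r0 by (metis dvd_add_left_iff dvd_mult2)
  have "?q dvd s"
  proof (rule ccontr)
    assume "\<not> ?q dvd s"
    hence "?q dvd a" "?q dvd b" using sa sb p by (auto simp: prime_dvd_mult_iff)
    hence "?q dvd A" by (simp add: A_def)
    hence "?q dvd A - (A - 1)" using A1 by (rule dvd_diff)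
    thus False using p by (auto dest: not_prime_unit)
  qed
  moreover have "?q dvd (n * n - 1) * t"
  proof -
    have "n * n - 1 = (n - 1) * (n + 1)" by (simp add: algebra_simps)
    thus ?thesis using n1 by simp
  qed
  ultimately have "?q dvd s - (n * n - 1) * t" by (rule dvd_diff)
  thus ?thesis by (simp add: s_def mods algebra_simps)
qed

text \<open>Here \<open>d\<close> and \<open>z\<close> are expressed by \<open>p\<close>-th powers,
  so commutation with \<open>c\<close> becomes the matrix with rows \<open>(0, t)\<close> and
  \<open>(1, 1)\<close> of trace \<open>1\<close> and determinant \<open>- t\<close>. The factors
  \<open>2\<close> match the doubled coordinates of the model \<open>nil3\<close>.\<close>

locale parameter_group =
  fixes p t :: nat and S :: "'a::grp set" and x y c :: 'a
  assumes xy: "gpair p S x y" and cS: "c \<in> S"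
    and col: "collection x y c (y ^ (2 * p)) 1 (x ^ (2 * p * t) * y ^ (2 * p))"
    and pw: "c ^ p = 1" "(x ^ p) ^ p = 1" "(y ^ p) ^ p = 1"
    and central: "x ^ p * y = y * x ^ p" "y ^ p * x = x * y ^ p" "x ^ p * c = c * x ^ p" "y ^ p * c = c * y ^ p"
    and ind: "\<And>i j. (x ^ p) ^ i * (y ^ p) ^ j = 1 \<Longrightarrow> p dvd i \<and> p dvd j"
    and elem: "\<And>u. u \<in> S \<Longrightarrow> \<exists>a b k. u = x ^ a * y ^ b * c ^ k"
begin

abbreviation "d \<equiv> y ^ (2 * p)"
abbreviation "z \<equiv> x ^ (2 * p * t) * y ^ (2 * p)"

sublocale collection x y c d 1 z by (rule col)

lemma S: "subgrp S" "finite S" "x \<in> S" "y \<in> S" "prime p" "5 < p"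
  using gpair_sg[OF xy] gpair_mem[OF xy] by auto

definition "Z = gen {x ^ p, y ^ p}"

lemma Z_central:
  assumes w: "w \<in> Z" and s: "s \<in> S"
  shows "w * s = s * w"
proof -
  have "{x ^ p, y ^ p} \<subseteq> {w \<in> S. w * s = s * w}"
  proof -
    obtain a b k where s': "s = x ^ a * y ^ b * c ^ k" using elem[OF s] by blast
    have "x ^ p * s = s * x ^ p"
      unfolding s' using commute_pow[of "x ^ p" x 1 a] commute_pow[OF central(1), of 1 b] commute_pow[OF central(3), of 1 k]
      by (intro commute_mult[symmetric, of "x ^ p"] commute_mult) (simp_all add: power_commutes mult.assoc)
    moreover have "y ^ p * s = s * y ^ p"
      unfolding s' using commute_pow[of "y ^ p" y 1 b] commute_pow[OF central(2), of 1 a] commute_pow[OF central(4), of 1 k]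
      by (intro commute_mult[symmetric, of "y ^ p"] commute_mult) (simp_all add: power_commutes mult.assoc)
    ultimately show ?thesis using S by (simp add: sg_pow)
  qed
  hence "Z \<subseteq> {w \<in> S. w * s = s * w}" unfolding Z_def by (intro gen_least sg_centralizer S)
  thus ?thesis using w by auto
qed

lemma Z_S: "w \<in> Z \<Longrightarrow> w \<in> S"
  unfolding Z_def using gen_least[OF S(1), of "{x ^ p, y ^ p}"] S by (auto simp: sg_pow)

lemma nrm_Z: "normal_sub Z S"
  unfolding normal_sub_def
proof (intro conjI ballI)
  fix n s assume n: "n \<in> Z" and s: "s \<in> S"
  show "ginv s * n * s \<in> Z" using n Z_central[OF n s] by (simp add: mult.assoc)
qed (use Z_S in \<open>auto simp: Z_def\<close>)

lemma dzZ: "d \<in> Z" "z \<in> Z"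
proof -
  have g: "x ^ p \<in> Z" "y ^ p \<in> Z" "subgrp Z" unfolding Z_def by (auto intro: gen_mem)
  have "d = (y ^ p) ^ 2" "z = (x ^ p) ^ (2 * t) * (y ^ p) ^ 2"
    by (simp_all add: mult.commute mult.left_commute flip: power_mult)
  thus "d \<in> Z" "z \<in> Z" using g by (metis sg_mult sg_pow)+
qed

lemma dz_pow: "d ^ p = 1" "z ^ p = 1"
proof -
  show d: "d ^ p = 1" using pow_swap_one[OF pw(3), of 2] by (simp add: mult.commute flip: power_mult)
  have "x ^ (2 * p * t) * y ^ (2 * p) = y ^ (2 * p) * x ^ (2 * p * t)"
    using commute_pow[OF commute_pow[OF central(2), of 1 1], of 2 "2 * p * t"]
    by (simp add: mult.commute flip: power_mult)
  hence "z ^ p = (x ^ (2 * p * t)) ^ p * d ^ p" by (rule commute_mult_pow)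
  also have "(x ^ (2 * p * t)) ^ p = ((x ^ p) ^ p) ^ (2 * t)" by (simp add: ac_simps flip: power_mult)
  finally show "z ^ p = 1" using d pw by simp
qed

lemma pow_elem: "(x ^ a * y ^ b * c ^ k) ^ p = (x ^ p) ^ a * (y ^ p) ^ b"
proof -
  let ?u = "x ^ a * y ^ b"
  define w where "w = d ^ (k * a) * z ^ (k * b)"
  have wZ: "w \<in> Z" unfolding w_def using dzZ nrm_sg[OF nrm_Z] by (simp add: sg_closed)
  have uS: "?u \<in> S" "c ^ k \<in> S" using S cS by (auto simp: sg_closed)
  have cen: "w * s = s * w" if "s \<in> S" for s by (rule Z_central[OF wZ that])
  have "c ^ k * ?u = x ^ a * c ^ k * (d ^ (k * a) * y ^ b)"
    using c_x_pow[of k a] unfolding nf_def by (simp add: binomial_eq_0 flip: mult.assoc)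
  also have "d ^ (k * a) * y ^ b = y ^ b * d ^ (k * a)" by (rule commute_pow[OF dy])
  also have "x ^ a * c ^ k * (y ^ b * d ^ (k * a)) = x ^ a * (c ^ k * y ^ b) * d ^ (k * a)" by (simp only: mult.assoc)
  also have "\<dots> = ?u * c ^ k * (z ^ (k * b) * d ^ (k * a))" by (simp only: c_y_pow mult.assoc)
  also have "z ^ (k * b) * d ^ (k * a) = w" unfolding w_def by (rule cdez_commute(5)[symmetric])
  finally interpret C: collection ?u "c ^ k" w 1 1 1
    by unfold_locales (simp_all add: cen uS)
  have "w ^ p = 1"
    unfolding w_def commute_mult_pow[OF cdez_commute(5)] using pow_swap_one[OF dz_pow(1)] pow_swap_one[OF dz_pow(2)] by simp
  hence "(?u * c ^ k) ^ p = ?u ^ p * (c ^ k) ^ p"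
    by (intro C.xy_pow_prime[OF S(5)]) (use S in auto)
  moreover have "?u ^ p = (x ^ p) ^ a * (y ^ p) ^ b"
    by (rule scaled_pow_prime[OF S(5)]) (use S pw dz_pow in auto)
  ultimately show ?thesis using pow_swap_one[OF pw(1)] by simp
qed

text \<open>Commutation with \<open>c ^ n * w\<close> is linear in the class of the element modulo
  \<open>c\<close> and the central \<open>p\<close>-th powers.\<close>

lemma comm_with_elem:
  assumes w: "w \<in> Z"
  shows "(c ^ n * w) * (x ^ a * y ^ b * c ^ k) = (x ^ a * y ^ b * c ^ k) * (c ^ n * w) * (d ^ (n * a) * z ^ (n * b))"
proof -
  let ?u = "x ^ a * y ^ b"
  define v where "v = d ^ (n * a) * z ^ (n * b)"
  have vZ: "v \<in> Z" unfolding v_def using dzZ nrm_sg[OF nrm_Z] by (simp add: sg_closed)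
  have uS: "?u \<in> S" "c ^ k \<in> S" "c ^ n \<in> S" using S cS by (auto simp: sg_closed)
  have "c ^ n * ?u = x ^ a * c ^ n * (d ^ (n * a) * y ^ b)"
    using c_x_pow[of n a] unfolding nf_def by (simp add: binomial_eq_0 flip: mult.assoc)
  also have "d ^ (n * a) * y ^ b = y ^ b * d ^ (n * a)" by (rule commute_pow[OF dy])
  also have "x ^ a * c ^ n * (y ^ b * d ^ (n * a)) = x ^ a * (c ^ n * y ^ b) * d ^ (n * a)" by (simp only: mult.assoc)
  also have "\<dots> = ?u * c ^ n * (z ^ (n * b) * d ^ (n * a))" by (simp only: c_y_pow mult.assoc)
  also have "z ^ (n * b) * d ^ (n * a) = v" unfolding v_def by (rule cdez_commute(5)[symmetric])
  finally have cu: "c ^ n * ?u = ?u * c ^ n * v" .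
  have "(c ^ n * w) * (?u * c ^ k) = c ^ n * (?u * c ^ k) * w"
  proof -
    have "w * (?u * c ^ k) = ?u * c ^ k * w" by (rule Z_central[OF w sg_mult[OF S(1) uS(1,2)]])
    thus ?thesis by (simp only: mult.assoc[of "c ^ n" w]) (simp only: mult.assoc)
  qed
  also have "\<dots> = c ^ n * ?u * (c ^ k * w)" by (simp only: mult.assoc)
  also have "\<dots> = ?u * c ^ n * (v * (c ^ k * w))" by (simp only: cu mult.assoc)
  also have "v * (c ^ k * w) = c ^ k * w * v" by (rule Z_central[OF vZ]) (use uS Z_S[OF w] S(1) in \<open>simp add: sg_mult\<close>)
  also have "?u * c ^ n * (c ^ k * w * v) = ?u * (c ^ n * c ^ k) * w * v" by (simp only: mult.assoc)
  also have "c ^ n * c ^ k = c ^ k * c ^ n" by (rule cdez_commute)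
  finally show ?thesis by (simp only: v_def mult.assoc)
qed

lemma xy_p_commute: "x ^ p * y ^ p = y ^ p * x ^ p"
  using commute_pow[OF central(1), of 1 p] by simp

lemma dz_rep: "d ^ i * z ^ j = (x ^ p) ^ (2 * t * j) * (y ^ p) ^ (2 * i + 2 * j)"
proof -
  have xx: "x ^ (2 * p * t) = (x ^ p) ^ (2 * t)" and yy: "y ^ (2 * p) = (y ^ p) ^ 2"
    by (simp_all add: ac_simps flip: power_mult)
  have "(x ^ p) ^ (2 * t) * (y ^ p) ^ 2 = (y ^ p) ^ 2 * (x ^ p) ^ (2 * t)"
    by (rule commute_pow[OF xy_p_commute])
  from commute_mult_pow[OF this, of j] have "z ^ j = (x ^ p) ^ (2 * t * j) * (y ^ p) ^ (2 * j)"
    unfolding xx yy by (simp only: power_mult)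
  moreover have "d ^ i = (y ^ p) ^ (2 * i)" unfolding yy by (simp add: power_mult)
  moreover have "(y ^ p) ^ (2 * i) * (x ^ p) ^ (2 * t * j) = (x ^ p) ^ (2 * t * j) * (y ^ p) ^ (2 * i)"
    by (rule commute_pow[OF xy_p_commute[symmetric]])
  ultimately show ?thesis by (simp add: power_add flip: mult.assoc)
qed

lemma cong_of_eq:
  assumes "(x ^ p) ^ i * (y ^ p) ^ j = (x ^ p) ^ i' * (y ^ p) ^ j'"
  shows "[i = i'] (mod p) \<and> [j = j'] (mod p)"
  by (rule independent_cong[OF xy_p_commute _ ind pw(2,3) assms]) (use S in auto)

lemma half_cong: "[2 * i = 2 * j] (mod p) \<Longrightarrow> [i = j] (mod p)" for i j :: nat
  using S prime_coprime_small[OF S(5), of 2 1] by (simp add: cong_mult_lcancel_nat)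

text \<open>The new generators are written in normal form. Modulo \<open>Z\<close> the new
  commutator is \<open>c ^ n\<close> with \<open>n\<close> the determinant of the change of
  generators; comparing exponents of \<open>x ^ p\<close> and \<open>y ^ p\<close> in the two
  remaining relations gives the four congruences of \<open>parameter_arith\<close>.\<close>

lemma parameter_unique:
  assumes gen': "gen {x', y'} = S"
    and yx': "y' * x' = x' * y' * c'" and cx': "c' * x' = x' * c' * y' ^ (2 * p)"
    and cy': "c' * y' = y' * c' * (x' ^ (2 * p * t') * y' ^ (2 * p))"
    and t': "\<not> p dvd t'"
  shows "[t = t'] (mod p)"
proof -
  have S': "x' \<in> S" "y' \<in> S" using gen' gen_mem[of _ "{x', y'}"] by auto
  obtain a b k where x': "x' = x ^ a * y ^ b * c ^ k" using elem[OF S'(1)] by blast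
  obtain a' b' k' where y': "y' = x ^ a' * y ^ b' * c ^ k'" using elem[OF S'(2)] by blast
  have c'S: "c' \<in> S"
  proof -
    have "c' = comm y' x'" using yx' comm_unique by blast
    thus ?thesis using comm_closed[OF S(1)] S' by simp
  qed
  obtain f :: "'a \<Rightarrow> 'a set sym" where f: "ghom S f" "\<And>s. s \<in> S \<Longrightarrow> f s = 1 \<longleftrightarrow> s \<in> Z"
    using quotient_hom[OF S(1) nrm_Z] by blast
  have fS: "f (u * v) = f u * f v" if "u \<in> S" "v \<in> S" for u v using ghom_mult[OF f(1) that] .
  have fc: "f c * f x = f x * f c" "f c * f y = f y * f c" "f y * f x = f x * f y * f c"
  proof -
    have fd: "f d = 1" "f z = 1" using f(2) dzZ Z_S by auto
    have "f (c * x) = f (x * c * d)" "f (c * y) = f (y * c * z)" "f (y * x) = f (x * y * c)"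
      by (simp_all only: cx cy yx)
    thus "f c * f x = f x * f c" "f c * f y = f y * f c" "f y * f x = f x * f y * f c"
      using fd S cS Z_S[OF dzZ(1)] Z_S[OF dzZ(2)] by (simp_all add: fS sg_closed)
  qed
  interpret Q: collection "f x" "f y" "f c" 1 1 1 by standard (simp_all add: fc)
  have fe: "f (x ^ i * y ^ j * c ^ l) = f x ^ i * f y ^ j * f c ^ l" for i j l
    using S cS by (simp add: fS sg_closed ghom_pow[OF f(1)])
  have prod: "f x ^ i * f y ^ j * f c ^ l * (f x ^ i' * f y ^ j' * f c ^ l')
      = f x ^ (i + i') * f y ^ (j + j') * f c ^ (l + l' + i' * j)" for i j l i' j' l'
  proof -
    have cxy: "f c ^ l * f x ^ i' = f x ^ i' * f c ^ l" "f c ^ r * f y ^ j' = f y ^ j' * f c ^ r" for r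
      by (rule commute_pow[OF fc(1)], rule commute_pow[OF fc(2)])
    have yx: "f y ^ j * f x ^ i' = f x ^ i' * f y ^ j * f c ^ (i' * j)"
      using Q.y_x_pow[of j i'] by (simp add: Q.nf_def mult.assoc)
    have "f x ^ i * f y ^ j * f c ^ l * (f x ^ i' * f y ^ j' * f c ^ l')
        = f x ^ i * f y ^ j * (f c ^ l * f x ^ i') * (f y ^ j' * f c ^ l')" by (simp only: mult.assoc)
    also have "\<dots> = f x ^ i * (f y ^ j * f x ^ i') * (f c ^ l * f y ^ j') * f c ^ l'"
      by (simp only: cxy(1) mult.assoc)
    also have "\<dots> = f x ^ i * (f x ^ i' * f y ^ j * f c ^ (i' * j)) * (f y ^ j' * f c ^ l) * f c ^ l'"
      by (simp only: yx cxy(2))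
    also have "\<dots> = f x ^ i * f x ^ i' * f y ^ j * (f c ^ (i' * j) * f y ^ j') * (f c ^ l * f c ^ l')"
      by (simp only: mult.assoc)
    also have "\<dots> = f x ^ i * f x ^ i' * f y ^ j * (f y ^ j' * f c ^ (i' * j)) * (f c ^ l * f c ^ l')"
      by (simp only: cxy(2))
    also have "\<dots> = f x ^ (i + i') * f y ^ (j + j') * (f c ^ (i' * j) * (f c ^ l * f c ^ l'))"
      by (simp only: power_add mult.assoc)
    also have "f c ^ (i' * j) * (f c ^ l * f c ^ l') = f c ^ (l + l' + i' * j)"
      by (simp add: add_ac flip: power_add)
    finally show ?thesis .
  qed
  \<comment> \<open>The determinant \<open>a*b' - a'*b\<close> modulo \<open>p\<close>, kept a
    natural number.\<close>
  define n where "n = a * b' + (p - 1) * (a' * b)"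
  have fcp: "f c ^ p = 1" using pw(1) ghom_pow[OF f(1) S(1) cS, of p] ghom_one[OF f(1) S(1)] by simp
  have "f c' = f c ^ n"
  proof -
    have "f (y' * x') = f (x' * y' * c')" by (simp only: yx')
    hence "f y' * f x' = f x' * f y' * f c'" using S' c'S S(1) by (simp add: fS sg_closed)
    hence "f x ^ (a' + a) * f y ^ (b' + b) * f c ^ (k' + k + a * b')
        = f x ^ (a + a') * f y ^ (b + b') * f c ^ (k + k' + a' * b) * f c'"
      unfolding x' y' fe prod .
    hence "f c ^ (k + k' + a * b') = f c ^ (k + k' + a' * b) * f c'"
      by (simp add: add.commute mult.assoc)
    hence eq: "f c ^ (a * b') = f c ^ (a' * b) * f c'" by (simp add: power_add mult.assoc)
    have "f c' = f c ^ (p * (a' * b)) * f c'" using fcp by (simp add: power_mult)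
    also have "p * (a' * b) = (p - 1) * (a' * b) + a' * b" using S(6) by (cases p) auto
    also have "f c ^ ((p - 1) * (a' * b) + a' * b) * f c' = f c ^ ((p - 1) * (a' * b)) * f c ^ (a * b')"
      by (simp only: power_add mult.assoc eq)
    also have "\<dots> = f c ^ n" by (simp add: n_def add.commute flip: power_add)
    finally show ?thesis .
  qed
  hence "f (ginv (c ^ n) * c') = 1"
    using c'S cS S(1) by (simp add: fS sg_closed ghom_ginv[OF f(1)] ghom_pow[OF f(1)])
  hence wZ: "ginv (c ^ n) * c' \<in> Z" using f(2) c'S cS S(1) by (simp add: sg_closed)
  define w where "w = ginv (c ^ n) * c'"
  have c': "c' = c ^ n * w" by (simp add: w_def)
  have wZ: "w \<in> Z" using wZ by (simp add: w_def)
  have y'p: "y' ^ (2 * p) = (x ^ p) ^ (2 * a') * (y ^ p) ^ (2 * b')"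
  proof -
    have "y' ^ (2 * p) = (y' ^ p) ^ 2" by (simp add: mult.commute flip: power_mult)
    also have "\<dots> = ((x ^ p) ^ a' * (y ^ p) ^ b') ^ 2" by (simp only: y' pow_elem)
    also have "\<dots> = ((x ^ p) ^ a') ^ 2 * ((y ^ p) ^ b') ^ 2"
      by (rule commute_mult_pow[OF commute_pow[OF xy_p_commute]])
    also have "\<dots> = (x ^ p) ^ (2 * a') * (y ^ p) ^ (2 * b')"
      by (simp only: power_mult[of "_ ^ p", symmetric] mult.commute)
    finally show ?thesis .
  qed
  have x'p: "x' ^ (2 * p * t') = (x ^ p) ^ (2 * t' * a) * (y ^ p) ^ (2 * t' * b)"
  proof -
    have "x' ^ (2 * p * t') = (x' ^ p) ^ (2 * t')" by (simp add: ac_simps flip: power_mult)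
    also have "\<dots> = ((x ^ p) ^ a * (y ^ p) ^ b) ^ (2 * t')" by (simp only: x' pow_elem)
    also have "\<dots> = ((x ^ p) ^ a) ^ (2 * t') * ((y ^ p) ^ b) ^ (2 * t')"
      by (rule commute_mult_pow[OF commute_pow[OF xy_p_commute]])
    also have "\<dots> = (x ^ p) ^ (2 * t' * a) * (y ^ p) ^ (2 * t' * b)"
      by (simp only: power_mult[of "_ ^ p", symmetric] mult.commute)
    finally show ?thesis .
  qed
  have "d ^ (n * a) * z ^ (n * b) = y' ^ (2 * p)"
    using cx' comm_with_elem[OF wZ, of n a b k] unfolding c' x' by simp
  hence e1: "[2 * t * (n * b) = 2 * a'] (mod p) \<and> [2 * (n * a) + 2 * (n * b) = 2 * b'] (mod p)"
    unfolding dz_rep y'p by (rule cong_of_eq)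
  have "d ^ (n * a') * z ^ (n * b') = x' ^ (2 * p * t') * y' ^ (2 * p)"
    using cy' comm_with_elem[OF wZ, of n a' b' k'] unfolding c' y' by simp
  also have "\<dots> = (x ^ p) ^ (2 * t' * a + 2 * a') * (y ^ p) ^ (2 * t' * b + 2 * b')"
  proof -
    have "(y ^ p) ^ (2 * t' * b) * (x ^ p) ^ (2 * a') = (x ^ p) ^ (2 * a') * (y ^ p) ^ (2 * t' * b)"
      by (rule commute_pow[OF xy_p_commute[symmetric]])
    thus ?thesis unfolding x'p y'p power_add by (simp only: mult.assoc assoc_mult_swap)
  qed
  finally have e2: "[2 * t * (n * b') = 2 * t' * a + 2 * a'] (mod p) \<and>
      [2 * (n * a') + 2 * (n * b') = 2 * t' * b + 2 * b'] (mod p)"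
    unfolding dz_rep by (rule cong_of_eq)
  have h: "[n * (t * b) = a'] (mod p)" "[n * (a + b) = b'] (mod p)"
    "[n * (t * b') = t' * a + a'] (mod p)" "[n * (a' + b') = t' * b + b'] (mod p)"
    by (rule half_cong, use e1 e2 in \<open>simp add: algebra_simps\<close>)+
  \<comment> \<open>If \<open>n\<close> vanished, so would all four coordinates modulo
    \<open>p\<close>; the generators would lie in \<open>Z\<close> up to powers of \<open>c\<close>
    and commute, making the group abelian against \<open>d\<close> being nontrivial.\<close>
  have n0: "\<not> p dvd n"
  proof
    assume pn: "p dvd n"
    have "p dvd a'" using h(1) pn by (metis cong_dvd_iff dvd_mult2)
    moreover have "p dvd b'" using h(2) pn by (metis cong_dvd_iff dvd_mult2)
    ultimately have "p dvd t' * a" "p dvd t' * b"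
      using h(3,4) pn by (metis cong_dvd_iff dvd_mult2 dvd_add_left_iff)+
    hence "p dvd a" "p dvd b" using t' S(5) by (auto simp: prime_dvd_mult_iff)
    note ab = \<open>p dvd a\<close> \<open>p dvd b\<close> \<open>p dvd a'\<close> \<open>p dvd b'\<close>
    have Zp: "x ^ i \<in> Z" "y ^ i \<in> Z" if "p dvd i" for i
    proof -
      from \<open>p dvd i\<close> obtain m where m: "i = p * m" by auto
      show "x ^ i \<in> Z" "y ^ i \<in> Z"
        unfolding Z_def m power_mult by (rule sg_pow[OF sg_gen gen_mem], simp)+
    qed
    have "x' * y' = y' * x'"
    proof -
      define u v where "u = x ^ a * y ^ b" and "v = x ^ a' * y ^ b'"
      have uv: "u \<in> Z" "v \<in> Z" unfolding u_def v_def using Zp ab nrm_sg[OF nrm_Z] by (auto intro: sg_mult)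
      have uS: "u \<in> S" "v \<in> S" "c ^ k \<in> S" "c ^ k' \<in> S" using uv Z_S cS S(1) by (auto simp: sg_pow)
      have "x' * y' = u * (c ^ k * v) * c ^ k'" unfolding x' y' u_def v_def by (simp only: mult.assoc)
      also have "c ^ k * v = v * c ^ k" using Z_central[OF uv(2) uS(3)] by simp
      also have "u * (v * c ^ k) * c ^ k' = (u * v) * (c ^ k * c ^ k')" by (simp only: mult.assoc)
      also have "u * v = v * u" by (rule Z_central[OF uv(1) uS(2)])
      also have "c ^ k * c ^ k' = c ^ k' * c ^ k" by (rule cdez_commute)
      also have "v * u * (c ^ k' * c ^ k) = v * (u * c ^ k') * c ^ k" by (simp only: mult.assoc)
      also have "u * c ^ k' = c ^ k' * u" by (rule Z_central[OF uv(1) uS(4)])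
      also have "v * (c ^ k' * u) * c ^ k = y' * x'" unfolding x' y' u_def v_def by (simp only: mult.assoc)
      finally show ?thesis .
    qed
    moreover have "ghom S id" by (simp add: ghom_def)
    ultimately have ab: "u * v = v * u" if "u \<in> S" "v \<in> S" for u v
      using ghom_commute_gen2[OF _ S(1) gen' _ that, of id] by simp
    have "d = 1" using ab[OF cS S(3)] cx by (simp add: mult.assoc)
    hence "(x ^ p) ^ 0 * (y ^ p) ^ 2 = 1" by (simp add: mult.commute flip: power_mult)
    hence "p dvd 2" using ind by blast
    thus False using S(6) by (auto dest: dvd_imp_le)
  qed
  have i: "[int (n * (t * b)) = int a'] (mod int p)" "[int (n * (a + b)) = int b'] (mod int p)"
    "[int (n * (t * b')) = int (t' * a + a')] (mod int p)" "[int (n * (a' + b')) = int (t' * b + b')] (mod int p)"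
    using h by (simp_all only: cong_int_iff)
  have "[int t = int t'] (mod int p)"
  proof (rule parameter_arith[where n = "int n" and a = "int a" and b = "int b" and a' = "int a'" and b' = "int b'"])
    show "prime (int p)" using S(5) by simp
    have "int n = int a * int b' + (int p - 1) * (int a' * int b)" using S(6) by (simp add: n_def of_nat_diff)
    hence "int n - (int a * int b' - int a' * int b) = int p * (int a' * int b)" by (simp add: algebra_simps)
    thus "[int n = int a * int b' - int a' * int b] (mod int p)" by (simp add: cong_iff_dvd_diff)
    show "\<not> int p dvd int n" using n0 by simp
  qed (use i in simp_all)
  thus ?thesis by (simp only: cong_int_iff)
qed

end

section \<open>Existence of the family as quotients of a class-three group\<close>

text \<open>The free nilpotent group of class three and rank two in Mal'cev coordinates, with the last two
  coordinates doubled so that the multiplication is given by integer polynomials.\<close>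

datatype nil3 = Nil3 int int int int int

instantiation nil3 :: grp
begin

text \<open>Formally \<open>Nil3 i j k l m\<close> is \<open>x^i y^j c^k d^(l/2) z^(m/2)\<close>,
  and the product is its collection with \<open>e = 1\<close>.\<close>

fun times_nil3 :: "nil3 \<Rightarrow> nil3 \<Rightarrow> nil3" where
  "Nil3 i j k l m * Nil3 i' j' k' l' m' =
     Nil3 (i + i') (j + j') (k + k' + j * i') (l + l' + j * (i' * (i' - 1)) + 2 * i' * k)
       (m + m' + i' * (j * (j - 1)) + 2 * j' * (k + j * i'))"

definition one_nil3 :: nil3 where "1 = Nil3 0 0 0 0 0"

fun ginv_nil3 :: "nil3 \<Rightarrow> nil3" where
  "ginv (Nil3 i j k l m) = Nil3 (- i) (- j) (j * i - k) (2 * i * k - l - j * (i * (i + 1)))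
     (2 * j * (k - j * i) - m + i * (j * (j - 1)))"

instance
proof
  fix a b c :: nil3
  obtain i j k l m where a: "a = Nil3 i j k l m" by (cases a)
  obtain i' j' k' l' m' where b: "b = Nil3 i' j' k' l' m'" by (cases b)
  obtain i'' j'' k'' l'' m'' where c: "c = Nil3 i'' j'' k'' l'' m''" by (cases c)
  show "a * b * c = a * (b * c)" by (simp add: a b c algebra_simps)
  show "1 * a = a" "a * 1 = a" by (simp_all add: a one_nil3_def)
  show "ginv a * a = 1" by (simp add: a one_nil3_def algebra_simps)
qed

end

lemma nil3_pow:
  "Nil3 i 0 0 0 0 ^ n = Nil3 (int n * i) 0 0 0 0"
  "Nil3 0 j 0 0 0 ^ n = Nil3 0 (int n * j) 0 0 0"
  "Nil3 0 0 k 0 0 ^ n = Nil3 0 0 (int n * k) 0 0"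
  by (induction n) (simp_all add: one_nil3_def algebra_simps)

text \<open>Imposing \<open>d = y^(2q)\<close> and \<open>z = x^(2qt) y^(2q)\<close> turns the
  element into one with \<open>x\<close>-exponent \<open>i + q*t*m\<close> and
  \<open>y\<close>-exponent \<open>j + q*(l + m)\<close>; these must vanish modulo
  \<open>q^2\<close>, and \<open>k\<close> modulo \<open>q\<close>.\<close>

fun nil3_kernel :: "int \<Rightarrow> int \<Rightarrow> nil3 \<Rightarrow> bool" where
  "nil3_kernel q t (Nil3 i j k l m) \<longleftrightarrow> q dvd i \<and> q dvd j \<and> q dvd k \<and>
     q\<^sup>2 dvd i + q * (t * m) \<and> q\<^sup>2 dvd j + q * (l + m)"

lemma nil3_kernel_mult:
  assumes "nil3_kernel q t u" "nil3_kernel q t v"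
  shows "nil3_kernel q t (u * v)"
proof -
  obtain i j k l m where u: "u = Nil3 i j k l m" by (cases u)
  obtain i' j' k' l' m' where v: "v = Nil3 i' j' k' l' m'" by (cases v)
  have d: "q dvd i" "q dvd j" "q dvd k" "q dvd i'" "q dvd j'" "q dvd k'" using assms by (auto simp: u v)
  have d2: "q\<^sup>2 dvd i + q * (t * m)" "q\<^sup>2 dvd j + q * (l + m)" "q\<^sup>2 dvd i' + q * (t * m')" "q\<^sup>2 dvd j' + q * (l' + m')"
    using assms by (auto simp: u v)
  define \<delta> \<epsilon> where "\<delta> = j * (i' * (i' - 1)) + 2 * i' * k" and "\<epsilon> = i' * (j * (j - 1)) + 2 * j' * (k + j * i')"
  have "q dvd \<delta>" "q dvd \<epsilon>" using d by (auto simp: \<delta>_def \<epsilon>_def)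
  hence "q * q dvd q * (t * \<epsilon>)" "q * q dvd q * (\<delta> + \<epsilon>)" by (auto intro!: mult_dvd_mono dvd_add dvd_mult)
  hence "q\<^sup>2 dvd (i + q * (t * m)) + (i' + q * (t * m')) + q * (t * \<epsilon>)"
    "q\<^sup>2 dvd (j + q * (l + m)) + (j' + q * (l' + m')) + q * (\<delta> + \<epsilon>)"
    using d2 by (auto simp only: power2_eq_square intro!: dvd_add)
  thus ?thesis using d by (auto simp: u v \<delta>_def \<epsilon>_def algebra_simps)
qed

lemma nil3_kernel_ginv:
  assumes "nil3_kernel q t u"
  shows "nil3_kernel q t (ginv u)"
proof -
  obtain i j k l m where u: "u = Nil3 i j k l m" by (cases u)
  have d: "q dvd i" "q dvd j" "q dvd k" using assms by (auto simp: u)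
  have d2: "q\<^sup>2 dvd i + q * (t * m)" "q\<^sup>2 dvd j + q * (l + m)" using assms by (auto simp: u)
  define \<delta> \<epsilon> where "\<delta> = 2 * i * k - j * (i * (i + 1))" and "\<epsilon> = 2 * j * (k - j * i) + i * (j * (j - 1))"
  have "q dvd \<delta>" "q dvd \<epsilon>" using d by (auto simp: \<delta>_def \<epsilon>_def)
  hence "q * q dvd q * (t * \<epsilon>)" "q * q dvd q * (\<delta> + \<epsilon>)" by (auto intro!: mult_dvd_mono dvd_add dvd_mult)
  hence "q\<^sup>2 dvd q * (t * \<epsilon>) - (i + q * (t * m))" "q\<^sup>2 dvd q * (\<delta> + \<epsilon>) - (j + q * (l + m))"
    using d2 by (auto simp only: power2_eq_square intro!: dvd_diff)
  thus ?thesis using d by (auto simp: u \<delta>_def \<epsilon>_def algebra_simps)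
qed

lemma nrm_nil3_kernel: "normal_sub {u. nil3_kernel q t u} UNIV"
  unfolding normal_sub_def subgrp_def
proof (intro conjI ballI)
  show "1 \<in> {u. nil3_kernel q t u}" by (simp add: one_nil3_def)
  fix u assume u: "u \<in> {u. nil3_kernel q t u}"
  show "ginv u \<in> {u. nil3_kernel q t u}" using u nil3_kernel_ginv by simp
  show "u * v \<in> {u. nil3_kernel q t u}" if "v \<in> {u. nil3_kernel q t u}" for v
    using u that nil3_kernel_mult by simp
  fix s :: nil3
  obtain i j k l m where eu: "u = Nil3 i j k l m" by (cases u)
  obtain i' j' k' l' m' where es: "s = Nil3 i' j' k' l' m'" by (cases s)
  define \<kappa> where "\<kappa> = j * i' - j' * i"
  define \<delta> where "\<delta> = j * (i' * (i' - 1)) + 2 * i' * k - (j' * (i * (i - 1)) + 2 * i * k')"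
  define \<epsilon> where "\<epsilon> = i' * (j * (j - 1)) + 2 * j' * (k + j * i')
    - (i * (j' * (j' - 1)) + 2 * j * (k' + j' * i))"
  have d: "q dvd i" "q dvd j" "q dvd k" using u by (auto simp: eu)
  have dd: "q dvd \<kappa>" "q dvd \<delta>" "q dvd \<epsilon>" using d by (auto simp: \<kappa>_def \<delta>_def \<epsilon>_def)
  hence "q * q dvd q * (t * \<epsilon>)" "q * q dvd q * (\<delta> + \<epsilon>)" by (auto intro!: mult_dvd_mono dvd_add dvd_mult)
  hence "nil3_kernel q t (Nil3 0 0 \<kappa> \<delta> \<epsilon>)" using dd by (simp add: power2_eq_square)
  hence "nil3_kernel q t (u * Nil3 0 0 \<kappa> \<delta> \<epsilon>)" using u nil3_kernel_mult by simp
  moreover have "u * s = s * (u * Nil3 0 0 \<kappa> \<delta> \<epsilon>)"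
    by (simp add: eu es \<kappa>_def \<delta>_def \<epsilon>_def algebra_simps)
  ultimately show "ginv s * u * s \<in> {u. nil3_kernel q t u}" by (simp add: mult.assoc)
qed simp

text \<open>Coordinates on the quotient: after trading \<open>l\<close> and \<open>m\<close> for
  powers of \<open>x\<close> and \<open>y\<close>, a coset is given by two residues modulo
  \<open>q^2\<close> and one modulo \<open>q\<close>.\<close>

lemma nil3_kernel_quotient_iff:
  "nil3_kernel q t (ginv (Nil3 i j k' l m) * Nil3 a b k 0 0) \<longleftrightarrow>
     [a = i + q * (t * m)] (mod q\<^sup>2) \<and> [b = j + q * (l + m)] (mod q\<^sup>2) \<and> [k = k'] (mod q)"
proof (cases "[a = i] (mod q) \<and> [b = j] (mod q)")
  case True
  define L where "L = 2 * i * k' - l - j * (i * (i + 1)) + (- j) * (a * (a - 1)) + 2 * a * (j * i - k')"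
  define M where "M = 2 * j * (k' - j * i) - m + i * (j * (j - 1)) + a * ((- j) * (- j - 1)) + 2 * b * (j * i - k' + (- j) * a)"
  have ca: "[a = i] (mod q)" and cb: "[b = j] (mod q)" using True by auto
  have "[L = 2 * i * k' - l - j * (i * (i + 1)) + (- j) * (i * (i - 1)) + 2 * i * (j * i - k')] (mod q)"
    unfolding L_def by (intro cong_add cong_mult cong_diff cong_refl ca)
  hence "[L = - l] (mod q)" by (simp add: algebra_simps)
  hence L: "q dvd L + l" by (simp add: cong_iff_dvd_diff)
  have "[M = 2 * j * (k' - j * i) - m + i * (j * (j - 1)) + i * ((- j) * (- j - 1)) + 2 * j * (j * i - k' + (- j) * i)] (mod q)"
    unfolding M_def by (intro cong_add cong_mult cong_diff cong_refl ca cb)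
  hence "[M = - m] (mod q)" by (simp add: algebra_simps)
  hence M: "q dvd M + m" by (simp add: cong_iff_dvd_diff)
  have "q * q dvd q * (t * (M + m))" "q * q dvd q * ((L + l) + (M + m))"
    by (rule mult_dvd_mono[OF dvd_refl dvd_mult[OF M]], rule mult_dvd_mono[OF dvd_refl dvd_add[OF L M]])
  hence e: "q\<^sup>2 dvd (a - i - q * (t * m)) + q * (t * (M + m)) \<longleftrightarrow> q\<^sup>2 dvd a - i - q * (t * m)"
     "q\<^sup>2 dvd (b - j - q * (l + m)) + q * ((L + l) + (M + m)) \<longleftrightarrow> q\<^sup>2 dvd b - j - q * (l + m)"
    by (simp_all only: power2_eq_square dvd_add_left_iff)
  have k: "q dvd j * i - k' + k + (- j) * a \<longleftrightarrow> q dvd k - k'"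
  proof -
    have d: "q dvd j * (a - i)" using ca by (simp add: cong_iff_dvd_diff)
    have e: "j * i - k' + k + (- j) * a = (k - k') + - (j * (a - i))" by (simp add: algebra_simps)
    show ?thesis unfolding e by (rule dvd_add_left_iff) (simp only: dvd_minus_iff d)
  qed
  have "ginv (Nil3 i j k' l m) * Nil3 a b k 0 0 = Nil3 (a - i) (b - j) (j * i - k' + k + (- j) * a) L M"
    by (simp add: L_def M_def)
  hence "nil3_kernel q t (ginv (Nil3 i j k' l m) * Nil3 a b k 0 0) \<longleftrightarrow>
      q dvd k - k' \<and> q\<^sup>2 dvd (a - i) + q * (t * M) \<and> q\<^sup>2 dvd (b - j) + q * (L + M)"
    using ca cb k by (simp add: cong_iff_dvd_diff)
  also have "(a - i) + q * (t * M) = (a - i - q * (t * m)) + q * (t * (M + m))" by (simp add: algebra_simps)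
  also have "(b - j) + q * (L + M) = (b - j - q * (l + m)) + q * ((L + l) + (M + m))" by (simp add: algebra_simps)
  finally show ?thesis unfolding e by (auto simp: cong_iff_dvd_diff diff_diff_eq)
next
  case False
  have "[c = d] (mod q)" if "[c = d + q * e] (mod q\<^sup>2)" for c d e :: int
  proof -
    have "[c = d + q * e] (mod q)" using that by (rule cong_dvd_modulus) (simp add: power2_eq_square)
    thus ?thesis by (simp add: cong_def)
  qed
  thus ?thesis using False by (auto simp: cong_iff_dvd_diff)
qed

text \<open>The quotient has \<open>p^2 * p^2 * p\<close> elements by its coordinates, and every
  required relation is checked on normal forms.\<close>

lemma parameter_group_exists:
  assumes p: "prime p" "5 < p"
  shows "\<exists>(S :: nil3 set sym set) x y c. parameter_group p t S x y c"
proof -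
  let ?q = "int p"
  have p0: "p > 0" using p by simp
  obtain f :: "nil3 \<Rightarrow> nil3 set sym" where "ghom UNIV f"
    and "\<And>s. s \<in> UNIV \<Longrightarrow> f s = 1 \<longleftrightarrow> s \<in> {u. nil3_kernel ?q (int t) u}"
    using quotient_hom[OF _ nrm_nil3_kernel, of ?q "int t"] by (auto simp: subgrp_def)
  hence f: "ghom UNIV f" and ker: "f s = 1 \<longleftrightarrow> nil3_kernel ?q (int t) s" for s by auto
  have U: "subgrp (UNIV :: nil3 set)" by (simp add: subgrp_def)
  have fm: "f (u * v) = f u * f v" for u v using ghom_mult[OF f] by simp
  have fp: "f (u ^ n) = f u ^ n" for u n using ghom_pow[OF f U] by simp
  have feq: "f u = f v \<longleftrightarrow> nil3_kernel ?q (int t) (ginv u * v)" for u v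
  proof -
    have "f (ginv u * v) = ginv (f u) * f v" using ghom_ginv[OF f U] by (simp add: fm)
    moreover have "ginv (f u) * f v = 1 \<longleftrightarrow> f u = f v"
      using grp_left_cancel[of "f u" "ginv (f u) * f v" 1] by auto
    ultimately show ?thesis by (simp flip: ker)
  qed
  have norm: "f (Nil3 i j k' l m) = f (Nil3 a b k 0 0) \<longleftrightarrow>
     [a = i + ?q * (int t * m)] (mod ?q\<^sup>2) \<and> [b = j + ?q * (l + m)] (mod ?q\<^sup>2) \<and> [k = k'] (mod ?q)"
    for i j k' l m a b k unfolding feq by (rule nil3_kernel_quotient_iff)
  \<comment> \<open>Both sides reduce to the same normal form; this makes \<open>p\<close>-th powers
    central at once, since swapping the factors alters the last three coordinates by multiples of
    \<open>p\<close> only.\<close>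
  have mod_p: "f (Nil3 i j k l m) = f (Nil3 i j k' l' m')"
    if "[k = k'] (mod ?q)" "[l = l'] (mod ?q)" "[m = m'] (mod ?q)" for i j k l m k' l' m'
  proof -
    have "[?q * (int t * m') = ?q * (int t * m)] (mod ?q * ?q)" "[?q * (l' + m') = ?q * (l + m)] (mod ?q * ?q)"
      using cong_sym[OF that(2)] cong_sym[OF that(3)]
      by (auto intro!: cong_cmult_leftI cong_mult cong_add)
    hence "f (Nil3 i j k l m) = f (Nil3 (i + ?q * (int t * m')) (j + ?q * (l' + m')) k' 0 0)"
      unfolding norm using cong_sym[OF that(1)] by (auto simp: power2_eq_square intro!: cong_add)
    also have "\<dots> = f (Nil3 i j k' l' m')" by (rule sym) (simp add: norm)
    finally show ?thesis .
  qed
  have central: "f (Nil3 (?q * \<alpha>) (?q * \<beta>) 0 0 0) * f u = f u * f (Nil3 (?q * \<alpha>) (?q * \<beta>) 0 0 0)" for u \<alpha> \<beta>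
  proof -
    obtain i j k l m where u: "u = Nil3 i j k l m" by (cases u)
    have "f (Nil3 (?q * \<alpha>) (?q * \<beta>) 0 0 0 * u) = f (u * Nil3 (?q * \<alpha>) (?q * \<beta>) 0 0 0)"
      unfolding u times_nil3.simps add.commute[of "?q * \<alpha>"] add.commute[of "?q * \<beta>"]
      by (rule mod_p) (auto simp: cong_iff_dvd_diff intro!: dvd_diff dvd_add)
    thus ?thesis by (simp add: fm)
  qed
  define X Y C where "X = Nil3 1 0 0 0 0" and "Y = Nil3 0 1 0 0 0" and "C = Nil3 0 0 1 0 0"
  define S where "S = range f"
  have S: "subgrp S" unfolding S_def by (rule ghom_image_sg[OF f U U]) simp
  have pows: "X ^ n = Nil3 (int n) 0 0 0 0" "Y ^ n = Nil3 0 (int n) 0 0 0" "C ^ n = Nil3 0 0 (int n) 0 0" for n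
    by (simp_all add: X_def Y_def C_def nil3_pow)
  have XYC: "X ^ a * Y ^ b * C ^ k = Nil3 (int a) (int b) (int k) 0 0" for a b k by (simp add: pows)
  have XYC_eq: "f (X ^ a * Y ^ b * C ^ k) = f (X ^ a' * Y ^ b' * C ^ k') \<longleftrightarrow>
      [a = a'] (mod p\<^sup>2) \<and> [b = b'] (mod p\<^sup>2) \<and> [k = k'] (mod p)" for a b k a' b' k'
    unfolding XYC norm using cong_int_iff[of a' a "p\<^sup>2"] cong_int_iff[of b' b "p\<^sup>2"] cong_int_iff[of k' k p]
    by (auto simp: cong_sym_eq)
  have XYC_one: "f (X ^ a * Y ^ b * C ^ k) = 1 \<longleftrightarrow> p\<^sup>2 dvd a \<and> p\<^sup>2 dvd b \<and> p dvd k" for a b k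
    using XYC_eq[of a b k 0 0 0] ghom_one[OF f U] by (simp add: cong_0_iff)
  have elem: "\<exists>a<p\<^sup>2. \<exists>b<p\<^sup>2. \<exists>k<p. u = f (X ^ a * Y ^ b * C ^ k)" if "u \<in> S" for u
  proof -
    obtain i j k l m where u: "u = f (Nil3 i j k l m)" using \<open>u \<in> S\<close> unfolding S_def by (metis imageE nil3.exhaust)
    define a b k' where "a = nat ((i + ?q * (int t * m)) mod ?q\<^sup>2)" and "b = nat ((j + ?q * (l + m)) mod ?q\<^sup>2)"
      and "k' = nat (k mod ?q)"
    have pos: "?q\<^sup>2 > 0" "?q > 0" using p0 by auto
    have e: "int a = (i + ?q * (int t * m)) mod ?q\<^sup>2" "int b = (j + ?q * (l + m)) mod ?q\<^sup>2" "int k' = k mod ?q"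
      using pos by (simp_all add: a_def b_def k'_def)
    have "u = f (X ^ a * Y ^ b * C ^ k')" unfolding u XYC norm e by (simp add: cong_def)
    moreover have "int a < int (p\<^sup>2)" "int b < int (p\<^sup>2)" "int k' < int p" unfolding e using pos by simp_all
    ultimately show ?thesis by (metis of_nat_less_iff)
  qed
  have "bij_betw (\<lambda>(a, b, k). f (X ^ a * Y ^ b * C ^ k)) ({..<p\<^sup>2} \<times> {..<p\<^sup>2} \<times> {..<p}) S"
    unfolding bij_betw_def
  proof
    show "inj_on (\<lambda>(a, b, k). f (X ^ a * Y ^ b * C ^ k)) ({..<p\<^sup>2} \<times> {..<p\<^sup>2} \<times> {..<p})"
      by (rule inj_onI) (auto simp: XYC_eq cong_less_modulus_unique_nat)
    show "(\<lambda>(a, b, k). f (X ^ a * Y ^ b * C ^ k)) ` ({..<p\<^sup>2} \<times> {..<p\<^sup>2} \<times> {..<p}) = S"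
    proof
      show "S \<subseteq> (\<lambda>(a, b, k). f (X ^ a * Y ^ b * C ^ k)) ` ({..<p\<^sup>2} \<times> {..<p\<^sup>2} \<times> {..<p})"
      proof
        fix u assume "u \<in> S"
        then obtain a b k where abk: "a < p\<^sup>2" "b < p\<^sup>2" "k < p" "u = f (X ^ a * Y ^ b * C ^ k)"
          using elem by blast
        thus "u \<in> (\<lambda>(a, b, k). f (X ^ a * Y ^ b * C ^ k)) ` ({..<p\<^sup>2} \<times> {..<p\<^sup>2} \<times> {..<p})"
          by (intro image_eqI[of _ _ "(a, b, k)"]) auto
      qed
    qed (auto simp: S_def)
  qed
  from bij_betw_same_card[OF this] bij_betw_finite[OF this]
  have bij: "card S = p ^ 5" "finite S" by (simp_all add: eval_nat_numeral)
  define x y c where "x = f X" and "y = f Y" and "c = f C"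
  have xyc: "x ^ a * y ^ b * c ^ k = f (X ^ a * Y ^ b * C ^ k)" for a b k
    by (simp add: x_def y_def c_def fm fp)
  have mem: "x \<in> S" "y \<in> S" "c \<in> S" by (auto simp: x_def y_def c_def S_def)
  have yx: "y * x = x * y * c"
    unfolding x_def y_def c_def fm[symmetric] by (simp add: X_def Y_def C_def)
  have "gen {x, y} = S"
  proof
    show "gen {x, y} \<subseteq> S" by (rule gen_least) (use S mem in auto)
    have g: "x \<in> gen {x, y}" "y \<in> gen {x, y}" by (auto intro: gen_mem)
    have "c = comm y x" using yx comm_unique by blast
    hence "c \<in> gen {x, y}" using g by (simp add: comm_closed)
    hence "x ^ a * y ^ b * c ^ k \<in> gen {x, y}" for a b k using g by (simp add: sg_mult sg_pow)
    thus "S \<subseteq> gen {x, y}" using elem unfolding xyc by blast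
  qed
  hence gp: "gpair p S x y" using p S bij by (simp add: gpair_def)
  have cen: "x ^ (p * a) * y ^ (p * b) * f u = f u * (x ^ (p * a) * y ^ (p * b))" for a b u
    using central[of "int a" "int b" u] XYC[of "p * a" "p * b" 0] xyc[of "p * a" "p * b" 0] by simp
  have cx: "c * x = x * c * y ^ (2 * p)"
  proof -
    have "c * x = f (Nil3 1 0 1 2 0)" unfolding x_def c_def fm[symmetric] by (simp add: X_def C_def)
    also have "\<dots> = f (X ^ 1 * Y ^ (2 * p) * C ^ 1)" unfolding XYC norm by (simp add: mult.commute)
    also have "\<dots> = x * (y ^ (2 * p) * c)" using xyc[of 1 "2 * p" 1] by (simp add: mult.assoc)
    also have "y ^ (2 * p) * c = c * y ^ (2 * p)" using cen[of 0 2 C] by (simp add: c_def mult.commute)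
    finally show ?thesis by (simp add: mult.assoc)
  qed
  have z: "x ^ (2 * p * t) * y ^ (2 * p) * f u = f u * (x ^ (2 * p * t) * y ^ (2 * p))" for u
    using cen[of "2 * t" 2 u] by (simp add: ac_simps)
  have cy: "c * y = y * c * (x ^ (2 * p * t) * y ^ (2 * p))"
  proof -
    have "c * y = f (Nil3 0 1 1 0 2)" unfolding y_def c_def fm[symmetric] by (simp add: Y_def C_def)
    also have "\<dots> = f (X ^ (2 * p * t) * Y ^ (2 * p + 1) * C ^ 1)" unfolding XYC norm by (simp add: algebra_simps)
    also have "\<dots> = x ^ (2 * p * t) * y ^ (2 * p) * (y * c)"
      using xyc[of "2 * p * t" "2 * p + 1" 1] by (simp only: power_add power_one_right mult.assoc)
    also have "\<dots> = y * c * (x ^ (2 * p * t) * y ^ (2 * p))" using z[of "Y * C"] by (simp add: fm y_def c_def)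
    finally show ?thesis .
  qed
  have d: "y ^ (2 * p) * f u = f u * y ^ (2 * p)" for u using cen[of 0 2 u] by (simp add: mult.commute)
  have zd: "f (X ^ (2 * p * t) * Y ^ (2 * p)) = x ^ (2 * p * t) * y ^ (2 * p)" by (simp add: x_def y_def fm fp)
  have col: "collection x y c (y ^ (2 * p)) 1 (x ^ (2 * p * t) * y ^ (2 * p))"
  proof
    show "y ^ (2 * p) * (x ^ (2 * p * t) * y ^ (2 * p)) = x ^ (2 * p * t) * y ^ (2 * p) * y ^ (2 * p)"
      using d[of "X ^ (2 * p * t) * Y ^ (2 * p)"] unfolding zd .
  qed (use yx cx cy d[of X] d[of Y] d[of C] z[of X] z[of Y] z[of C] in \<open>simp_all add: x_def y_def c_def\<close>)
  have "parameter_group p t S x y c"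
  proof (rule parameter_group.intro)
    show "gpair p S x y" "c \<in> S" by (fact gp mem)+
    show "collection x y c (y ^ (2 * p)) 1 (x ^ (2 * p * t) * y ^ (2 * p))" by (rule col)
    show "c ^ p = 1" using XYC_one[of 0 0 p] xyc[of 0 0 p] by simp
    show "(x ^ p) ^ p = 1" using XYC_one[of "p\<^sup>2" 0 0] xyc[of "p\<^sup>2" 0 0]
      by (simp add: power2_eq_square flip: power_mult)
    show "(y ^ p) ^ p = 1" using XYC_one[of 0 "p\<^sup>2" 0] xyc[of 0 "p\<^sup>2" 0]
      by (simp add: power2_eq_square flip: power_mult)
    show "x ^ p * y = y * x ^ p" "x ^ p * c = c * x ^ p"
      using cen[of 1 0 Y] cen[of 1 0 C] by (simp_all add: y_def c_def)
    show "y ^ p * x = x * y ^ p" "y ^ p * c = c * y ^ p"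
      using cen[of 0 1 X] cen[of 0 1 C] by (simp_all add: x_def c_def)
    show "p dvd i \<and> p dvd j" if "(x ^ p) ^ i * (y ^ p) ^ j = 1" for i j
      using that XYC_one[of "p * i" "p * j" 0] xyc[of "p * i" "p * j" 0] p0
      by (simp add: power_mult power2_eq_square)
    show "\<exists>a b k. u = x ^ a * y ^ b * c ^ k" if "u \<in> S" for u using elem[OF that] xyc by metis
  qed
  thus ?thesis by blast
qed

section \<open>From type-class groups back to groups on natural numbers\<close>

lemma generate_mon:
  assumes "subgrp S" "A \<subseteq> S"
  shows "generate (as_monoid S) A = gen A"
proof -
  interpret group "as_monoid S" by (rule mon_group) fact
  have sub: "generate (as_monoid S) A \<subseteq> S" using generate_incl assms by simp
  have "subgrp (generate (as_monoid S) A)"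
    unfolding subgrp_def
  proof (intro conjI ballI)
    show "1 \<in> generate (as_monoid S) A" using generate.one[of "as_monoid S" A] by simp
    fix a b assume a: "a \<in> generate (as_monoid S) A"
    show "ginv a \<in> generate (as_monoid S) A"
      using generate_m_inv_closed[of A a] a assms sub by (auto simp: mon_inv)
    assume b: "b \<in> generate (as_monoid S) A"
    show "a * b \<in> generate (as_monoid S) A" using generate.eng[OF a b] by simp
  qed
  hence "gen A \<subseteq> generate (as_monoid S) A" by (rule gen_least) (auto intro: generate.incl)
  moreover have "a \<in> gen A" if "a \<in> generate (as_monoid S) A" for a
    using that
  proof (induction rule: generate.induct)
    case (inv h)
    thus ?case using assms by (auto simp: mon_inv subset_iff intro: sg_ginv gen_mem)
  qed (auto intro: sg_one sg_mult gen_mem)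
  ultimately show ?thesis by auto
qed

text \<open>Isomorphism classes are counted among carriers of natural numbers, so the constructed
  groups are copied there along an injection.\<close>

lemma nat_model:
  fixes S :: "'a::grp set"
  assumes "subgrp S" "finite S"
  obtains G :: "nat monoid" where "group G" "as_monoid S \<cong> G"
proof -
  interpret group "as_monoid S" by (rule mon_group) fact
  obtain b :: "'a \<Rightarrow> nat" where b: "inj_on b S" using finite_imp_inj_to_nat_seg[OF assms(2)] by metis
  define G where "G = \<lparr>carrier = b ` S, monoid.mult = (\<lambda>u v. b (the_inv_into S b u * the_inv_into S b v)), one = b 1\<rparr>"
  have inv: "the_inv_into S b (b u) = u" if "u \<in> S" for u using the_inv_into_f_f[OF b that] .
  have "group G"
  proof (rule groupI)
    fix u assume "u \<in> carrier G"
    then obtain v where v: "v \<in> S" "u = b v" by (auto simp: G_def)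
    thus "\<exists>w\<in>carrier G. w \<otimes>\<^bsub>G\<^esub> u = \<one>\<^bsub>G\<^esub>"
      using assms(1) by (intro bexI[of _ "b (ginv v)"]) (auto simp: G_def inv sg_ginv)
  qed (use assms(1) in \<open>auto simp: G_def inv sg_closed mult.assoc\<close>)
  moreover have "b \<in> iso (as_monoid S) G"
    using b assms(1) by (auto simp: iso_def hom_def G_def inv bij_betw_def sg_mult)
  ultimately show ?thesis using that by (auto simp: is_iso_def)
qed

lemma two_generated_iso:
  assumes "group G" "group H" "G \<cong> H" "generating_pair G x y"
  shows "two_generated H"
proof -
  obtain h where h: "h \<in> iso G H" using assms(3) by (auto simp: is_iso_def)
  interpret group_hom G H h
    using assms(1,2) h by (simp add: group_hom_def group_hom_axioms_def iso_def)
  have xy: "x \<in> carrier G" "y \<in> carrier G" "generate G {x, y} = carrier G"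
    using assms(4) by (auto simp: generating_pair_def)
  have "generate H {h x, h y} = h ` carrier G" using generate_img[of "{x, y}"] xy by simp
  also have "\<dots> = carrier H" using h by (auto simp: iso_def bij_betw_def)
  finally show ?thesis
    unfolding two_generated_def generating_pair_def
    by (intro exI[of _ "h x"] exI[of _ "h y"]) (use xy in simp)
qed

lemma parameter_group_iso:
  assumes S: "parameter_group p t S x y c" and T: "parameter_group p t' T x' y' c'"
    and iso: "as_monoid T \<cong> as_monoid S" and t': "\<not> p dvd t'"
  shows "[t = t'] (mod p)"
proof -
  interpret S: parameter_group p t S x y c by (rule S)
  interpret T: parameter_group p t' T x' y' c' by (rule T)
  obtain h where h: "h \<in> iso (as_monoid T) (as_monoid S)" using iso by (auto simp: is_iso_def)
  have g: "ghom T h" and b: "h ` T = S" using h by (auto simp: iso_def hom_def ghom_def bij_betw_def)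
  have hm: "h (u * v) = h u * h v" if "u \<in> T" "v \<in> T" for u v using ghom_mult[OF g that] .
  have hp: "h (u ^ n) = h u ^ n" if "u \<in> T" for u n using ghom_pow[OF g T.S(1) that] .
  show ?thesis
  proof (rule S.parameter_unique[OF _ _ _ _ t', of "h x'" "h y'" "h c'"])
    show "gen {h x', h y'} = S" using ghom_gen[OF g T.S(1), of "{x', y'}"] T.xy T.S b by (simp add: gpair_def)
    show "h y' * h x' = h x' * h y' * h c'"
      using arg_cong[OF T.yx, of h] T.S T.cS by (simp add: hm sg_mult)
    show "h c' * h x' = h x' * h c' * h y' ^ (2 * p)"
      using arg_cong[OF T.cx, of h] T.S T.cS by (simp add: hm hp sg_mult sg_pow)
    show "h c' * h y' = h y' * h c' * (h x' ^ (2 * p * t') * h y' ^ (2 * p))"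
      using arg_cong[OF T.cy, of h] T.S T.cS by (simp add: hm hp sg_mult sg_pow)
  qed
qed

text \<open>The parameters \<open>1, ..., p - 1\<close> give pairwise non-isomorphic groups;
  \<open>0\<close> is left out because \<open>parameter_unique\<close> wants a parameter prime to
  \<open>p\<close>.\<close>

lemma num_two_generated_ge:
  assumes p: "prime p" "5 < p" and fin: "finite (groups_of_order (p ^ 5) // iso_rel)"
  shows "p - 1 \<le> num_two_generated (p ^ 5)"
proof -
  have "\<exists>S x y c. parameter_group p t (S :: nil3 set sym set) x y c" for t
    by (rule parameter_group_exists[OF p])
  then obtain S x y c where S: "\<And>t. parameter_group p t (S t :: nil3 set sym set) (x t) (y t) (c t)" by metis
  have sgS: "subgrp (S t)" "finite (S t)" "card (S t) = p ^ 5" for t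
    using parameter_group.xy[OF S[of t]] by (auto simp: gpair_def)
  have "\<exists>G :: nat monoid. group G \<and> as_monoid (S t) \<cong> G" for t using nat_model[OF sgS(1,2)] by metis
  then obtain G :: "nat \<Rightarrow> nat monoid" where G: "\<And>t. group (G t)" "\<And>t. as_monoid (S t) \<cong> G t" by metis
  let ?T = "{G \<in> groups_of_order (p ^ 5). two_generated G}"
  have T: "G t \<in> ?T" for t
  proof -
    have "card (carrier (G t)) = p ^ 5"
      using iso_same_card[OF G(2)[of t]] sgS(3)[of t] by simp
    moreover have "finite (carrier (G t))" using calculation p by (intro card_ge_0_finite) simp
    moreover have "generating_pair (as_monoid (S t)) (x t) (y t)"
      using parameter_group.S[OF S[of t]] parameter_group.xy[OF S[of t]] generate_mon[OF sgS(1)[of t], of "{x t, y t}"]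
      by (simp add: generating_pair_def gpair_def)
    ultimately show ?thesis
      using G two_generated_iso[OF mon_group[OF sgS(1)] G(1) G(2)]
      by (auto simp: groups_of_order_def Coset.order_def)
  qed
  have "inj_on (\<lambda>t. iso_rel `` {G t}) {1..<p}"
  proof (rule inj_onI)
    fix t t' assume t: "t \<in> {1..<p}" "t' \<in> {1..<p}" and eq: "iso_rel `` {G t} = iso_rel `` {G t'}"
    have "(G t, G t) \<in> iso_rel" using G by (auto simp: iso_rel_def iso_refl)
    hence "G t \<in> iso_rel `` {G t'}" by (simp flip: eq)
    hence "G t' \<cong> G t" by (simp add: iso_rel_def)
    from iso_trans[OF G(2)[of t'] iso_trans[OF this group.iso_sym[OF mon_group[OF sgS(1)[of t]] G(2)[of t]]]]
    have "as_monoid (S t') \<cong> as_monoid (S t)" .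
    moreover have "\<not> p dvd t'" using t by (auto dest: dvd_imp_le)
    ultimately have "[t = t'] (mod p)" by (rule parameter_group_iso[OF S[of t] S[of t']])
    thus "t = t'" using t by (simp add: cong_less_modulus_unique_nat)
  qed
  moreover have "(\<lambda>t. iso_rel `` {G t}) ` {1..<p} \<subseteq> ?T // iso_rel" using T by (auto simp: quotient_def)
  moreover have "finite (?T // iso_rel)"
    by (rule finite_subset[OF _ fin]) (auto simp: quotient_def)
  ultimately have "card {1..<p} \<le> card (?T // iso_rel)" by (rule card_inj_on_le)
  thus ?thesis by (simp add: num_two_generated_def)
qed

section \<open>Counting isomorphism classes\<close>

lemma (in group) gpair_cay:
  assumes "finite (carrier G)" "order G = p ^ 5" "prime p" "5 < p" "generating_pair G x y"
  shows "gpair p (cayley G ` carrier G) (cayley G x) (cayley G y)"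
  using assms gen_cay[of "{x, y}"] sg_cay[OF subgroup_self] card_image[OF cay_inj]
  by (auto simp: gpair_def generating_pair_def Coset.order_def)

lemma (in group) Sigma_set_elim:
  assumes "a \<in> Sigma_set G x y" "x \<in> carrier G" "y \<in> carrier G"
  obtains u i g where "u \<in> {cayley G x, cayley G y, cayley G x * cayley G y}" "g \<in> cayley G ` carrier G"
    "a \<in> carrier G" "cayley G a = ginv g * u ^ i * g"
proof -
  obtain u i g where u: "u \<in> {x, y, x \<otimes> y}" and g: "g \<in> carrier G" and a: "a = conj_by G (u [^] (i::nat)) g"
    using assms(1) by (auto simp: Sigma_set_def)
  have uG: "u \<in> carrier G" using u assms by auto
  show ?thesis
  proof (rule that)
    show "cayley G u \<in> {cayley G x, cayley G y, cayley G x * cayley G y}" using u assms by (auto simp: cay_mult)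
    show "cayley G g \<in> cayley G ` carrier G" using g by auto
    show "a \<in> carrier G" using a uG g by (simp add: conj_by_def)
    show "cayley G a = ginv (cayley G g) * cayley G u ^ i * cayley G g"
      using a uG g by (simp add: conj_by_def cay_mult cay_inv cay_pow)
  qed
qed

lemma (in group) one_in_Sigma_set:
  assumes "finite (carrier G)" "x \<in> carrier G"
  shows "\<one> \<in> Sigma_set G x y"
proof -
  have "order G \<in> {1..order G}" using order_gt_0_iff_finite assms(1) by auto
  moreover have "conj_by G (x [^] order G) \<one> = \<one>" using assms by (simp add: conj_by_def pow_order_eq_1)
  ultimately show ?thesis
    unfolding Sigma_set_def by (intro UN_I[of "order G"] UN_I[of \<one>]) auto
qed

text \<open>Pulled back along the Cayley embedding, an element common to both sets is a conjugate of
  a power from each triple, which separation makes trivial.\<close>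

lemma (in group) beauville_if_separated:
  assumes fin: "finite (carrier G)" and sep: "separated (cayley G ` carrier G)"
  shows "beauville_group G"
proof -
  obtain X1 Y1 X2 Y2 where XY: "{X1, Y1, X2, Y2} \<subseteq> cayley G ` carrier G"
    and gX: "gen {X1, Y1} = cayley G ` carrier G" "gen {X2, Y2} = cayley G ` carrier G"
    and sX: "\<forall>u\<in>{X1, Y1, X1 * Y1}. \<forall>v\<in>{X2, Y2, X2 * Y2}. \<forall>i j. \<forall>g\<in>cayley G ` carrier G. \<forall>h\<in>cayley G ` carrier G.
        ginv g * u ^ i * g = ginv h * v ^ j * h \<longrightarrow> u ^ i = 1"
    using sep unfolding separated_def by (elim exE conjE) (rule that)
  obtain x1 y1 x2 y2 where xy: "x1 \<in> carrier G" "y1 \<in> carrier G" "x2 \<in> carrier G" "y2 \<in> carrier G"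
    and eq: "X1 = cayley G x1" "Y1 = cayley G y1" "X2 = cayley G x2" "Y2 = cayley G y2"
    using XY by auto
  note g = gX[unfolded eq]
  have s: "u ^ i = 1" if "u \<in> {cayley G x1, cayley G y1, cayley G x1 * cayley G y1}"
    "v \<in> {cayley G x2, cayley G y2, cayley G x2 * cayley G y2}" "g \<in> cayley G ` carrier G" "h \<in> cayley G ` carrier G"
    "ginv g * u ^ i * g = ginv h * v ^ j * h" for u v i j g h
    using sX[unfolded eq] that by blast
  have gp: "generating_pair G x y" if "x \<in> carrier G" "y \<in> carrier G"
      "gen {cayley G x, cayley G y} = cayley G ` carrier G" for x y
  proof -
    have "cayley G ` generate G {x, y} = cayley G ` carrier G" using gen_cay[of "{x, y}"] that by simp
    hence "generate G {x, y} = carrier G"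
      using inj_on_image_eq_iff[OF cay_inj generate_incl[of "{x, y}"] subset_refl] that by simp
    thus ?thesis using that by (simp add: generating_pair_def)
  qed
  have "Sigma_set G x1 y1 \<inter> Sigma_set G x2 y2 = {\<one>}"
  proof
    show "{\<one>} \<subseteq> Sigma_set G x1 y1 \<inter> Sigma_set G x2 y2" using one_in_Sigma_set fin xy by auto
    show "Sigma_set G x1 y1 \<inter> Sigma_set G x2 y2 \<subseteq> {\<one>}"
    proof
      fix a assume a: "a \<in> Sigma_set G x1 y1 \<inter> Sigma_set G x2 y2"
      obtain u i g where u: "u \<in> {cayley G x1, cayley G y1, cayley G x1 * cayley G y1}" "g \<in> cayley G ` carrier G"
          "a \<in> carrier G" "cayley G a = ginv g * u ^ i * g"
        by (rule Sigma_set_elim[of a x1 y1]) (use a xy in auto)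
      obtain v j h where v: "v \<in> {cayley G x2, cayley G y2, cayley G x2 * cayley G y2}" "h \<in> cayley G ` carrier G"
          "cayley G a = ginv h * v ^ j * h"
        by (rule Sigma_set_elim[of a x2 y2]) (use a xy in auto)
      have "u ^ i = 1" by (rule s[OF u(1) v(1) u(2) v(2), where j = j]) (use u(4) v(3) in simp)
      hence "cayley G a = cayley G \<one>" using u(4) by (simp add: cay_one)
      thus "a \<in> {\<one>}" using inj_onD[OF cay_inj] u(3) by auto
    qed
  qed
  hence "beauville_structure G (x1, y1) (x2, y2)"
    using gp[OF xy(1,2) g(1)] gp[OF xy(3,4) g(2)] by (simp add: beauville_structure_def)
  thus ?thesis unfolding beauville_group_def using fin is_group by blast
qed

lemma beauville_two_generated: "beauville_group G \<Longrightarrow> two_generated G"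
  by (auto simp: beauville_group_def beauville_structure_def two_generated_def)

text \<open>Multiplication tables on \<open>{..<n}\<close> serve as descriptions. Finiteness gives
  the cardinalities their meaning, as \<open>card\<close> of an infinite set is
  \<open>0\<close>.\<close>

lemma finite_iso_classes: "finite (groups_of_order n // iso_rel)"
proof -
  define P where "P G t \<longleftrightarrow> (\<exists>b. bij_betw b {..<n} (carrier G) \<and>
      (\<forall>i<n. \<forall>j<n. t (i, j) < n \<and> b (t (i, j)) = b i \<otimes>\<^bsub>G\<^esub> b j))" for G :: "nat monoid" and t :: "nat \<times> nat \<Rightarrow> nat"
  have "finite (groups_of_order n // iso_rel) \<and>
      card (groups_of_order n // iso_rel) \<le> card (({..<n} \<times> {..<n}) \<rightarrow>\<^sub>E {..<n})"
  proof (rule card_iso_classes_le)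
    show "group G" if "G \<in> groups_of_order n" for G using that by (simp add: groups_of_order_def)
    show "finite (({..<n} \<times> {..<n}) \<rightarrow>\<^sub>E {..<n})" by (intro finite_PiE) auto
    show "\<exists>t\<in>({..<n} \<times> {..<n}) \<rightarrow>\<^sub>E {..<n}. P G t" if G: "G \<in> groups_of_order n" for G
    proof -
      interpret group G using G by (simp add: groups_of_order_def)
      obtain b where b: "bij_betw b {..<n} (carrier G)"
        using G ex_bij_betw_nat_finite[of "carrier G"]
        by (auto simp: groups_of_order_def Coset.order_def atLeast0LessThan)
      define t where "t = (\<lambda>ij\<in>{..<n} \<times> {..<n}. the_inv_into {..<n} b (b (fst ij) \<otimes>\<^bsub>G\<^esub> b (snd ij)))"
      have bc: "b i \<otimes>\<^bsub>G\<^esub> b j \<in> b ` {..<n}" if "i < n" "j < n" for i j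
        using that b by (auto simp: bij_betw_def)
      have "t (i, j) < n \<and> b (t (i, j)) = b i \<otimes>\<^bsub>G\<^esub> b j" if ij: "i < n" "j < n" for i j
        using the_inv_into_into[OF bij_betw_imp_inj_on[OF b] bc[OF ij] subset_refl]
          f_the_inv_into_f[OF bij_betw_imp_inj_on[OF b] bc[OF ij]] ij by (simp add: t_def)
      thus ?thesis using b by (intro bexI[of _ t]) (auto simp: P_def t_def)
    qed
    show "G \<cong> H" if G: "G \<in> groups_of_order n" and H: "H \<in> groups_of_order n" and PP: "P G t" "P H t" for G H t
    proof -
      obtain b where b: "bij_betw b {..<n} (carrier G)" "\<And>i j. i < n \<Longrightarrow> j < n \<Longrightarrow> t (i, j) < n \<and> b (t (i, j)) = b i \<otimes>\<^bsub>G\<^esub> b j"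
        using PP by (auto simp: P_def)
      obtain b' where b': "bij_betw b' {..<n} (carrier H)" "\<And>i j. i < n \<Longrightarrow> j < n \<Longrightarrow> t (i, j) < n \<and> b' (t (i, j)) = b' i \<otimes>\<^bsub>H\<^esub> b' j"
        using PP by (auto simp: P_def)
      interpret group G using G by (simp add: groups_of_order_def)
      let ?h = "b' \<circ> the_inv_into {..<n} b"
      have bij: "bij_betw ?h (carrier G) (carrier H)"
        by (rule bij_betw_trans[OF bij_betw_the_inv_into[OF b(1)] b'(1)])
      have inj: "inj_on b {..<n}" using b(1) by (simp add: bij_betw_def)
      have "?h (u \<otimes>\<^bsub>G\<^esub> v) = ?h u \<otimes>\<^bsub>H\<^esub> ?h v" if uv: "u \<in> carrier G" "v \<in> carrier G" for u v
      proof -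
        have "u \<in> b ` {..<n}" "v \<in> b ` {..<n}" using uv b(1) by (auto simp: bij_betw_def)
        then obtain i j where ij: "i < n" "u = b i" "j < n" "v = b j" by auto
        thus ?thesis using conjunct2[OF b(2)[OF ij(1,3)], symmetric] conjunct1[OF b(2)[OF ij(1,3)]] b'(2)[OF ij(1,3)]
          by (simp add: the_inv_into_f_f[OF inj])
      qed
      hence "?h \<in> iso G H" using bij bij_betwE[OF bij] by (auto simp: iso_def hom_def)
      thus ?thesis by (auto simp: is_iso_def)
    qed
  qed
  thus ?thesis by simp
qed

text \<open>A group that is not Beauville is not separated, so it has a bounded presentation, and
  its list of codes determines it up to isomorphism.\<close>

lemma card_not_beauville_le:
  assumes p: "prime p" "5 < p"
  shows "card ({G \<in> groups_of_order (p ^ 5). two_generated G \<and> \<not> beauville_group G} // iso_rel) \<le> card codes"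
proof -
  define P where "P G cs \<longleftrightarrow> (\<exists>gs. length gs = 5 \<and> gen (set gs) = cayley G ` carrier G \<and> pc_presentation p (exponent p) gs cs)"
    for G :: "nat monoid" and cs
  let ?A = "{G \<in> groups_of_order (p ^ 5). two_generated G \<and> \<not> beauville_group G}"
  have "finite (?A // iso_rel) \<and> card (?A // iso_rel) \<le> card codes"
  proof (rule card_iso_classes_le)
    show "group G" if "G \<in> ?A" for G using that by (simp add: groups_of_order_def)
    show "finite codes" by (rule finite_codes)
    show "\<exists>cs\<in>codes. P G cs" if G: "G \<in> ?A" for G
    proof -
      interpret group G using G by (simp add: groups_of_order_def)
      obtain x y where "generating_pair G x y" using G by (auto simp: two_generated_def)
      hence "gpair p (cayley G ` carrier G) (cayley G x) (cayley G y)"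
        using G p by (intro gpair_cay) (auto simp: groups_of_order_def)
      hence "bounded_presentation p (cayley G ` carrier G)"
        using classification beauville_if_separated G by (auto simp: groups_of_order_def)
      then obtain gs where gs: "length gs = 5" "gen (set gs) = cayley G ` carrier G" "bounded_pc p (exponent p) gs"
        by (auto simp: bounded_presentation_def)
      obtain cs where "cs \<in> codes" "pc_presentation p (exponent p) gs cs" using bounded_pc_codes[OF gs(3)] gs(1) by auto
      thus ?thesis using gs by (auto simp: P_def)
    qed
    show "G \<cong> H" if G: "G \<in> ?A" and H: "H \<in> ?A" and PP: "P G cs" "P H cs" for G H cs
    proof -
      have gr: "group G" "group H" using G H by (auto simp: groups_of_order_def)
      obtain gs where gs: "length gs = 5" "gen (set gs) = cayley G ` carrier G" "pc_presentation p (exponent p) gs cs"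
        using PP by (auto simp: P_def)
      obtain hs where hs: "length hs = 5" "gen (set hs) = cayley H ` carrier H" "pc_presentation p (exponent p) hs cs"
        using PP by (auto simp: P_def)
      have "card (gen (set gs)) = p ^ 5" "card (gen (set hs)) = p ^ 5"
        using G H card_image[OF group.cay_inj[OF gr(1)]] card_image[OF group.cay_inj[OF gr(2)]]
        unfolding gs hs by (auto simp: groups_of_order_def Coset.order_def)
      then obtain \<phi> where "bij_betw \<phi> (gen (set gs)) (gen (set hs))" "ghom (gen (set gs)) \<phi>"
        using pc_rel_isomorphic[OF gs(3) hs(3) _ gs(1) hs(1)] p by auto
      thus ?thesis using cay_iso[OF gr] gs hs by simp
    qed
  qed
  thus ?thesis by simp
qed

lemma num_beauville_bounds:
  assumes p: "prime p" "5 < p"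
  shows "num_beauville (p ^ 5) \<le> num_two_generated (p ^ 5)"
    and "num_two_generated (p ^ 5) \<le> num_beauville (p ^ 5) + card codes"
proof -
  let ?T = "{G \<in> groups_of_order (p ^ 5). two_generated G}"
  let ?B = "{G \<in> groups_of_order (p ^ 5). beauville_group G}"
  let ?N = "{G \<in> groups_of_order (p ^ 5). two_generated G \<and> \<not> beauville_group G}"
  have fin: "finite (A // iso_rel)" if "A \<subseteq> groups_of_order (p ^ 5)" for A
    by (rule finite_subset[OF _ finite_iso_classes[of "p ^ 5"]]) (use that in \<open>auto simp: quotient_def\<close>)
  have sub: "?B // iso_rel \<subseteq> ?T // iso_rel" using beauville_two_generated by (auto simp: quotient_def)
  have "card (?B // iso_rel) \<le> card (?T // iso_rel)" by (rule card_mono[OF fin sub]) auto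
  thus "num_beauville (p ^ 5) \<le> num_two_generated (p ^ 5)"
    by (simp add: num_beauville_def num_two_generated_def)
  have "?T // iso_rel \<subseteq> ?B // iso_rel \<union> ?N // iso_rel" by (auto simp: quotient_def)
  hence "card (?T // iso_rel) \<le> card (?B // iso_rel \<union> ?N // iso_rel)"
    by (intro card_mono) (auto intro!: fin)
  also have "\<dots> \<le> card (?B // iso_rel) + card (?N // iso_rel)" by (rule card_Un_le)
  also have "\<dots> \<le> card (?B // iso_rel) + card codes" using card_not_beauville_le[OF p] by simp
  finally show "num_two_generated (p ^ 5) \<le> num_beauville (p ^ 5) + card codes"
    by (simp add: num_beauville_def num_two_generated_def)
qed

theorem corollary5:
  shows "((\<lambda>p::nat. real (num_beauville (p ^ 5)) / real (num_two_generated (p ^ 5)))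
           \<longlongrightarrow> 1) (inf at_top (principal {p. Factorial_Ring.prime p}))"
proof (rule tendsto_sandwich)
  let ?F = "inf at_top (principal {p. Factorial_Ring.prime p}) :: nat filter"
  have ev: "eventually (\<lambda>p. prime p \<and> 5 < p) ?F"
    by (auto simp: eventually_inf_principal intro: eventually_mono[OF eventually_gt_at_top[of 5]])
  show "eventually (\<lambda>p. 1 - real (card codes) / real (p - 1)
      \<le> real (num_beauville (p ^ 5)) / real (num_two_generated (p ^ 5))) ?F"
    using ev
  proof eventually_elim
    case (elim p)
    define h g where "h = real (num_two_generated (p ^ 5))" and "g = real (num_beauville (p ^ 5))"
    have h: "real (p - 1) \<le> h" "0 < real (p - 1)" "h \<le> g + real (card codes)"
      using num_two_generated_ge[of p, OF _ _ finite_iso_classes] num_beauville_bounds(2)[of p] elim by (auto simp: h_def g_def)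
    \<comment> \<open>The number of codes does not depend on \<open>p\<close>, while
      \<open>h\<close> is at least \<open>p - 1\<close>, so the defect tends to
      \<open>0\<close>.\<close>
    have "1 - real (card codes) / real (p - 1) \<le> 1 - real (card codes) / h"
      using h by (simp add: frac_le)
    also have "\<dots> = (h - real (card codes)) / h" using h by (simp add: diff_divide_distrib)
    also have "\<dots> \<le> g / h" using h by (intro divide_right_mono) auto
    finally show ?case by (simp add: h_def g_def)
  qed
  show "eventually (\<lambda>p. real (num_beauville (p ^ 5)) / real (num_two_generated (p ^ 5)) \<le> 1) ?F"
    using ev
  proof eventually_elim
    case (elim p)
    thus ?case using num_beauville_bounds(1)[of p] by (auto simp: divide_le_eq_1)
  qed
  have "((\<lambda>p::nat. 1 - real (card codes) / real (p - 1)) \<longlongrightarrow> 1 - 0) at_top"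
    by (intro tendsto_diff tendsto_const real_tendsto_divide_at_top[OF tendsto_const]
        filterlim_compose[OF filterlim_real_sequentially] filterlim_minus_const_nat_at_top)
  thus "((\<lambda>p::nat. 1 - real (card codes) / real (p - 1)) \<longlongrightarrow> 1) ?F"
    by (intro tendsto_mono[OF inf_le1]) simp
qed (rule tendsto_const)

end
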